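(* On Riemannian manifolds $(M,g)$ of dimension $n\ge3$, $n\ne4$, the GJMS-operator $P_6$ is given by $$P_6=\Delta^3+\Delta\,\delta\,T_2\,d+\delta\,T_2\,d\,\Delta+\left(\tfrac n2-1\right)\Delta(\mathsf J\Delta)+\delta\,T_4\,d-\left(\tfrac n2-3\right)Q_6$$ with $$T_2=(n-2)\mathsf J-8\mathsf P,$$ $$T_4=-\left(3\left(\tfrac n2-1\right)^2-4\right)\mathsf J^2+4(n-4)|\mathsf P|^2+16\left(\tfrac n2-1\right)\mathsf J\,\mathsf P+(n-6)\Delta\mathsf J-48\,\mathsf P^2-\frac{16}{n-4}\mathcal B$$ and $$Q_6=-3!\,2!\,2^5v_6-\left(\tfrac n2+1\right)\Delta(\mathsf J^2)+4\Delta(|\mathsf P|^2)-8\,\delta(\mathsf P\,d\mathsf J)+\Delta^2\mathsf J-\left(\tfrac n2-3\right)\mathsf J\Delta\mathsf J-4(n-6)\mathsf J|\mathsf P|^2+\frac{(n-6)(n+6)}{4}\mathsf J^3,$$ where $v_6=-\frac18\mathrm{tr}(\wedge^3\mathsf P)-\frac{1}{24(n-4)}(\mathcal B,\mathsf P)$.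
   Context: $\delta$ is the formal adjoint of $d$ with respect to $g$ and $\Delta=-\delta d$ (so $-\Delta\ge0$). $\mathsf J=\frac{\mathrm{scal}}{2(n-1)}$; $\mathsf P$ is the Schouten tensor, $(n-2)\mathsf P=\mathrm{Ric}-\mathsf Jg$; $|\mathsf P|^2=\mathsf P_{ij}\mathsf P^{ij}$; $\mathrm{tr}(\wedge^3\mathsf P)$ is the third elementary symmetric function of the eigenvalues of $\mathsf P$; $(\mathcal B,\mathsf P)=\mathcal B_{ij}\mathsf P^{ij}$. The Bach tensor is $\mathcal B_{ij}=\Delta(\mathsf P)_{ij}-\nabla^k\nabla_j(\mathsf P)_{ik}+\mathsf P^{kl}W_{kijl}$, where $W$ is the Weyl tensor in the sign convention for which the curvature tensor satisfies $\mathrm{Ric}_{jk}=R^{i}{}_{jki}$ (opposite to Fefferman–Graham). Symmetric 2-tensors are regarded, using $g$, as endomorphisms of one-forms; scalar functions act as multiples of the identity. $\Delta(\mathsf J\Delta)$ denotes $u\mapsto\Delta(\mathsf J\,\Delta u)$, and $\delta Td$ denotes $u\mapsto\delta(T\,du)$. GJMS-operator $P_{2N}$ in dimension $n$ (all $N\ge1$ for odd $n$, $2N\le n$ for even $n$): let $g_+=r^{-2}(dr^2+g_r)$, $g_0=g$, $g_r$ even in $r$, be a Poincaré–Einstein metric, i.e. $\mathrm{Ric}(g_+)+ng_+=0$ asymptotically at $r=0$ (to infinite order for odd $n$; for even $n$: $O(r^{n-2})$ with vanishing $g$-trace of the coefficient of $r^{n-2}$), and let $\tilde g=2t\,dt\,d\rho+2\rho\,dt^2+t^2g(\rho)$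 with $g(\rho)=g_r$ for $\rho=-r^2/2$ be the ambient metric. Then $P_{2N}u=\Delta_{\tilde g}^N(t^{N-n/2}\tilde u)|_{\rho=0,t=1}$ for any smooth extension $\tilde u(x,\rho)$ of $u\in C^\infty(M)$. *)

theory Defs
  imports "HOL-Analysis.Analysis" "HOL-Library.Landau_Symbols"
begin

section \<open>Smooth functions and partial derivatives\<close>

text \<open>Only used for open \<open>S\<close> and finite-dimensional domains.\<close>

fun Ck_on :: "nat \<Rightarrow> 'a::real_normed_vector set \<Rightarrow> ('a \<Rightarrow> 'b::real_normed_vector) \<Rightarrow> bool" where
  "Ck_on 0 S f \<longleftrightarrow> continuous_on S f"
| "Ck_on (Suc k) S f \<longleftrightarrow>
     f differentiable_on S \<and> (\<forall>v. Ck_on k S (\<lambda>x. frechet_derivative f (at x) v))"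

definition smooth_on :: "'a::real_normed_vector set \<Rightarrow> ('a \<Rightarrow> 'b::real_normed_vector) \<Rightarrow> bool" where
  "smooth_on S f \<longleftrightarrow> (\<forall>k. Ck_on k S f)"

definition pd :: "'k::finite \<Rightarrow> (real^'k \<Rightarrow> real) \<Rightarrow> real^'k \<Rightarrow> real" where
  "pd i f x = frechet_derivative f (at x) (axis i 1)"

section \<open>Manifolds and covariant 2-tensors\<close>

text \<open>A chart is a pair \<open>(U, \<phi>)\<close>; only the values of \<open>\<phi>\<close> on \<open>U\<close> matter.\<close>

type_synonym ('m, 'n) chart = "'m set \<times> ('m \<Rightarrow> real^'n)"

definition chart_image :: "('m, 'n::finite) chart \<Rightarrow> (real^'n) set" where
  "chart_image c = snd c ` fst c"

definition chart_inv :: "('m, 'n::finite) chart \<Rightarrow> real^'n \<Rightarrow> 'm" where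
  "chart_inv c = inv_into (fst c) (snd c)"

definition smooth_manifold :: "'m topology \<Rightarrow> ('m, 'n::finite) chart set \<Rightarrow> bool" where
  "smooth_manifold X A \<longleftrightarrow>
     Hausdorff_space X \<and> second_countable X \<and>
     (\<Union>c\<in>A. fst c) = topspace X \<and>
     (\<forall>c\<in>A. openin X (fst c) \<and> open (chart_image c) \<and>
        homeomorphic_map (subtopology X (fst c)) (top_of_set (chart_image c)) (snd c)) \<and>
     (\<forall>c\<in>A. \<forall>e\<in>A. smooth_on (snd c ` (fst c \<inter> fst e)) (snd e \<circ> chart_inv c))"

definition smooth_function :: "('m, 'n::finite) chart set \<Rightarrow> ('m \<Rightarrow> real) \<Rightarrow> bool" where
  "smooth_function A u \<longleftrightarrow> (\<forall>c\<in>A. smooth_on (chart_image c) (u \<circ> chart_inv c))"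

text \<open>A covariant 2-tensor field is given by its component matrices in the charts of the atlas,
  \<open>g c y\<close> being the matrix at the point with coordinates \<open>y \<in> chart_image c\<close>; the components in
  different charts are related by the tensor transformation law.\<close>

type_synonym ('m, 'n) tensor2 = "('m, 'n) chart \<Rightarrow> real^'n \<Rightarrow> real^'n^'n"

definition transition_jacobian ::
    "('m, 'n::finite) chart \<Rightarrow> ('m, 'n) chart \<Rightarrow> real^'n \<Rightarrow> real^'n^'n" where
  "transition_jacobian c e y = matrix (frechet_derivative (snd e \<circ> chart_inv c) (at y))"

definition tensor2_law_at :: "('m, 'n::finite) chart set \<Rightarrow> ('m, 'n) tensor2 \<Rightarrow> 'm \<Rightarrow> bool" where
  "tensor2_law_at A S p \<longleftrightarrow>
     (\<forall>c\<in>A. \<forall>e\<in>A. p \<in> fst c \<inter> fst e \<longrightarrow>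
        (let J = transition_jacobian c e (snd c p)
         in S c (snd c p) = transpose J ** S e (snd e p) ** J))"

definition positive_definite :: "real^'n^'n::finite \<Rightarrow> bool" where
  "positive_definite B \<longleftrightarrow> transpose B = B \<and> (\<forall>v. v \<noteq> 0 \<longrightarrow> v \<bullet> (B *v v) > 0)"

definition riemannian_metric ::
    "'m topology \<Rightarrow> ('m, 'n::finite) chart set \<Rightarrow> ('m, 'n) tensor2 \<Rightarrow> bool" where
  "riemannian_metric X A g \<longleftrightarrow>
     (\<forall>p\<in>topspace X. tensor2_law_at A g p) \<and>
     (\<forall>c\<in>A. smooth_on (chart_image c) (g c) \<and> (\<forall>y\<in>chart_image c. positive_definite (g c y)))"

text \<open>Objects depending on an additional real parameter near \<open>0\<close> live on an open neighbourhood \<open>D\<close>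
  of \<open>M \<times> {0}\<close> in \<open>M \<times> \<real>\<close>; on a non-compact manifold the size of the parameter interval may
  depend on the point.\<close>

definition zero_section_nbhd :: "'m topology \<Rightarrow> ('m \<times> real) set \<Rightarrow> bool" where
  "zero_section_nbhd X D \<longleftrightarrow>
     openin (prod_topology X euclideanreal) D \<and> (\<forall>p\<in>topspace X. (p, 0) \<in> D)"

definition chart_domain :: "('m, 'n::finite) chart \<Rightarrow> ('m \<times> real) set \<Rightarrow> ((real^'n) \<times> real) set" where
  "chart_domain c D = {(y, s). y \<in> chart_image c \<and> (chart_inv c y, s) \<in> D}"

definition metric_family ::
    "('m, 'n::finite) chart set \<Rightarrow> ('m \<times> real) set \<Rightarrow> (real \<Rightarrow> ('m, 'n) tensor2) \<Rightarrow> bool" where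
  "metric_family A D h \<longleftrightarrow>
     (\<forall>(p, s)\<in>D. tensor2_law_at A (h s) p) \<and>
     (\<forall>c\<in>A. smooth_on (chart_domain c D) (\<lambda>(y, s). h s c y) \<and>
        (\<forall>(y, s)\<in>chart_domain c D. positive_definite (h s c y)))"

definition smooth_extension ::
    "'m topology \<Rightarrow> ('m, 'n::finite) chart set \<Rightarrow> ('m \<times> real) set \<Rightarrow>
     ('m \<Rightarrow> real) \<Rightarrow> ('m \<Rightarrow> real \<Rightarrow> real) \<Rightarrow> bool" where
  "smooth_extension X A D u U \<longleftrightarrow>
     (\<forall>p\<in>topspace X. U p 0 = u p) \<and>
     (\<forall>c\<in>A. smooth_on (chart_domain c D) (\<lambda>(y, s). U (chart_inv c y) s))"

section \<open>Pseudo-Riemannian geometry in local coordinates\<close>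

text \<open>Throughout, \<open>G\<close> is the component matrix of a pseudo-Riemannian metric on an open subset of
  \<open>real^'k\<close>.\<close>

definition ginv :: "(real^'k \<Rightarrow> real^'k^'k) \<Rightarrow> real^'k \<Rightarrow> real^'k^'k::finite" where
  "ginv G x = matrix_inv (G x)"

text \<open>\<open>christoffel G i j k\<close> is $\Gamma^i_{jk}$.\<close>

definition christoffel ::
    "(real^'k \<Rightarrow> real^'k^'k) \<Rightarrow> 'k::finite \<Rightarrow> 'k \<Rightarrow> 'k \<Rightarrow> real^'k \<Rightarrow> real" where
  "christoffel G i j k x =
     (\<Sum>l\<in>UNIV. ginv G x $ i $ l *
        (pd j (\<lambda>y. G y $ l $ k) x + pd k (\<lambda>y. G y $ l $ j) x - pd l (\<lambda>y. G y $ j $ k) x)) / 2"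

text \<open>\<open>curvature_up G i j k l\<close> is $R^i{}_{jkl}$ and \<open>curvature G i j k l\<close> is $R_{ijkl}$, with the
  sign for which $\mathrm{Ric}_{jk} = R^i{}_{jki}$ is positive on round spheres, so that
  $R_{ijkl} = g_{il} g_{jk} - g_{ik} g_{jl}$ on the unit sphere.\<close>

definition curvature_up ::
    "(real^'k \<Rightarrow> real^'k^'k) \<Rightarrow> 'k::finite \<Rightarrow> 'k \<Rightarrow> 'k \<Rightarrow> 'k \<Rightarrow> real^'k \<Rightarrow> real" where
  "curvature_up G i j k l x =
     pd l (christoffel G i j k) x - pd k (christoffel G i j l) x
     + (\<Sum>m\<in>UNIV. christoffel G i l m x * christoffel G m j k x
                - christoffel G i k m x * christoffel G m j l x)"

definition curvature ::
    "(real^'k \<Rightarrow> real^'k^'k) \<Rightarrow> 'k::finite \<Rightarrow> 'k \<Rightarrow> 'k \<Rightarrow> 'k \<Rightarrow> real^'k \<Rightarrow> real" where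
  "curvature G i j k l x = (\<Sum>m\<in>UNIV. G x $ i $ m * curvature_up G m j k l x)"

definition ricci :: "(real^'k \<Rightarrow> real^'k^'k) \<Rightarrow> real^'k \<Rightarrow> real^'k^'k::finite" where
  "ricci G x = (\<chi> j k. \<Sum>i\<in>UNIV. curvature_up G i j k i x)"

definition scal :: "(real^'k \<Rightarrow> real^'k^'k) \<Rightarrow> real^'k::finite \<Rightarrow> real" where
  "scal G x = (\<Sum>j\<in>UNIV. \<Sum>k\<in>UNIV. ginv G x $ j $ k * ricci G x $ j $ k)"

definition schouten_scalar :: "(real^'k \<Rightarrow> real^'k^'k) \<Rightarrow> real^'k::finite \<Rightarrow> real" where
  "schouten_scalar G x = scal G x / (2 * (real CARD('k) - 1))"

definition schouten :: "(real^'k \<Rightarrow> real^'k^'k) \<Rightarrow> real^'k \<Rightarrow> real^'k^'k::finite" where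
  "schouten G x = (1 / (real CARD('k) - 2)) *\<^sub>R (ricci G x - schouten_scalar G x *\<^sub>R G x)"

text \<open>In this sign convention $R_{ijkl} = W_{ijkl} - (P_{ik} g_{jl} + P_{jl} g_{ik} - P_{il} g_{jk}
  - P_{jk} g_{il})$.\<close>

definition weyl ::
    "(real^'k \<Rightarrow> real^'k^'k) \<Rightarrow> 'k::finite \<Rightarrow> 'k \<Rightarrow> 'k \<Rightarrow> 'k \<Rightarrow> real^'k \<Rightarrow> real" where
  "weyl G i j k l x =
     curvature G i j k l x
     + (schouten G x $ i $ k * G x $ j $ l + schouten G x $ j $ l * G x $ i $ k
        - schouten G x $ i $ l * G x $ j $ k - schouten G x $ j $ k * G x $ i $ l)"

text \<open>\<open>nabla G S i j k\<close> is $\nabla_k S_{ij}$ and \<open>nabla2 G S i j k l\<close> is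
  $\nabla_l \nabla_k S_{ij}$.\<close>

definition nabla ::
    "(real^'k \<Rightarrow> real^'k^'k) \<Rightarrow> (real^'k \<Rightarrow> real^'k^'k) \<Rightarrow>
     'k::finite \<Rightarrow> 'k \<Rightarrow> 'k \<Rightarrow> real^'k \<Rightarrow> real" where
  "nabla G S i j k x =
     pd k (\<lambda>y. S y $ i $ j) x
     - (\<Sum>m\<in>UNIV. christoffel G m k i x * S x $ m $ j + christoffel G m k j x * S x $ i $ m)"

definition nabla2 ::
    "(real^'k \<Rightarrow> real^'k^'k) \<Rightarrow> (real^'k \<Rightarrow> real^'k^'k) \<Rightarrow>
     'k::finite \<Rightarrow> 'k \<Rightarrow> 'k \<Rightarrow> 'k \<Rightarrow> real^'k \<Rightarrow> real" where
  "nabla2 G S i j k l x =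
     pd l (nabla G S i j k) x
     - (\<Sum>m\<in>UNIV. christoffel G m l i x * nabla G S m j k x
                + christoffel G m l j x * nabla G S i m k x
                + christoffel G m l k x * nabla G S i j m x)"

definition raise :: "(real^'k \<Rightarrow> real^'k^'k) \<Rightarrow> (real^'k \<Rightarrow> real^'k^'k) \<Rightarrow> real^'k \<Rightarrow> real^'k^'k::finite" where
  "raise G S x = ginv G x ** S x ** transpose (ginv G x)"

definition tensor_inner ::
    "(real^'k \<Rightarrow> real^'k^'k) \<Rightarrow> (real^'k \<Rightarrow> real^'k^'k) \<Rightarrow> (real^'k \<Rightarrow> real^'k^'k) \<Rightarrow>
     real^'k::finite \<Rightarrow> real" where
  "tensor_inner G S T x = (\<Sum>i\<in>UNIV. \<Sum>j\<in>UNIV. S x $ i $ j * raise G T x $ i $ j)"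

definition bach :: "(real^'k \<Rightarrow> real^'k^'k) \<Rightarrow> real^'k \<Rightarrow> real^'k^'k::finite" where
  "bach G x = (\<chi> i j.
     (\<Sum>k\<in>UNIV. \<Sum>l\<in>UNIV. ginv G x $ k $ l * nabla2 G (schouten G) i j k l x)
     - (\<Sum>k\<in>UNIV. \<Sum>l\<in>UNIV. ginv G x $ k $ l * nabla2 G (schouten G) i k j l x)
     + (\<Sum>k\<in>UNIV. \<Sum>l\<in>UNIV. raise G (schouten G) x $ k $ l * weyl G k i j l x))"

text \<open>The endomorphism $\omega_i \mapsto S_{ij} g^{jk} \omega_k$ of one-forms; matrices act on
  component vectors of one-forms by \<open>*v\<close>, and \<open>mat a\<close> is \<open>a\<close> times the identity.\<close>

definition endo :: "(real^'k \<Rightarrow> real^'k^'k) \<Rightarrow> (real^'k \<Rightarrow> real^'k^'k) \<Rightarrow> real^'k \<Rightarrow> real^'k^'k::finite" where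
  "endo G S x = S x ** ginv G x"

text \<open>\<open>lam\<close> lists the eigenvalues of \<open>B\<close> with multiplicity: the columns of \<open>V\<close> are a basis of
  eigenvectors. Endomorphisms obtained from symmetric 2-tensors by a Riemannian metric are
  diagonalizable, so in the use below such a \<open>lam\<close> exists; it is unique up to permutation.\<close>

definition eigenvalue_list :: "real^'k^'k \<Rightarrow> ('k::finite \<Rightarrow> real) \<Rightarrow> bool" where
  "eigenvalue_list B lam \<longleftrightarrow>
     (\<exists>V::real^'k^'k. invertible V \<and> (\<forall>k. B *v column k V = lam k *\<^sub>R column k V))"

definition elementary_symmetric :: "nat \<Rightarrow> ('k::finite \<Rightarrow> real) \<Rightarrow> real" where
  "elementary_symmetric r lam = (\<Sum>K\<in>{K. K \<subseteq> UNIV \<and> card K = r}. \<Prod>k\<in>K. lam k)"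

definition tr_wedge3 :: "real^'k^'k::finite \<Rightarrow> real" where
  "tr_wedge3 B = elementary_symmetric 3 (SOME lam. eigenvalue_list B lam)"

definition differential :: "(real^'k \<Rightarrow> real) \<Rightarrow> real^'k \<Rightarrow> real^'k::finite" where
  "differential f x = (\<chi> i. pd i f x)"

definition volume_density :: "(real^'k \<Rightarrow> real^'k^'k) \<Rightarrow> real^'k::finite \<Rightarrow> real" where
  "volume_density G x = sqrt \<bar>det (G x)\<bar>"

text \<open>$\delta\omega = -|g|^{-1/2} \partial_i (|g|^{1/2} g^{ij} \omega_j)$ is the formal adjoint of
  \<open>d\<close>; see \<open>codiff_formal_adjoint\<close> below.\<close>

definition codiff :: "(real^'k \<Rightarrow> real^'k^'k) \<Rightarrow> (real^'k \<Rightarrow> real^'k) \<Rightarrow> real^'k::finite \<Rightarrow> real" where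
  "codiff G \<omega> x =
     - (\<Sum>i\<in>UNIV. pd i (\<lambda>y. volume_density G y * (ginv G y *v \<omega> y) $ i) x) / volume_density G x"

definition laplacian :: "(real^'k \<Rightarrow> real^'k^'k) \<Rightarrow> (real^'k \<Rightarrow> real) \<Rightarrow> real^'k::finite \<Rightarrow> real" where
  "laplacian G f x = - codiff G (differential f) x"

subsection \<open>\<open>codiff\<close> is the formal adjoint of \<open>d\<close>\<close>

lemma differentiable_frechet:
  "f differentiable (at x) \<Longrightarrow> (f has_derivative frechet_derivative f (at x)) (at x)"
  by (simp add: frechet_derivative_works)

lemma has_derivative_pd:
  fixes f :: "real^'k::finite \<Rightarrow> real"
  assumes "(f has_derivative f') (at x)"
  shows "pd i f x = f' (axis i 1)"
  using frechet_derivative_at[OF assms] unfolding pd_def by simp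

lemma pd_mult:
  fixes f g :: "real^'k::finite \<Rightarrow> real"
  assumes "f differentiable (at x)" "g differentiable (at x)"
  shows "pd i (\<lambda>y. f y * g y) x = f x * pd i g x + pd i f x * g x"
  using has_derivative_pd[OF has_derivative_mult[OF differentiable_frechet[OF assms(1)] differentiable_frechet[OF assms(2)]]]
  unfolding pd_def .

lemma pd_add:
  fixes f g :: "real^'k::finite \<Rightarrow> real"
  assumes "f differentiable (at x)" "g differentiable (at x)"
  shows "pd i (\<lambda>y. f y + g y) x = pd i f x + pd i g x"
  using has_derivative_pd[OF has_derivative_add[OF differentiable_frechet[OF assms(1)] differentiable_frechet[OF assms(2)]]]
  unfolding pd_def .

lemma pd_cong_open:
  fixes f g :: "real^'k::finite \<Rightarrow> real"
  assumes "open S" "x \<in> S" "\<And>y. y \<in> S \<Longrightarrow> f y = g y"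
  shows "pd i f x = pd i g x" "f differentiable (at x) \<longleftrightarrow> g differentiable (at x)"
proof -
  have *: "(f has_derivative D) (at x) \<longleftrightarrow> (g has_derivative D) (at x)" for D
    by (metis assms has_derivative_transform_within_open)
  show "pd i f x = pd i g x" unfolding pd_def frechet_derivative_def * ..
  show "f differentiable (at x) \<longleftrightarrow> g differentiable (at x)"
    unfolding differentiable_def * ..
qed

lemma integral_pd_compact_support:
  fixes F :: "real^'k::finite \<Rightarrow> real"
  assumes diff: "\<And>x. F differentiable (at x)"
    and cont: "continuous_on UNIV (pd i F)"
    and K: "compact K" "\<And>x. x \<notin> K \<Longrightarrow> F x = 0"
  shows "integrable lborel (pd i F)" "integral\<^sup>L lborel (pd i F) = 0"
proof -
  let ?e = "axis i 1 :: real^'k"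
  obtain R where R: "K \<subseteq> cball 0 R"
    using compact_imp_bounded[OF K(1)] unfolding bounded_iff subset_iff mem_cball_0 by metis
  have pd0: "pd i F x = 0" if "x \<notin> K" for x
  proof -
    have "pd i F x = pd i (\<lambda>_. 0) x"
    proof (rule pd_cong_open(1))
      show "open (- K)" using compact_imp_closed[OF K(1)] by (rule open_Compl)
      show "x \<in> - K" using that by simp
      show "F y = 0" if "y \<in> - K" for y using that K(2) by simp
    qed
    also have "\<dots> = 0" by (simp add: pd_def)
    finally show ?thesis .
  qed
  have "bounded (pd i F ` K)"
    by (intro compact_imp_bounded compact_continuous_image continuous_on_subset[OF cont subset_UNIV] K(1))
  then obtain B where B0: "B > 0" and "\<forall>y\<in>pd i F ` K. norm y \<le> B"
    unfolding bounded_pos by blast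
  then have B: "\<bar>pd i F x\<bar> \<le> B" if "x \<in> K" for x
    using that by simp
  have B': "\<bar>pd i F x\<bar> \<le> B" for x
    using B[of x] pd0[of x] B0 by (cases "x \<in> K") auto
  have contF: "continuous_on UNIV F"
    by (intro continuous_at_imp_continuous_on ballI differentiable_imp_continuous_within diff)
  have mF: "F \<in> borel_measurable borel"
    using contF by (rule borel_measurable_continuous_onI)
  have line: "((\<lambda>s. F (x + s *\<^sub>R ?e)) has_real_derivative pd i F (x + s *\<^sub>R ?e)) (at s)" for x s
  proof -
    have F': "(F has_derivative frechet_derivative F (at (x + s *\<^sub>R ?e))) (at (x + s *\<^sub>R ?e))"
      by (rule differentiable_frechet[OF diff])
    have "((\<lambda>s. x + s *\<^sub>R ?e) has_derivative (\<lambda>s. s *\<^sub>R ?e)) (at s)"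
      by (auto intro!: derivative_eq_intros)
    from has_derivative_compose[OF this F']
    have "((\<lambda>s. F (x + s *\<^sub>R ?e)) has_derivative (\<lambda>s'. frechet_derivative F (at (x + s *\<^sub>R ?e)) (s' *\<^sub>R ?e))) (at s)" .
    moreover have "(\<lambda>s'. frechet_derivative F (at (x + s *\<^sub>R ?e)) (s' *\<^sub>R ?e)) = (*) (pd i F (x + s *\<^sub>R ?e))"
    proof
      fix s'
      show "frechet_derivative F (at (x + s *\<^sub>R ?e)) (s' *\<^sub>R ?e) = pd i F (x + s *\<^sub>R ?e) * s'"
        unfolding linear_scale[OF has_derivative_linear[OF F']] pd_def by simp
    qed
    ultimately show ?thesis by (simp add: has_field_derivative_def)
  qed
  have intF: "integrable lborel F"
  proof -
    have "integrable lborel (\<lambda>x. indicator K x *\<^sub>R F x)"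
      by (intro borel_integrable_compact continuous_on_subset[OF contF subset_UNIV] K(1))
    moreover have "(\<lambda>x. indicator K x *\<^sub>R F x) = F"
      using K(2) by (auto simp: fun_eq_iff indicator_def)
    ultimately show ?thesis by simp
  qed
  define q where "q m x = (F (x + inverse (real (Suc m)) *\<^sub>R ?e) - F x) / inverse (real (Suc m))" for m x
  have shift: "integrable lborel (\<lambda>x. F (x + a))" "integral\<^sup>L lborel (\<lambda>x. F (x + a)) = integral\<^sup>L lborel F" for a
  proof -
    have m: "(+) a \<in> measurable lborel borel" by simp
    have d: "distr lborel borel ((+) a) = lborel" by (rule lborel_distr_plus)
    have "integrable (distr lborel borel ((+) a)) F" unfolding d by (rule intF)
    then have "integrable lborel (\<lambda>x. F (a + x))"
      by (subst (asm) integrable_distr_eq[OF m mF])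
    then show "integrable lborel (\<lambda>x. F (x + a))" by (simp add: add.commute)
    have "integral\<^sup>L (distr lborel borel ((+) a)) F = integral\<^sup>L lborel (\<lambda>x. F (a + x))"
      by (rule integral_distr[OF m mF])
    then show "integral\<^sup>L lborel (\<lambda>x. F (x + a)) = integral\<^sup>L lborel F"
      unfolding d by (simp add: add.commute)
  qed
  have intq: "integral\<^sup>L lborel (q m) = 0" for m
    unfolding q_def using shift intF by simp
  let ?w = "\<lambda>x. indicator (cball 0 (R + 1)) x *\<^sub>R B"
  have bound: "norm (q m x) \<le> ?w x" for m x
  proof (cases "x \<in> cball 0 (R + 1)")
    case True
    let ?h = "inverse (real (Suc m))"
    have "\<exists>z>0. z < ?h \<and> F (x + ?h *\<^sub>R ?e) - F (x + 0 *\<^sub>R ?e) = (?h - 0) * pd i F (x + z *\<^sub>R ?e)"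
      by (rule MVT2) (use line in auto)
    then obtain z where "F (x + ?h *\<^sub>R ?e) - F x = ?h * pd i F (x + z *\<^sub>R ?e)" by auto
    then have "q m x = pd i F (x + z *\<^sub>R ?e)" unfolding q_def by (simp add: field_simps)
    then show ?thesis using B' True by simp
  next
    case False
    have "x \<notin> K" using False R by auto
    moreover have "x + inverse (real (Suc m)) *\<^sub>R ?e \<notin> K"
    proof
      assume "x + inverse (real (Suc m)) *\<^sub>R ?e \<in> K"
      then have "norm (x + inverse (real (Suc m)) *\<^sub>R ?e) \<le> R" using R by auto
      moreover have "norm (inverse (real (Suc m)) *\<^sub>R ?e) \<le> 1"
        by (simp add: field_simps)
      moreover have "norm x \<le> norm (x + inverse (real (Suc m)) *\<^sub>R ?e) + norm (inverse (real (Suc m)) *\<^sub>R ?e)"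
        by (metis add_diff_cancel_right' norm_triangle_ineq4)
      ultimately show False using False by simp
    qed
    ultimately show ?thesis using K(2) B0 by (simp add: q_def)
  qed
  have lim: "(\<lambda>m. q m x) \<longlonglongrightarrow> pd i F x" for x
  proof -
    have l: "((\<lambda>h. (F (x + h *\<^sub>R ?e) - F x) / h) \<longlongrightarrow> pd i F x) (at 0)"
      using line[of x 0] by (simp add: DERIV_def)
    have f: "filterlim (\<lambda>m. inverse (real (Suc m))) (at 0) sequentially"
      unfolding filterlim_at using LIMSEQ_inverse_real_of_nat by simp
    show ?thesis
      unfolding q_def[abs_def] by (rule filterlim_compose[OF l f])
  qed
  have w: "integrable lborel ?w"
    by (rule borel_integrable_compact) auto
  have mpd: "pd i F \<in> borel_measurable lborel"
    using borel_measurable_continuous_onI[OF cont] by simp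
  have mq: "q m \<in> borel_measurable lborel" for m
    unfolding q_def using shift(1)[THEN borel_measurable_integrable] mF by simp
  show "integrable lborel (pd i F)"
    by (rule integrable_dominated_convergence[OF mpd mq w AE_I2[OF lim] AE_I2[OF bound]])
  have "(\<lambda>m. integral\<^sup>L lborel (q m)) \<longlonglongrightarrow> integral\<^sup>L lborel (pd i F)"
    by (rule integral_dominated_convergence[OF mpd mq w AE_I2[OF lim] AE_I2[OF bound]])
  then show "integral\<^sup>L lborel (pd i F) = 0"
    by (simp add: intq LIMSEQ_const_iff)
qed

definition C1_on :: "(real^'k::finite) set \<Rightarrow> (real^'k \<Rightarrow> real) \<Rightarrow> bool" where
  "C1_on S f \<longleftrightarrow> (\<forall>x\<in>S. f differentiable (at x)) \<and> (\<forall>i. continuous_on S (pd i f))"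

lemma C1_cont: "C1_on S f \<Longrightarrow> continuous_on S f"
  unfolding C1_on_def by (meson continuous_at_imp_continuous_on differentiable_imp_continuous_within)

lemma C1_const: "C1_on S (\<lambda>_. a)"
  by (simp add: C1_on_def pd_def)

lemma C1_add: assumes "C1_on S f" "C1_on S g" shows "C1_on S (\<lambda>x. f x + g x)"
proof -
  have "continuous_on S (pd i (\<lambda>x. f x + g x))" for i
  proof -
    have "pd i (\<lambda>x. f x + g x) x = pd i f x + pd i g x" if "x \<in> S" for x
      using assms that unfolding C1_on_def by (simp add: pd_add)
    moreover have "continuous_on S (\<lambda>x. pd i f x + pd i g x)"
      using assms unfolding C1_on_def by (auto intro!: continuous_intros)
    ultimately show ?thesis by (simp cong: continuous_on_cong)
  qed
  then show ?thesis using assms by (auto simp: C1_on_def)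
qed

lemma C1_mult: assumes "C1_on S f" "C1_on S g" shows "C1_on S (\<lambda>x. f x * g x)"
proof -
  have "continuous_on S (pd i (\<lambda>x. f x * g x))" for i
  proof -
    have "pd i (\<lambda>x. f x * g x) x = f x * pd i g x + pd i f x * g x" if "x \<in> S" for x
      using assms that unfolding C1_on_def by (simp add: pd_mult)
    moreover have "continuous_on S (\<lambda>x. f x * pd i g x + pd i f x * g x)"
      using assms C1_cont[of S f] C1_cont[of S g] unfolding C1_on_def by (auto intro!: continuous_intros)
    ultimately show ?thesis by (simp cong: continuous_on_cong)
  qed
  then show ?thesis using assms by (auto simp: C1_on_def)
qed

lemma C1_sum: "(\<And>a. a \<in> I \<Longrightarrow> C1_on S (f a)) \<Longrightarrow> C1_on S (\<lambda>x. \<Sum>a\<in>I. f a x)"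
  by (induction I rule: infinite_finite_induct) (auto intro!: C1_const C1_add)

lemma C1_prod: "(\<And>a. a \<in> I \<Longrightarrow> C1_on S (f a)) \<Longrightarrow> C1_on S (\<lambda>x. \<Prod>a\<in>I. f a x)"
  by (induction I rule: infinite_finite_induct) (auto intro!: C1_const C1_mult)

lemma C1_compose:
  assumes "C1_on S f" "\<And>x. x \<in> S \<Longrightarrow> (\<phi> has_real_derivative \<phi>' (f x)) (at (f x))"
    and "continuous_on (f ` S) \<phi>'"
  shows "C1_on S (\<lambda>x. \<phi> (f x))"
proof -
  have d: "((\<lambda>x. \<phi> (f x)) has_derivative (\<lambda>v. \<phi>' (f x) * frechet_derivative f (at x) v)) (at x)"
    if "x \<in> S" for x
  proof -
    have "(f has_derivative frechet_derivative f (at x)) (at x)"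
      using assms(1) that differentiable_frechet unfolding C1_on_def by blast
    from has_derivative_compose[OF this assms(2)[OF that, unfolded has_field_derivative_def]]
    show ?thesis .
  qed
  have "continuous_on S (pd i (\<lambda>x. \<phi> (f x)))" for i
  proof -
    have "pd i (\<lambda>x. \<phi> (f x)) x = \<phi>' (f x) * pd i f x" if "x \<in> S" for x
      using has_derivative_pd[OF d[OF that]] by (simp add: pd_def)
    moreover have "continuous_on S (\<lambda>x. \<phi>' (f x) * pd i f x)"
      using assms(1) continuous_on_compose[OF C1_cont[OF assms(1)] assms(3)]
      unfolding C1_on_def comp_def by (auto intro!: continuous_intros)
    ultimately show ?thesis by (simp cong: continuous_on_cong)
  qed
  then show ?thesis using d unfolding C1_on_def differentiable_def by blast
qed

lemma C1_cong:
  assumes "open S" "\<And>x. x \<in> S \<Longrightarrow> f x = g x" "C1_on S g"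
  shows "C1_on S f"
proof -
  have "pd i f x = pd i g x" "f differentiable (at x) \<longleftrightarrow> g differentiable (at x)" if "x \<in> S" for i x
    by (rule pd_cong_open[OF assms(1) that assms(2)]; assumption)+
  then show ?thesis using assms(3) unfolding C1_on_def by (simp cong: continuous_on_cong)
qed

lemma abs_derivative:
  fixes d :: real
  assumes "d \<noteq> 0" shows "(abs has_real_derivative sgn d) (at d)"
proof (cases "d > 0")
  case True
  have "((\<lambda>s. s) has_real_derivative 1) (at d)" by (rule DERIV_ident)
  then have "(abs has_real_derivative 1) (at d)"
    by (rule has_field_derivative_transform_within_open[where S = "{0<..}"]) (use True in auto)
  then show ?thesis using True by simp
next
  case False
  have "((\<lambda>s. - s) has_real_derivative - 1) (at d)" by (auto intro!: derivative_eq_intros)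
  then have "(abs has_real_derivative - 1) (at d)"
    by (rule has_field_derivative_transform_within_open[where S = "{..<0}"]) (use False assms in auto)
  then show ?thesis using False assms by simp
qed

lemma smooth_imp_C1:
  fixes f :: "real^'k::finite \<Rightarrow> real"
  assumes "open S" "smooth_on S f" shows "C1_on S f"
proof -
  have *: "Ck_on (Suc 0) S f" using assms(2) unfolding smooth_on_def by blast
  have "continuous_on S (pd i f)" for i
    using * unfolding pd_def[abs_def] by simp
  moreover have "\<forall>x\<in>S. f differentiable (at x)"
    using * by (simp add: differentiable_on_eq_differentiable_at[OF assms(1)])
  ultimately show ?thesis unfolding C1_on_def by blast
qed

lemma smooth_component:
  assumes "open S" "smooth_on S f" "bounded_linear L"
  shows "smooth_on S (\<lambda>x. L (f x))"
proof -
  have "Ck_on k S f \<Longrightarrow> Ck_on k S (\<lambda>x. L (f x))" for k and f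
  proof (induction k arbitrary: f)
    case 0
    then show ?case using bounded_linear.continuous_on[OF assms(3)] by simp
  next
    case (Suc k)
    have d: "((\<lambda>x. L (f x)) has_derivative (\<lambda>v. L (frechet_derivative f (at x) v))) (at x)" if "x \<in> S" for x
    proof (rule bounded_linear.has_derivative[OF assms(3) differentiable_frechet])
      show "f differentiable (at x)"
        using Suc.prems that by (simp add: differentiable_on_eq_differentiable_at[OF assms(1)])
    qed
    have e: "frechet_derivative (\<lambda>x. L (f x)) (at x) v = L (frechet_derivative f (at x) v)" if "x \<in> S" for x v
      using fun_cong[OF frechet_derivative_at[OF d[OF that]], of v] by (rule sym)
    have cong: "Ck_on j S F = Ck_on j S F'" if "\<And>x. x \<in> S \<Longrightarrow> F x = F' x" for j and F F' :: "'a \<Rightarrow> 'c"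
      using that
    proof (induction j arbitrary: F F')
      case 0 then show ?case by (simp cong: continuous_on_cong)
    next
      case (Suc j)
      have hd: "(F has_derivative D) (at x) \<longleftrightarrow> (F' has_derivative D) (at x)" if "x \<in> S" for x D
        by (metis Suc.prems assms(1) has_derivative_transform_within_open that)
      have "frechet_derivative F (at x) = frechet_derivative F' (at x)" if "x \<in> S" for x
        unfolding frechet_derivative_def hd[OF that] ..
      then have "Ck_on j S (\<lambda>x. frechet_derivative F (at x) v) =
          Ck_on j S (\<lambda>x. frechet_derivative F' (at x) v)" for v
        by (intro Suc.IH) simp
      moreover have "F differentiable_on S \<longleftrightarrow> F' differentiable_on S"
        using hd by (simp add: differentiable_on_eq_differentiable_at[OF assms(1)] differentiable_def)
      ultimately show ?case by simp
    qed
    have "Ck_on k S (\<lambda>x. frechet_derivative (\<lambda>x. L (f x)) (at x) v)" for v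
    proof -
      have "Ck_on k S (\<lambda>x. L (frechet_derivative f (at x) v))"
        using Suc by simp
      moreover have "Ck_on k S (\<lambda>x. frechet_derivative (\<lambda>x. L (f x)) (at x) v) =
          Ck_on k S (\<lambda>x. L (frechet_derivative f (at x) v))"
        by (rule cong) (rule e)
      ultimately show ?thesis by simp
    qed
    moreover have "(\<lambda>x. L (f x)) differentiable_on S"
      using d by (auto simp: differentiable_on_eq_differentiable_at[OF assms(1)] differentiable_def)
    ultimately show ?case by simp
  qed
  then show ?thesis using assms(2) unfolding smooth_on_def by blast
qed

lemma C1_det:
  fixes M :: "real^'k::finite \<Rightarrow> real^'m^'m::finite"
  assumes "\<And>i j. C1_on S (\<lambda>x. M x $ i $ j)"
  shows "C1_on S (\<lambda>x. det (M x))"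
  unfolding det_def by (intro C1_sum C1_mult C1_const C1_prod assms)

lemma C1_flux:
  fixes G :: "real^'k::finite \<Rightarrow> real^'k^'k"
  assumes "open S" "smooth_on S G" "smooth_on S \<omega>" "\<And>x. x \<in> S \<Longrightarrow> det (G x) \<noteq> 0"
  shows "C1_on S (volume_density G)" "C1_on S (\<lambda>x. (ginv G x *v \<omega> x) $ i)"
proof -
  have G: "C1_on S (\<lambda>x. G x $ a $ b)" for a b
    by (rule smooth_imp_C1[OF assms(1)],
        rule smooth_component[OF assms(1) smooth_component[OF assms(1,2)]])
       (auto intro: bounded_linear_vec_nth)
  have w: "C1_on S (\<lambda>x. \<omega> x $ a)" for a
    by (rule smooth_imp_C1[OF assms(1)], rule smooth_component[OF assms(1,3)])
       (auto intro: bounded_linear_vec_nth)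
  have detG: "C1_on S (\<lambda>x. det (G x))" by (rule C1_det[OF G])
  show "C1_on S (volume_density G)"
    unfolding volume_density_def[abs_def]
  proof (rule C1_compose[OF detG, where \<phi>' = "\<lambda>s. sgn s * (inverse (sqrt \<bar>s\<bar>) / 2)"])
    fix x assume "x \<in> S"
    then have nz: "det (G x) \<noteq> 0" by (rule assms(4))
    then show "((\<lambda>s. sqrt \<bar>s\<bar>) has_real_derivative
        sgn (det (G x)) * (inverse (sqrt \<bar>det (G x)\<bar>) / 2)) (at (det (G x)))"
      by (auto intro!: derivative_eq_intros abs_derivative)
  next
    show "continuous_on ((\<lambda>x. det (G x)) ` S) (\<lambda>s. sgn s * (inverse (sqrt \<bar>s\<bar>) / 2))"
      using assms(4) by (auto intro!: continuous_intros)
  qed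
  let ?M = "\<lambda>x. (\<chi> a b. if b = i then \<omega> x $ a else G x $ a $ b) :: real^'k^'k"
  have eq: "(ginv G x *v \<omega> x) $ i = det (?M x) * inverse (det (G x))" if "x \<in> S" for x
  proof -
    have nz: "det (G x) \<noteq> 0" using that by (rule assms(4))
    then have "G x ** ginv G x = mat 1"
      unfolding ginv_def matrix_inv_def invertible_det_nz[symmetric] invertible_def
      by (rule someI2_ex) simp
    then have "G x *v (ginv G x *v \<omega> x) = \<omega> x"
      by (simp add: matrix_vector_mul_assoc)
    then have "ginv G x *v \<omega> x = (\<chi> k. det (\<chi> a b. if b = k then \<omega> x $ a else G x $ a $ b) / det (G x))"
      using cramer[OF nz] by blast
    then show ?thesis by (simp add: divide_inverse)
  qed
  have *: "C1_on S (\<lambda>x. det (?M x) * inverse (det (G x)))"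
  proof (rule C1_mult)
    show "C1_on S (\<lambda>x. det (?M x))"
    proof (rule C1_det)
      fix a b show "C1_on S (\<lambda>x. ?M x $ a $ b)"
        using G w by (cases "b = i") simp_all
    qed
    show "C1_on S (\<lambda>x. inverse (det (G x)))"
    proof (rule C1_compose[OF detG, where \<phi>' = "\<lambda>s. - (inverse s)\<^sup>2"])
      fix x assume "x \<in> S"
      then have nz: "det (G x) \<noteq> 0" by (rule assms(4))
      then show "(inverse has_real_derivative - (inverse (det (G x)))\<^sup>2) (at (det (G x)))"
        using DERIV_inverse[of "det (G x)" UNIV] by (simp add: power2_eq_square numeral_2_eq_2)
    next
      show "continuous_on ((\<lambda>x. det (G x)) ` S) (\<lambda>s. - (inverse s)\<^sup>2)"
        using assms(4) by (auto intro!: continuous_intros)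
    qed
  qed
  show "C1_on S (\<lambda>x. (ginv G x *v \<omega> x) $ i)"
    by (rule C1_cong[OF assms(1) _ *]) (rule eq)
qed

lemma codiff_formal_adjoint:
  fixes G :: "real^'k::finite \<Rightarrow> real^'k^'k"
  assumes S: "open S" and G: "smooth_on S G" "\<And>x. x \<in> S \<Longrightarrow> det (G x) \<noteq> 0"
    and \<omega>: "smooth_on S \<omega>"
    and v: "smooth_on UNIV v" and K: "compact K" "K \<subseteq> S" "\<And>x. x \<notin> K \<Longrightarrow> v x = 0"
  shows "(LINT x:S|lborel. v x * codiff G \<omega> x * volume_density G x)
       = (LINT x:S|lborel. (differential v x \<bullet> (ginv G x *v \<omega> x)) * volume_density G x)"
proof -
  define W where "W i x = volume_density G x * (ginv G x *v \<omega> x) $ i" for i x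
  have W: "C1_on S (W i)" for i
    unfolding W_def by (intro C1_mult C1_flux[OF S G(1) \<omega> G(2)])
  have v1: "C1_on UNIV v" using smooth_imp_C1[OF open_UNIV v] .
  then have vS: "C1_on S v" unfolding C1_on_def using continuous_on_subset by blast
  define F where "F i x = (if x \<in> S then v x * W i x else 0)" for i x
  have opK: "open (- K)" using K(1) compact_imp_closed by blast
  have pdv0: "pd i v x = 0" if "x \<notin> K" for i x
  proof -
    have "pd i v x = pd i (\<lambda>_. 0) x" by (rule pd_cong_open[OF opK]) (use that K in auto)
    then show ?thesis by (simp add: pd_def)
  qed
  have FS: "pd i (F i) x = v x * pd i (W i) x + pd i v x * W i x" "F i differentiable (at x)"
    if "x \<in> S" for i x
  proof -
    have c: "pd i (F i) x = pd i (\<lambda>x. v x * W i x) x"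
      "F i differentiable (at x) \<longleftrightarrow> (\<lambda>x. v x * W i x) differentiable (at x)"
      by (rule pd_cong_open[OF S that]; simp add: F_def)+
    show "pd i (F i) x = v x * pd i (W i) x + pd i v x * W i x"
      unfolding c using vS W that by (simp add: C1_on_def pd_mult)
    show "F i differentiable (at x)" unfolding c using vS W that by (auto simp: C1_on_def)
  qed
  have FK: "pd i (F i) x = 0" "F i differentiable (at x)" if "x \<notin> K" for i x
  proof -
    have c: "pd i (F i) x = pd i (\<lambda>_. 0) x"
      "F i differentiable (at x) \<longleftrightarrow> (\<lambda>_. 0::real) differentiable (at x)"
      by (rule pd_cong_open[OF opK]; use that K in \<open>auto simp: F_def\<close>)+
    then show "pd i (F i) x = 0" "F i differentiable (at x)" by (simp_all add: pd_def)
  qed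
  have contF: "continuous_on UNIV (pd i (F i))" for i
  proof -
    have "continuous_on S (pd i (F i))"
    proof -
      have "continuous_on S (\<lambda>x. v x * pd i (W i) x + pd i v x * W i x)"
        using vS W C1_cont[OF vS] C1_cont[OF W] unfolding C1_on_def by (auto intro!: continuous_intros)
      then show ?thesis using FS by (simp cong: continuous_on_cong)
    qed
    moreover have "continuous_on (- K) (pd i (F i))"
      by (rule continuous_on_eq[of _ "\<lambda>_. 0"]) (use FK in auto)
    ultimately have "continuous_on (S \<union> - K) (pd i (F i))"
      using S opK by (simp add: continuous_on_open_Un)
    moreover have "S \<union> - K = UNIV" using K by auto
    ultimately show ?thesis by simp
  qed
  have dF: "F i differentiable (at x)" for i x
    using FS(2) FK(2) K(2) by blast
  have F0: "F i x = 0" if "x \<notin> K" for i x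
    using that K(3) by (simp add: F_def)
  note int = integral_pd_compact_support[OF dF contF K(1) F0]
  let ?A = "\<lambda>x. indicator S x *\<^sub>R (v x * codiff G \<omega> x * volume_density G x)"
  let ?B = "\<lambda>x. indicator S x *\<^sub>R ((differential v x \<bullet> (ginv G x *v \<omega> x)) * volume_density G x)"
  have A: "v x * codiff G \<omega> x * volume_density G x = - (v x * (\<Sum>i\<in>UNIV. pd i (W i) x))"
    if "x \<in> S" for x
  proof -
    have "volume_density G x \<noteq> 0"
      using G(2)[OF that] by (simp add: volume_density_def)
    moreover have "codiff G \<omega> x = - (\<Sum>i\<in>UNIV. pd i (W i) x) / volume_density G x"
      unfolding codiff_def W_def[abs_def] ..
    ultimately show ?thesis by simp
  qed
  have B: "(differential v x \<bullet> (ginv G x *v \<omega> x)) * volume_density G x = (\<Sum>i\<in>UNIV. pd i v x * W i x)"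
    for x
    by (simp add: inner_vec_def differential_def W_def sum_distrib_left algebra_simps)
  have intA: "integrable lborel ?A"
  proof -
    have "integrable lborel (\<lambda>x. indicator K x *\<^sub>R (- (v x * (\<Sum>i\<in>UNIV. pd i (W i) x))))"
    proof (rule borel_integrable_compact[OF K(1)])
      have "continuous_on S (\<lambda>x. - (v x * (\<Sum>i\<in>UNIV. pd i (W i) x)))"
        using C1_cont[OF vS] W unfolding C1_on_def by (auto intro!: continuous_intros)
      then show "continuous_on K (\<lambda>x. - (v x * (\<Sum>i\<in>UNIV. pd i (W i) x)))"
        using K(2) continuous_on_subset by blast
    qed
    moreover have "indicator K x *\<^sub>R (- (v x * (\<Sum>i\<in>UNIV. pd i (W i) x))) = ?A x" for x
      using A[of x] K(2) K(3)[of x] by (cases "x \<in> K"; cases "x \<in> S") auto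
    ultimately show ?thesis by (simp only:)
  qed
  have BA: "?B x = ?A x + (\<Sum>i\<in>UNIV. pd i (F i) x)" for x
  proof (cases "x \<in> S")
    case True
    then show ?thesis
      using A[OF True] B FS(1)[OF True] by (simp add: sum.distrib sum_distrib_left)
  next
    case False
    then have "x \<notin> K" using K(2) by blast
    then show ?thesis using False FK(1) by simp
  qed
  have "integral\<^sup>L lborel ?B = integral\<^sup>L lborel ?A + (\<Sum>i\<in>UNIV. integral\<^sup>L lborel (pd i (F i)))"
    unfolding BA using intA int(1) by (simp add: integrable_sum integral_sum)
  then show ?thesis unfolding set_lebesgue_integral_def using int by simp
qed

section \<open>Poincare--Einstein metrics, ambient metrics and GJMS-operators\<close>

text \<open>In \<open>real^'n option\<close> the index \<open>None\<close> belongs to the coordinate \<open>r\<close> and \<open>Some i\<close> to \<open>x\<^sub>i\<close>.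
  The first argument of \<open>plus_metric\<close> is the family \<open>r \<mapsto> g\<^sub>r\<close> in a fixed chart.\<close>

definition plus_point :: "real \<Rightarrow> real^'n::finite \<Rightarrow> real^'n option" where
  "plus_point r y = (\<chi> a. case a of None \<Rightarrow> r | Some i \<Rightarrow> y $ i)"

definition plus_metric ::
    "(real \<Rightarrow> real^'n \<Rightarrow> real^'n^'n) \<Rightarrow> real^'n::finite option \<Rightarrow> real^'n option^'n option" where
  "plus_metric gr z =
     (let r = z $ None; y = (\<chi> i. z $ Some i) in
      (1 / r\<^sup>2) *\<^sub>R (\<chi> a b. case (a, b) of
          (None, None) \<Rightarrow> 1
        | (Some i, Some j) \<Rightarrow> gr r y $ i $ j
        | _ \<Rightarrow> 0))"

definition einstein_defect ::
    "(real \<Rightarrow> real^'n \<Rightarrow> real^'n^'n) \<Rightarrow> real \<Rightarrow> real^'n::finite \<Rightarrow> real^'n option^'n option" where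
  "einstein_defect gr r y =
     ricci (plus_metric gr) (plus_point r y)
     + real CARD('n) *\<^sub>R plus_metric gr (plus_point r y)"

text \<open>For even \<open>n\<close>, \<open>C\<close> is the coefficient of \<open>r ^ (n - 2)\<close> of the components tangential to \<open>M\<close>.\<close>

definition asymptotically_einstein ::
    "(real^'n \<Rightarrow> real^'n^'n) \<Rightarrow> (real \<Rightarrow> real^'n \<Rightarrow> real^'n^'n) \<Rightarrow> real^'n::finite \<Rightarrow> bool" where
  "asymptotically_einstein G gr y \<longleftrightarrow>
     (if odd CARD('n)
      then \<forall>m a b. (\<lambda>r. einstein_defect gr r y $ a $ b) \<in> O[at_right 0](\<lambda>r. r ^ m)
      else (\<forall>a b. (\<lambda>r. einstein_defect gr r y $ a $ b) \<in> O[at_right 0](\<lambda>r. r ^ (CARD('n) - 2))) \<and>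
           (\<exists>C. (\<forall>i j. ((\<lambda>r. einstein_defect gr r y $ Some i $ Some j / r ^ (CARD('n) - 2))
                          \<longlongrightarrow> C $ i $ j) (at_right 0)) \<and>
                (\<Sum>i\<in>UNIV. \<Sum>j\<in>UNIV. ginv G y $ i $ j * C $ i $ j) = 0))"

definition poincare_einstein ::
    "'m topology \<Rightarrow> ('m, 'n::finite) chart set \<Rightarrow> ('m, 'n) tensor2 \<Rightarrow>
     ('m \<times> real) set \<Rightarrow> (real \<Rightarrow> ('m, 'n) tensor2) \<Rightarrow> bool" where
  "poincare_einstein X A g D gr \<longleftrightarrow>
     zero_section_nbhd X D \<and> metric_family A D gr \<and>
     (\<forall>(p, r)\<in>D. (p, - r) \<in> D \<and> (\<forall>c\<in>A. p \<in> fst c \<longrightarrow> gr (- r) c (snd c p) = gr r c (snd c p))) \<and>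
     (\<forall>c\<in>A. \<forall>y\<in>chart_image c.
        gr 0 c y = g c y \<and> asymptotically_einstein (g c) (\<lambda>r. gr r c) y)"

text \<open>The family \<open>\<rho> \<mapsto> g(\<rho>)\<close> defining the ambient metric: \<open>g(\<rho>) = g\<^sub>r\<close> for
  \<open>\<rho> = - r\<^sup>2 / 2\<close>, extended smoothly (and arbitrarily) to \<open>\<rho> > 0\<close>.\<close>

definition ambient_family ::
    "'m topology \<Rightarrow> ('m, 'n::finite) chart set \<Rightarrow> ('m \<times> real) set \<Rightarrow> (real \<Rightarrow> ('m, 'n) tensor2) \<Rightarrow>
     ('m \<times> real) set \<Rightarrow> (real \<Rightarrow> ('m, 'n) tensor2) \<Rightarrow> bool" where
  "ambient_family X A D gr E h \<longleftrightarrow>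
     zero_section_nbhd X E \<and> metric_family A E h \<and>
     (\<forall>(p, r)\<in>D. (p, - r\<^sup>2 / 2) \<in> E \<longrightarrow>
        (\<forall>c\<in>A. p \<in> fst c \<longrightarrow> h (- r\<^sup>2 / 2) c (snd c p) = gr r c (snd c p)))"

text \<open>In \<open>real^'n option option\<close> the index \<open>None\<close> belongs to the coordinate \<open>t\<close>, \<open>Some None\<close> to
  \<open>\<rho>\<close> and \<open>Some (Some i)\<close> to \<open>x\<^sub>i\<close>.\<close>

definition ambient_point :: "real \<Rightarrow> real \<Rightarrow> real^'n::finite \<Rightarrow> real^'n option option" where
  "ambient_point t \<rho> y = (\<chi> a. case a of None \<Rightarrow> t | Some None \<Rightarrow> \<rho> | Some (Some i) \<Rightarrow> y $ i)"

definition ambient_metric ::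
    "(real \<Rightarrow> real^'n \<Rightarrow> real^'n^'n) \<Rightarrow>
     real^'n::finite option option \<Rightarrow> real^'n option option^'n option option" where
  "ambient_metric h z =
     (let t = z $ None; \<rho> = z $ Some None; y = (\<chi> i. z $ Some (Some i)) in
      (\<chi> a b. case (a, b) of
          (None, None) \<Rightarrow> 2 * \<rho>
        | (None, Some None) \<Rightarrow> t
        | (Some None, None) \<Rightarrow> t
        | (Some (Some i), Some (Some j)) \<Rightarrow> t\<^sup>2 * h \<rho> y $ i $ j
        | _ \<Rightarrow> 0))"

text \<open>\<open>gjms N h U y\<close> is $P_{2N} u$ at the point with coordinates \<open>y\<close> in a fixed chart, where \<open>h\<close> is
  the family \<open>\<rho> \<mapsto> g(\<rho>)\<close> and \<open>U\<close> the extension \<open>(y, \<rho>) \<mapsto> U y \<rho>\<close> of \<open>u\<close> in that chart. It is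
  the GJMS-operator for \<open>N \<ge> 1\<close>, with \<open>2 * N \<le> n\<close> if \<open>n\<close> is even.\<close>

definition gjms ::
    "nat \<Rightarrow> (real \<Rightarrow> real^'n \<Rightarrow> real^'n^'n) \<Rightarrow> (real^'n \<Rightarrow> real \<Rightarrow> real) \<Rightarrow> real^'n::finite \<Rightarrow> real" where
  "gjms N h U y =
     (laplacian (ambient_metric h) ^^ N)
       (\<lambda>z. (z $ None) powr (real N - real CARD('n) / 2) * U (\<chi> i. z $ Some (Some i)) (z $ Some None))
       (ambient_point 1 0 y)"

section \<open>The ingredients of the formula for \<open>P\<^sub>6\<close>\<close>

definition T2 :: "(real^'n \<Rightarrow> real^'n^'n) \<Rightarrow> real^'n \<Rightarrow> real^'n^'n::finite" where
  "T2 G x =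
     (let n = real CARD('n) in
      mat ((n - 2) * schouten_scalar G x) - 8 *\<^sub>R endo G (schouten G) x)"

definition T4 :: "(real^'n \<Rightarrow> real^'n^'n) \<Rightarrow> real^'n \<Rightarrow> real^'n^'n::finite" where
  "T4 G x =
     (let n = real CARD('n); J = schouten_scalar G; P = endo G (schouten G) x in
      mat (- (3 * (n / 2 - 1)\<^sup>2 - 4) * (J x)\<^sup>2
           + 4 * (n - 4) * tensor_inner G (schouten G) (schouten G) x)
      + (16 * (n / 2 - 1) * J x) *\<^sub>R P
      + mat ((n - 6) * laplacian G J x)
      - 48 *\<^sub>R (P ** P)
      - (16 / (n - 4)) *\<^sub>R endo G (bach G) x)"

definition v6 :: "(real^'n \<Rightarrow> real^'n^'n) \<Rightarrow> real^'n::finite \<Rightarrow> real" where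
  "v6 G x =
     - (1 / 8) * tr_wedge3 (endo G (schouten G) x)
     - 1 / (24 * (real CARD('n) - 4)) * tensor_inner G (bach G) (schouten G) x"

definition Q6 :: "(real^'n \<Rightarrow> real^'n^'n) \<Rightarrow> real^'n::finite \<Rightarrow> real" where
  "Q6 G x =
     (let n = real CARD('n); J = schouten_scalar G;
          normP2 = tensor_inner G (schouten G) (schouten G) in
      - fact 3 * fact 2 * 2 ^ 5 * v6 G x
      - (n / 2 + 1) * laplacian G (\<lambda>y. (J y)\<^sup>2) x
      + 4 * laplacian G normP2 x
      - 8 * codiff G (\<lambda>y. endo G (schouten G) y *v differential J y) x
      + laplacian G (laplacian G J) x
      - (n / 2 - 3) * J x * laplacian G J x
      - 4 * (n - 6) * J x * normP2 x
      + (n - 6) * (n + 6) / 4 * (J x) ^ 3)"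

end

theory Submission
  imports Defs
begin

text \<open>On functions $t^w f(x, \rho)$ the ambient Laplacian acts as $t^{w-2}$ times
    $$f \mapsto \Delta_\rho f - 2 \rho f'' + (2 w + n - 2 - \rho \theta) f' + \frac{w}{2} \theta f,
      \qquad \theta = \mathrm{tr}\, g(\rho)^{-1} g'(\rho),$$
  a prime being the derivative in $\rho$ (\<open>ambient_laplacian\<close>). Composing the operators for
  $w = 3 - \frac n2, 1 - \frac n2, -1 - \frac n2$ and restricting to $\rho = 0$, all
  $\rho$-derivatives of the extension cancel, and what remains is built from $\Delta_g$, the first two
  $\rho$-derivatives of $\Delta_\rho$ and of $\theta$ at $\rho = 0$ (\<open>amb_cube\<close>). The $\rho$-derivatives
  of the Laplacian are again in divergence form, with coefficients $g^{-1}$ differentiated in $\rho$, up to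
  gradient terms in $\theta$.

  So only the beginning of the Taylor expansion of $g(\rho)$ matters. The Ricci tensor of
  $r^{-2}(dr^2 + g_r)$ at $\rho = - r^2 / 2$ has the components
    $$\mathrm{Ric}(g) - (\tfrac n2 - 1) g' - \tfrac12 \theta g + \rho (g'' + \tfrac12 \theta g' - g' g^{-1} g'),
      \qquad \rho (\theta' + \tfrac12 |g'|^2), \qquad - \tfrac r2 (\nabla^k g'_{ki} - \partial_i \theta)$$
  besides $- n g_+$ (\<open>ricci_gp_tangential\<close>, \<open>ricci_gp_normal\<close>, \<open>ricci_gp_mixed\<close>). Vanishing at
  $\rho = 0$ gives $g' = 2 \mathsf P$, $\theta = 2 \mathsf J$, $\theta' = - 2 |\mathsf P|^2$ and
  $\delta \mathsf P = - d \mathsf J$. The first order of the tangential equation expresses $g''$ by the variation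
  of the Ricci tensor in the direction $2 \mathsf P$, which by commuting one pair of covariant derivatives
  is minus the Bach tensor plus terms quadratic in $\mathsf P$ (\<open>ds_Ric_eq_bach\<close>); hence
  $\mathcal B = (n - 4) (\mathsf P^2 - \frac12 g'')$ (\<open>bach_boundary\<close>). The first order of the normal
  equation determines $\theta''$, which accounts for $v_6$: the third elementary symmetric function enters
  through the traces of powers of $\mathsf P$ (\<open>tr_wedge3_eq\<close>). For $n = 6$ the Einstein
  condition stops short of that order, but there the coefficient $\frac n2 - 3$ of $Q_6$ vanishes, and with it
  that of $\theta''$.

  Substituting these values and expanding with the product rules for operators in divergence form
  identifies the two sides (\<open>gjms_expansion\<close>).\<close>

section \<open>Directional derivatives of smooth functions\<close>

definition ddir :: "'a::real_normed_vector \<Rightarrow> ('a \<Rightarrow> 'b::real_normed_vector) \<Rightarrow> 'a \<Rightarrow> 'b" where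
  "ddir v f x = frechet_derivative f (at x) v"

lemma pd_eq_ddir: "pd i = ddir (axis i 1)"
  by (simp add: fun_eq_iff pd_def ddir_def)

lemma ddir_unique: "(f has_derivative f') (at x) \<Longrightarrow> ddir v f x = f' v"
  using frechet_derivative_at unfolding ddir_def by metis

lemma has_derivative_ddir:
  "f differentiable (at x) \<Longrightarrow> (f has_derivative (\<lambda>v. ddir v f x)) (at x)"
  unfolding ddir_def using frechet_derivative_works by metis

lemma ddir_cong:
  assumes "open S" "x \<in> S" "\<And>y. y \<in> S \<Longrightarrow> f y = g y"
  shows "ddir v f x = ddir v g x" "f differentiable (at x) \<longleftrightarrow> g differentiable (at x)" (is ?P1)
proof -
  have *: "(f has_derivative D) (at x) \<longleftrightarrow> (g has_derivative D) (at x)" for D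
    by (metis assms has_derivative_transform_within_open)
  show "ddir v f x = ddir v g x" unfolding ddir_def frechet_derivative_def * ..
  show ?P1
    unfolding differentiable_def * ..
qed

lemma ddir_const [simp]: "ddir v (\<lambda>x. a) x = 0"
  by (simp add: ddir_unique[OF has_derivative_const])

lemma ddir_add:
  "f differentiable (at x) \<Longrightarrow> g differentiable (at x) \<Longrightarrow>
     ddir v (\<lambda>y. f y + g y) x = ddir v f x + ddir v g x"
  by (rule ddir_unique[OF has_derivative_add[OF has_derivative_ddir has_derivative_ddir]])

lemma ddir_diff:
  "f differentiable (at x) \<Longrightarrow> g differentiable (at x) \<Longrightarrow>
     ddir v (\<lambda>y. f y - g y) x = ddir v f x - ddir v g x"
  by (rule ddir_unique[OF has_derivative_diff[OF has_derivative_ddir has_derivative_ddir]])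

lemma ddir_minus:
  "f differentiable (at x) \<Longrightarrow> ddir v (\<lambda>y. - f y) x = - ddir v f x"
  by (rule ddir_unique[OF has_derivative_minus[OF has_derivative_ddir]])

lemma ddir_sum:
  "(\<And>i. i \<in> I \<Longrightarrow> f i differentiable (at x)) \<Longrightarrow>
     ddir v (\<lambda>y. \<Sum>i\<in>I. f i y) x = (\<Sum>i\<in>I. ddir v (f i) x)"
  by (rule ddir_unique[OF has_derivative_sum]) (rule has_derivative_ddir)

lemma ddir_bounded_linear:
  "bounded_linear L \<Longrightarrow> f differentiable (at x) \<Longrightarrow> ddir v (\<lambda>y. L (f y)) x = L (ddir v f x)"
  by (rule ddir_unique[OF bounded_linear.has_derivative[OF _ has_derivative_ddir]])

lemma ddir_bounded_bilinear:
  "bounded_bilinear B \<Longrightarrow> f differentiable (at x) \<Longrightarrow> g differentiable (at x) \<Longrightarrow>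
     ddir v (\<lambda>y. B (f y) (g y)) x = B (f x) (ddir v g x) + B (ddir v f x) (g x)"
  by (rule ddir_unique[OF bounded_bilinear.FDERIV[OF _ has_derivative_ddir has_derivative_ddir]])

lemmas ddir_mult = ddir_bounded_bilinear[OF bounded_bilinear_mult]

lemma ddir_cmult:
  fixes f :: "'a::real_normed_vector \<Rightarrow> real"
  shows "f differentiable (at x) \<Longrightarrow> ddir v (\<lambda>y. c * f y) x = c * ddir v f x"
  by (simp add: ddir_mult)

lemma ddir_scale_direction:
  "f differentiable (at x) \<Longrightarrow> ddir (c *\<^sub>R v) f x = c *\<^sub>R ddir v f x"
  by (rule linear_scale[OF has_derivative_linear[OF has_derivative_ddir]])

lemma ddir_chain:
  assumes "(\<phi> has_derivative \<phi>') (at x)" "f differentiable (at (\<phi> x))"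
  shows "ddir v (\<lambda>y. f (\<phi> y)) x = ddir (\<phi>' v) f (\<phi> x)"
  by (rule ddir_unique[OF has_derivative_compose[OF assms(1) has_derivative_ddir[OF assms(2)]]])

lemma differentiable_bounded_bilinear:
  "bounded_bilinear B \<Longrightarrow> f differentiable (at x) \<Longrightarrow> g differentiable (at x) \<Longrightarrow>
     (\<lambda>y. B (f y) (g y)) differentiable (at x)"
  by (rule differentiableI[OF bounded_bilinear.FDERIV[OF _ has_derivative_ddir has_derivative_ddir]])

lemma Ck_on_Suc:
  assumes "open S"
  shows "Ck_on (Suc k) S f \<longleftrightarrow>
    (\<forall>x\<in>S. f differentiable (at x)) \<and> (\<forall>v. Ck_on k S (ddir v f))"
  by (simp add: ddir_def[abs_def] differentiable_on_eq_differentiable_at[OF assms])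

declare Ck_on.simps(2) [simp del]

lemma Ck_on_cong:
  assumes "open S" "\<And>x. x \<in> S \<Longrightarrow> f x = g x"
  shows "Ck_on k S f = Ck_on k S g"
  using assms(2)
proof (induction k arbitrary: f g)
  case 0 then show ?case by (simp cong: continuous_on_cong)
next
  case (Suc k)
  have "Ck_on k S (ddir v f) = Ck_on k S (ddir v g)" for v
    by (rule Suc.IH, rule ddir_cong(1)[OF assms(1)]) (auto intro: Suc.prems)
  moreover have "f differentiable (at x) \<longleftrightarrow> g differentiable (at x)" if "x \<in> S" for x
    by (rule ddir_cong(2)[OF assms(1) that Suc.prems])
  ultimately show ?case by (simp add: Ck_on_Suc[OF assms(1)])
qed

lemma Ck_on_SucD: "open S \<Longrightarrow> Ck_on (Suc k) S f \<Longrightarrow> Ck_on k S f"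
proof (induction k arbitrary: f)
  case 0 then show ?case
    by (auto simp: Ck_on_Suc intro!: continuous_at_imp_continuous_on differentiable_imp_continuous_within)
next
  case (Suc k) then show ?case by (simp add: Ck_on_Suc[where k = "Suc k"] Ck_on_Suc[where k = k])
qed

lemma Ck_on_const: "open S \<Longrightarrow> Ck_on k S (\<lambda>x. a)"
proof (induction k arbitrary: a)
  case (Suc k) then show ?case using Ck_on_cong[OF Suc.prems, of "ddir _ (\<lambda>x. a)" "\<lambda>x. 0"]
    by (simp add: Ck_on_Suc)
qed simp

lemma Ck_on_add: "open S \<Longrightarrow> Ck_on k S f \<Longrightarrow> Ck_on k S g \<Longrightarrow> Ck_on k S (\<lambda>x. f x + g x)"
proof (induction k arbitrary: f g)
  case 0 then show ?case by (simp add: continuous_on_add)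
next
  case (Suc k)
  have "Ck_on k S (ddir v (\<lambda>x. f x + g x))" for v
    using Ck_on_cong[OF Suc.prems(1), of "ddir v (\<lambda>x. f x + g x)" "\<lambda>x. ddir v f x + ddir v g x"]
      Suc by (simp add: Ck_on_Suc ddir_add)
  then show ?case using Suc by (simp add: Ck_on_Suc)
qed

lemma Ck_on_bilinear:
  assumes "bounded_bilinear B" "open S"
  shows "Ck_on k S f \<Longrightarrow> Ck_on k S g \<Longrightarrow> Ck_on k S (\<lambda>x. B (f x) (g x))"
proof (induction k arbitrary: f g)
  case 0 then show ?case using bounded_bilinear.continuous_on[OF assms(1)] by simp
next
  case (Suc k)
  have *: "Ck_on k S f" "Ck_on k S g" using Suc.prems Ck_on_SucD[OF assms(2)] by auto
  have "Ck_on k S (ddir v (\<lambda>x. B (f x) (g x)))" for v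
    using Ck_on_cong[OF assms(2), of "ddir v (\<lambda>x. B (f x) (g x))"
        "\<lambda>x. B (f x) (ddir v g x) + B (ddir v f x) (g x)"] * Suc
    by (simp add: Ck_on_Suc assms ddir_bounded_bilinear[OF assms(1)] Ck_on_add)
  then show ?case using Suc.prems
    by (simp add: Ck_on_Suc assms differentiable_bounded_bilinear[OF assms(1)])
qed

lemma Ck_on_inverse:
  fixes f :: "'a::real_normed_vector \<Rightarrow> real"
  assumes "open S" "\<And>x. x \<in> S \<Longrightarrow> f x \<noteq> 0"
  shows "Ck_on k S f \<Longrightarrow> Ck_on k S (\<lambda>x. inverse (f x))"
proof (induction k)
  case 0 then show ?case using assms by (auto intro!: continuous_intros)
next
  case (Suc k)
  have i: "Ck_on k S (\<lambda>x. inverse (f x))" using Suc Ck_on_SucD[OF assms(1)] by auto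
  have d: "((\<lambda>x. inverse (f x)) has_derivative (\<lambda>v. - (inverse (f x) * ddir v f x * inverse (f x)))) (at x)"
    if "x \<in> S" for x
    by (rule Deriv.has_derivative_inverse[OF _ has_derivative_ddir])
       (use that assms Suc.prems in \<open>auto simp: Ck_on_Suc\<close>)
  have "ddir v (\<lambda>x. inverse (f x)) x = (- 1) * (inverse (f x) * (ddir v f x * inverse (f x)))"
    if "x \<in> S" for v x
    using ddir_unique[OF d[OF that]] by simp
  moreover have "Ck_on k S (\<lambda>x. (- 1) * (inverse (f x) * (ddir v f x * inverse (f x))))" for v
    using Suc.prems by (intro Ck_on_bilinear[OF bounded_bilinear_mult] Ck_on_const i assms)
      (simp add: Ck_on_Suc assms)
  ultimately have "Ck_on k S (ddir v (\<lambda>x. inverse (f x)))" for v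
    using Ck_on_cong[OF assms(1)] by (metis (no_types, lifting))
  then show ?case using d by (auto simp: Ck_on_Suc assms differentiable_def)
qed

lemma smooth_on_differentiable: "open S \<Longrightarrow> smooth_on S f \<Longrightarrow> x \<in> S \<Longrightarrow> f differentiable (at x)"
  unfolding smooth_on_def using Ck_on_Suc by blast

lemma smooth_on_ddir: "open S \<Longrightarrow> smooth_on S f \<Longrightarrow> smooth_on S (ddir v f)"
  unfolding smooth_on_def using Ck_on_Suc by blast

lemma smooth_on_continuous: "smooth_on S f \<Longrightarrow> continuous_on S f"
  unfolding smooth_on_def using Ck_on.simps(1) by blast

lemma smooth_on_cong: "open S \<Longrightarrow> (\<And>x. x \<in> S \<Longrightarrow> f x = g x) \<Longrightarrow> smooth_on S f = smooth_on S g"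
  unfolding smooth_on_def using Ck_on_cong by blast

lemma smooth_on_const: "open S \<Longrightarrow> smooth_on S (\<lambda>x. a)"
  unfolding smooth_on_def using Ck_on_const by blast

lemma smooth_on_add: "open S \<Longrightarrow> smooth_on S f \<Longrightarrow> smooth_on S g \<Longrightarrow> smooth_on S (\<lambda>x. f x + g x)"
  unfolding smooth_on_def using Ck_on_add by blast

lemma smooth_on_bilinear:
  "bounded_bilinear B \<Longrightarrow> open S \<Longrightarrow> smooth_on S f \<Longrightarrow> smooth_on S g \<Longrightarrow>
     smooth_on S (\<lambda>x. B (f x) (g x))"
  unfolding smooth_on_def using Ck_on_bilinear by blast

lemmas smooth_on_mult = smooth_on_bilinear[OF bounded_bilinear_mult]

lemma smooth_on_inverse:
  fixes f :: "'a::real_normed_vector \<Rightarrow> real"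
  shows "open S \<Longrightarrow> smooth_on S f \<Longrightarrow> (\<And>x. x \<in> S \<Longrightarrow> f x \<noteq> 0) \<Longrightarrow> smooth_on S (\<lambda>x. inverse (f x))"
  unfolding smooth_on_def using Ck_on_inverse by blast

lemma smooth_on_minus: "open S \<Longrightarrow> smooth_on S f \<Longrightarrow> smooth_on S (\<lambda>x. - f x)"
  by (rule smooth_component) (auto intro: bounded_linear_minus bounded_linear_ident)

lemma smooth_on_diff: "open S \<Longrightarrow> smooth_on S f \<Longrightarrow> smooth_on S g \<Longrightarrow> smooth_on S (\<lambda>x. f x - g x)"
  using smooth_on_add[of S f "\<lambda>x. - g x"] smooth_on_minus[of S g] by simp

lemma smooth_on_sum:
  "open S \<Longrightarrow> (\<And>i. i \<in> I \<Longrightarrow> smooth_on S (f i)) \<Longrightarrow> smooth_on S (\<lambda>x. \<Sum>i\<in>I. f i x)"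
  by (induction I rule: infinite_finite_induct) (auto intro: smooth_on_const smooth_on_add)

lemma smooth_on_prod:
  fixes f :: "'i \<Rightarrow> 'a::real_normed_vector \<Rightarrow> real"
  shows "open S \<Longrightarrow> (\<And>i. i \<in> I \<Longrightarrow> smooth_on S (f i)) \<Longrightarrow> smooth_on S (\<lambda>x. \<Prod>i\<in>I. f i x)"
  by (induction I rule: infinite_finite_induct) (auto intro: smooth_on_const smooth_on_mult)

text \<open>Both mixed second difference quotients are, by the mean value theorem applied twice, values
  of the corresponding mixed derivative near \<open>x\<close>.\<close>

lemma second_difference:
  fixes f :: "'a::real_normed_vector \<Rightarrow> real"
  assumes f: "\<And>y. y \<in> ball x r \<Longrightarrow> f differentiable (at y)"
    "\<And>y. y \<in> ball x r \<Longrightarrow> ddir v f differentiable (at y)"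
    and h: "h > 0" "h * (norm v + norm w) < r"
  obtains y where "dist y x \<le> h * (norm v + norm w)"
    "f (x + h *\<^sub>R v + h *\<^sub>R w) - f (x + h *\<^sub>R v) - f (x + h *\<^sub>R w) + f x = h * h * ddir w (ddir v f) y"
proof -
  have in_ball: "dist (x + s *\<^sub>R v + t *\<^sub>R w) x \<le> h * (norm v + norm w)"
    "x + s *\<^sub>R v + t *\<^sub>R w \<in> ball x r" if "0 \<le> s" "s \<le> h" "0 \<le> t" "t \<le> h" for s t
  proof -
    have "norm (s *\<^sub>R v + t *\<^sub>R w) \<le> s * norm v + t * norm w"
      using that norm_triangle_ineq[of "s *\<^sub>R v" "t *\<^sub>R w"] by simp
    also have "\<dots> \<le> h * (norm v + norm w)"
      using that by (simp add: distrib_left add_mono mult_right_mono)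
    finally show "dist (x + s *\<^sub>R v + t *\<^sub>R w) x \<le> h * (norm v + norm w)"
      by (simp add: dist_norm add.assoc)
    then show "x + s *\<^sub>R v + t *\<^sub>R w \<in> ball x r" using h by (simp add: dist_commute)
  qed
  have line: "((\<lambda>s. F (a + s *\<^sub>R e)) has_real_derivative ddir e F (a + s *\<^sub>R e)) (at s)"
    if "F differentiable (at (a + s *\<^sub>R e))" for F :: "'a \<Rightarrow> real" and a e s
  proof -
    have "((\<lambda>s. a + s *\<^sub>R e) has_derivative (\<lambda>s. s *\<^sub>R e)) (at s)"
      by (auto intro!: derivative_eq_intros)
    from has_derivative_compose[OF this has_derivative_ddir[OF that]]
    have "((\<lambda>s. F (a + s *\<^sub>R e)) has_derivative (\<lambda>t. t * ddir e F (a + s *\<^sub>R e))) (at s)"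
      by (simp add: ddir_scale_direction[OF that])
    moreover have "(\<lambda>t. t * ddir e F (a + s *\<^sub>R e)) = (*) (ddir e F (a + s *\<^sub>R e))"
      by (simp add: fun_eq_iff)
    ultimately show ?thesis by (simp add: has_field_derivative_def)
  qed
  let ?g = "\<lambda>s. f (x + h *\<^sub>R w + s *\<^sub>R v) - f (x + s *\<^sub>R v)"
  have "(?g has_real_derivative ddir v f (x + h *\<^sub>R w + s *\<^sub>R v) - ddir v f (x + s *\<^sub>R v)) (at s)"
    if "0 \<le> s" "s \<le> h" for s
  proof -
    have "x + h *\<^sub>R w + s *\<^sub>R v \<in> ball x r" "x + s *\<^sub>R v \<in> ball x r"
      using in_ball(2)[of s h] in_ball(2)[of s 0] that h(1) by (simp_all add: add_ac)
    then show ?thesis by (intro DERIV_diff line[where F = f] f)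
  qed
  from MVT2[OF h(1) this] obtain s where s: "0 < s" "s < h"
    "?g h - ?g 0 = (h - 0) * (ddir v f (x + h *\<^sub>R w + s *\<^sub>R v) - ddir v f (x + s *\<^sub>R v))" by auto
  let ?k = "\<lambda>t. ddir v f (x + s *\<^sub>R v + t *\<^sub>R w)"
  have "(?k has_real_derivative ddir w (ddir v f) (x + s *\<^sub>R v + t *\<^sub>R w)) (at t)"
    if "0 \<le> t" "t \<le> h" for t
    by (rule line[where F = "ddir v f"], rule f(2), rule in_ball(2)) (use that s in auto)
  from MVT2[OF h(1) this] obtain t where t: "0 < t" "t < h"
    "?k h - ?k 0 = (h - 0) * ddir w (ddir v f) (x + s *\<^sub>R v + t *\<^sub>R w)" by auto
  show thesis
  proof (rule that)
    show "dist (x + s *\<^sub>R v + t *\<^sub>R w) x \<le> h * (norm v + norm w)"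
      using in_ball(1)[of s t] s t by simp
    show "f (x + h *\<^sub>R v + h *\<^sub>R w) - f (x + h *\<^sub>R v) - f (x + h *\<^sub>R w) + f x
        = h * h * ddir w (ddir v f) (x + s *\<^sub>R v + t *\<^sub>R w)"
      using s(3) t(3) by (simp add: algebra_simps)
  qed
qed

lemma ddir_commute_real:
  fixes f :: "'a::real_normed_vector \<Rightarrow> real"
  assumes S: "open S" "x \<in> S" and f: "smooth_on S f"
  shows "ddir v (ddir w f) x = ddir w (ddir v f) x"
proof (rule ccontr)
  let ?A = "ddir v (ddir w f)" and ?B = "ddir w (ddir v f)"
  assume ne: "?A x \<noteq> ?B x"
  define \<epsilon> where "\<epsilon> = \<bar>?A x - ?B x\<bar> / 2"
  have \<epsilon>: "\<epsilon> > 0" using ne by (simp add: \<epsilon>_def)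
  have "continuous (at x) (ddir a (ddir b f))" for a b
    using smooth_on_continuous[OF smooth_on_ddir[OF S(1) smooth_on_ddir[OF S(1) f]]] S
    by (simp add: continuous_on_eq_continuous_at)
  then have cont: "\<exists>d>0. \<forall>y. dist y x < d \<longrightarrow> \<bar>ddir a (ddir b f) y - ddir a (ddir b f) x\<bar> < \<epsilon>" for a b
    using \<epsilon> unfolding continuous_at_eps_delta dist_real_def by simp
  from cont[of v w] obtain d1 where d1: "d1 > 0" "\<And>y. dist y x < d1 \<Longrightarrow> \<bar>?A y - ?A x\<bar> < \<epsilon>" by auto
  from cont[of w v] obtain d2 where d2: "d2 > 0" "\<And>y. dist y x < d2 \<Longrightarrow> \<bar>?B y - ?B x\<bar> < \<epsilon>" by auto
  note d = d1 d2
  obtain r where r: "r > 0" "ball x r \<subseteq> S" using S open_contains_ball by blast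
  define \<delta> where "\<delta> = min r (min d1 d2)"
  have \<delta>: "\<delta> > 0" using r d by (simp add: \<delta>_def)
  define h where "h = \<delta> / (2 * (norm v + norm w + 1))"
  have nn: "norm v + norm w + 1 > 0" by (simp add: add_nonneg_pos)
  have h: "h > 0" using \<delta> nn unfolding h_def by (intro divide_pos_pos) auto
  have "h * (norm v + norm w) \<le> h * (norm v + norm w + 1)" using h by simp
  also have "\<dots> = \<delta> / 2" using nn unfolding h_def by (simp add: field_simps)
  finally have hd: "h * (norm v + norm w) < \<delta>" using \<delta> by simp
  have diff: "f differentiable (at y)" "ddir u f differentiable (at y)" if "y \<in> ball x r" for u y
    using smooth_on_differentiable[OF S(1) f] smooth_on_differentiable[OF S(1) smooth_on_ddir[OF S(1) f]]
      r that by blast+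
  obtain y where y: "dist y x \<le> h * (norm v + norm w)"
    "f (x + h *\<^sub>R v + h *\<^sub>R w) - f (x + h *\<^sub>R v) - f (x + h *\<^sub>R w) + f x = h * h * ?B y"
    by (rule second_difference[where f = f and v = v and w = w and x = x and r = r and h = h])
      (use diff h hd in \<open>auto simp: \<delta>_def\<close>)
  obtain z where z: "dist z x \<le> h * (norm w + norm v)"
    "f (x + h *\<^sub>R w + h *\<^sub>R v) - f (x + h *\<^sub>R w) - f (x + h *\<^sub>R v) + f x = h * h * ?A z"
    by (rule second_difference[where f = f and v = w and w = v and x = x and r = r and h = h])
      (use diff h hd in \<open>auto simp: \<delta>_def add.commute\<close>)
  have "h * h * ?B y = h * h * ?A z" using y(2) z(2) by (simp add: algebra_simps)
  then have "?B y = ?A z" using h by simp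
  moreover have "\<bar>?A z - ?A x\<bar> < \<epsilon>" "\<bar>?B y - ?B x\<bar> < \<epsilon>"
    using y(1) z(1) hd by (auto intro!: d simp: \<delta>_def add.commute)
  moreover have "\<bar>?A x - ?B x\<bar> = 2 * \<epsilon>" by (simp add: \<epsilon>_def)
  ultimately show False by linarith
qed

text \<open>The vector-valued case is read off from inner products with basis vectors.\<close>

lemma ddir_commute:
  fixes f :: "'a::real_normed_vector \<Rightarrow> 'b::euclidean_space"
  assumes S: "open S" "x \<in> S" and f: "smooth_on S f"
  shows "ddir v (ddir w f) x = ddir w (ddir v f) x"
proof (rule euclidean_eqI)
  fix b :: 'b
  have bl: "bounded_linear (\<lambda>y::'b. y \<bullet> b)" by (rule bounded_linear_inner_left)
  note d = smooth_on_differentiable[OF S(1)]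
  have 1: "ddir u (\<lambda>y. F y \<bullet> b) y = ddir u F y \<bullet> b" if "smooth_on S F" "y \<in> S" for F u y
    by (rule ddir_bounded_linear[OF bl d[OF that]])
  have 2: "ddir v (ddir w f) x \<bullet> b = ddir v (ddir w (\<lambda>y. f y \<bullet> b)) x" for v w
    unfolding 1[OF smooth_on_ddir[OF S(1) f] S(2), symmetric]
    by (rule ddir_cong(1)[OF S], rule sym, rule 1[OF f])
  show "ddir v (ddir w f) x \<bullet> b = ddir w (ddir v f) x \<bullet> b"
    unfolding 2 by (rule ddir_commute_real[OF S smooth_component[OF S(1) f bl]])
qed

section \<open>Matrix-valued functions\<close>

lemma matrix_eqI: "(\<And>i j. A $ i $ j = B $ i $ j) \<Longrightarrow> A = B"
  by (simp add: vec_eq_iff)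

lemma matrix_mul_nth: "(A ** B) $ i $ j = (\<Sum>k\<in>UNIV. A $ i $ k * B $ k $ j)"
  by (simp add: matrix_matrix_mult_def)

lemma transpose_nth [simp]: "transpose A $ i $ j = A $ j $ i"
  by (simp add: transpose_def)

lemma mat_nth: "mat a $ i $ j = (if i = j then a else 0)"
  by (simp add: mat_def)

lemma matrix_vector_nth: "(A *v x) $ i = (\<Sum>k\<in>UNIV. A $ i $ k * x $ k)"
  by (simp add: matrix_vector_mult_def)

lemma matrix_mul_simps:
  fixes A B C :: "real^'n::finite^'n"
  shows "(A + B) ** C = A ** C + B ** C" "A ** (B + C) = A ** B + A ** C"
    "(A - B) ** C = A ** C - B ** C" "A ** (B - C) = A ** B - A ** C"
    "(- A) ** C = - (A ** C)" "A ** (- C) = - (A ** C)"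
    "(r *\<^sub>R A) ** C = r *\<^sub>R (A ** C)" "A ** (r *\<^sub>R C) = r *\<^sub>R (A ** C)"
    "0 ** C = 0" "A ** 0 = 0"
  by (simp_all add: vec_eq_iff matrix_mul_nth algebra_simps sum.distrib sum_subtractf sum_negf
      sum_distrib_left)

lemma transpose_simps:
  fixes A B :: "real^'n::finite^'n"
  shows "transpose (A + B) = transpose A + transpose B"
    "transpose (A - B) = transpose A - transpose B"
    "transpose (- A) = - transpose A" "transpose (r *\<^sub>R A) = r *\<^sub>R transpose A"
    "transpose (A ** B) = transpose B ** transpose A" "transpose 0 = (0 :: real^'n^'n)"
  by (simp_all add: vec_eq_iff matrix_transpose_mul)

lemma trace_simps:
  fixes A B :: "real^'n::finite^'n"
  shows "trace (A + B) = trace A + trace B" "trace (A - B) = trace A - trace B"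
    "trace (- A) = - trace A" "trace (r *\<^sub>R A) = r * trace A" "trace (0 :: real^'n^'n) = 0"
    "trace (transpose A) = trace A"
  by (simp_all add: trace_def sum.distrib sum_subtractf sum_negf sum_distrib_left)

lemma trace_mul: "trace (A ** B) = (\<Sum>i\<in>UNIV. \<Sum>j\<in>UNIV. A $ i $ j * B $ j $ i)"
  by (simp add: trace_def matrix_mul_nth)

lemma symmetric_nth: "transpose A = A \<Longrightarrow> A $ i $ j = A $ j $ i"
  by (metis transpose_nth)

subsection \<open>Inverse matrices\<close>

lemma matrix_inv_works:
  fixes A :: "real^'n::finite^'n"
  assumes "det A \<noteq> 0"
  shows "A ** matrix_inv A = mat 1" "matrix_inv A ** A = mat 1"
proof -
  have "A ** matrix_inv A = mat 1 \<and> matrix_inv A ** A = mat 1"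
    using assms unfolding matrix_inv_def invertible_det_nz[symmetric] invertible_def
    by (rule someI2_ex) simp
  then show "A ** matrix_inv A = mat 1" "matrix_inv A ** A = mat 1" by auto
qed

lemma matrix_inv_unique:
  fixes A B :: "real^'n::finite^'n"
  assumes "A ** B = mat 1"
  shows "matrix_inv A = B" "det A \<noteq> 0"
proof -
  show d: "det A \<noteq> 0"
    using assms invertible_det_nz invertible_right_inverse by blast
  have "matrix_inv A ** (A ** B) = B"
    by (simp add: matrix_mul_assoc matrix_inv_works[OF d])
  then show "matrix_inv A = B" by (simp add: assms)
qed

lemma transpose_matrix_inv:
  fixes A :: "real^'n::finite^'n"
  assumes "det A \<noteq> 0"
  shows "transpose (matrix_inv A) = matrix_inv (transpose A)"
  using matrix_inv_unique(1)[of "transpose A" "transpose (matrix_inv A)"]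
    matrix_inv_works(2)[OF assms] by (simp flip: matrix_transpose_mul)

lemma positive_definite_det:
  fixes A :: "real^'n::finite^'n"
  assumes "positive_definite A"
  shows "det A \<noteq> 0"
proof -
  have "A *v x \<noteq> 0" if "x \<noteq> 0" for x
    using assms that unfolding positive_definite_def by (metis inner_zero_right less_irrefl)
  then have "\<exists>B. B ** A = mat 1"
    unfolding matrix_left_invertible_ker by blast
  then show ?thesis by (simp add: invertible_left_inverse flip: invertible_det_nz)
qed

subsection \<open>Derivatives of matrix-valued functions\<close>

lemma bounded_linear_entry: "bounded_linear (\<lambda>A::real^'m::finite^'n::finite. A $ i $ j)"
  using bounded_linear_compose[OF bounded_linear_vec_nth bounded_linear_vec_nth] .

lemma bounded_bilinear_matrix_mul:
  "bounded_bilinear ((**) :: real^'m::finite^'n::finite \<Rightarrow> real^'p::finite^'m \<Rightarrow> real^'p^'n)"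
proof -
  have "bilinear ((**) :: real^'m^'n \<Rightarrow> real^'p^'m \<Rightarrow> real^'p^'n)"
    unfolding bilinear_def linear_iff
    by (simp add: vec_eq_iff matrix_mul_nth algebra_simps sum.distrib sum_distrib_left)
  then show ?thesis by (simp add: bilinear_conv_bounded_bilinear)
qed

lemma bounded_linear_trace: "bounded_linear (trace :: real^'n::finite^'n \<Rightarrow> real)"
  unfolding linear_conv_bounded_linear[symmetric] linear_iff by (simp add: trace_simps)

lemma bounded_linear_transpose: "bounded_linear (transpose :: real^'n::finite^'n \<Rightarrow> real^'n^'n)"
  unfolding linear_conv_bounded_linear[symmetric] linear_iff by (simp add: transpose_simps)

lemmas ddir_matrix_mul = ddir_bounded_bilinear[OF bounded_bilinear_matrix_mul]
lemmas differentiable_matrix_mul = differentiable_bounded_bilinear[OF bounded_bilinear_matrix_mul]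
lemmas smooth_on_matrix_mul = smooth_on_bilinear[OF bounded_bilinear_matrix_mul]
lemmas ddir_entry = ddir_bounded_linear[OF bounded_linear_entry]
lemmas ddir_trace = ddir_bounded_linear[OF bounded_linear_trace]
lemmas ddir_transpose = ddir_bounded_linear[OF bounded_linear_transpose]

lemma smooth_on_entry:
  fixes G :: "'a::real_normed_vector \<Rightarrow> real^'m::finite^'n::finite"
  shows "open S \<Longrightarrow> smooth_on S G \<Longrightarrow> smooth_on S (\<lambda>x. G x $ i $ j)"
  by (rule smooth_component[OF _ _ bounded_linear_entry])

lemma smooth_on_trace:
  fixes G :: "'a::real_normed_vector \<Rightarrow> real^'n::finite^'n"
  shows "open S \<Longrightarrow> smooth_on S G \<Longrightarrow> smooth_on S (\<lambda>x. trace (G x))"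
  by (rule smooth_component[OF _ _ bounded_linear_trace])

lemma matrix_eq_sum_axis:
  fixes A :: "real^'m::finite^'n::finite"
  shows "A = (\<Sum>i\<in>UNIV. \<Sum>j\<in>UNIV. (A $ i $ j) *\<^sub>R axis i (axis j 1))"
proof (rule matrix_eqI)
  fix a b
  have "(\<Sum>i\<in>UNIV. \<Sum>j\<in>UNIV. (A $ i $ j) *\<^sub>R (axis i (axis j 1) :: real^'m^'n)) $ a $ b
    = (\<Sum>i\<in>UNIV. \<Sum>j\<in>UNIV. if i = a then if j = b then A $ i $ j else 0 else 0)"
    by (simp add: axis_def) (intro sum.cong refl, auto)
  also have "\<dots> = (\<Sum>i\<in>UNIV. if i = a then \<Sum>j\<in>UNIV. if j = b then A $ i $ j else 0 else 0)"
    by (intro sum.cong refl) auto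
  also have "\<dots> = A $ a $ b" by (simp add: sum.delta)
  finally show "A $ a $ b = (\<Sum>i\<in>UNIV. \<Sum>j\<in>UNIV. (A $ i $ j) *\<^sub>R (axis i (axis j 1) :: real^'m^'n)) $ a $ b" ..
qed

lemma smooth_on_matrixI:
  fixes G :: "'a::real_normed_vector \<Rightarrow> real^'m::finite^'n::finite"
  assumes "open S" "\<And>i j. smooth_on S (\<lambda>x. G x $ i $ j)"
  shows "smooth_on S G"
proof -
  have eq: "G = (\<lambda>x. \<Sum>i\<in>UNIV. \<Sum>j\<in>UNIV. (G x $ i $ j) *\<^sub>R axis i (axis j 1))"
    by (rule ext) (rule matrix_eq_sum_axis)
  show ?thesis
    by (subst eq) (intro smooth_on_sum assms smooth_on_bilinear[OF bounded_bilinear_scaleR] smooth_on_const)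
qed

lemma differentiable_matrixI:
  fixes G :: "'a::real_normed_vector \<Rightarrow> real^'m::finite^'n::finite"
  assumes "\<And>i j. (\<lambda>x. G x $ i $ j) differentiable (at x)"
  shows "G differentiable (at x)"
proof -
  have eq: "G = (\<lambda>x. \<Sum>i\<in>UNIV. \<Sum>j\<in>UNIV. (G x $ i $ j) *\<^sub>R axis i (axis j 1))"
    by (rule ext) (rule matrix_eq_sum_axis)
  show ?thesis
    by (subst eq) (intro differentiable_sum differentiable_bounded_bilinear[OF bounded_bilinear_scaleR] assms
      differentiable_const finite ballI)
qed

lemma smooth_on_det:
  fixes G :: "'a::real_normed_vector \<Rightarrow> real^'n::finite^'n"
  assumes "open S" "\<And>i j. smooth_on S (\<lambda>x. G x $ i $ j)"
  shows "smooth_on S (\<lambda>x. det (G x))"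
  unfolding det_def by (intro smooth_on_sum smooth_on_mult smooth_on_const smooth_on_prod assms)

text \<open>Cramer's rule, which makes the entries of the inverse rational functions of the entries, hence smooth.\<close>

lemma matrix_inv_nth:
  fixes A :: "real^'n::finite^'n"
  assumes "det A \<noteq> 0"
  shows "matrix_inv A $ i $ j = det (\<chi> a b. if b = i then axis j 1 $ a else A $ a $ b) * inverse (det A)"
proof -
  have "A *v (matrix_inv A *v axis j 1) = axis j 1"
    by (simp add: matrix_vector_mul_assoc matrix_inv_works[OF assms])
  then have "matrix_inv A *v axis j 1 = (\<chi> k. det (\<chi> a b. if b = k then axis j 1 $ a else A $ a $ b) / det A)"
    using cramer[OF assms] by blast
  moreover have "(matrix_inv A *v axis j 1) $ i = matrix_inv A $ i $ j"
    by (simp add: matrix_vector_nth axis_def if_distrib cong: if_cong)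
  ultimately show ?thesis by (simp add: divide_inverse)
qed

lemma smooth_on_matrix_inv:
  fixes G :: "'a::real_normed_vector \<Rightarrow> real^'n::finite^'n"
  assumes "open S" "smooth_on S G" "\<And>x. x \<in> S \<Longrightarrow> det (G x) \<noteq> 0"
  shows "smooth_on S (\<lambda>x. matrix_inv (G x))"
proof (rule smooth_on_matrixI[OF assms(1)])
  fix i j
  have "smooth_on S (\<lambda>x. det (\<chi> a b. if b = i then axis j 1 $ a else G x $ a $ b) * inverse (det (G x)))"
  proof (intro smooth_on_mult smooth_on_inverse smooth_on_det assms)
    fix a b show "smooth_on S (\<lambda>x. (\<chi> a b. if b = i then axis j 1 $ a else G x $ a $ b) $ a $ b)"
      using smooth_on_const[OF assms(1)] smooth_on_entry[OF assms(1,2)] by (cases "b = i") simp_all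
  qed (use smooth_on_entry[OF assms(1,2)] in auto)
  then show "smooth_on S (\<lambda>x. matrix_inv (G x) $ i $ j)"
    using smooth_on_cong[OF assms(1) matrix_inv_nth[OF assms(3)]] by simp
qed

text \<open>Differentiating $K G = 1$, once $K$ is known to be smooth.\<close>

lemma ddir_matrix_inv:
  fixes G :: "'a::real_normed_vector \<Rightarrow> real^'n::finite^'n"
  assumes S: "open S" "x \<in> S" and G: "smooth_on S G" "\<And>x. x \<in> S \<Longrightarrow> det (G x) \<noteq> 0"
  shows "ddir v (\<lambda>x. matrix_inv (G x)) x = - (matrix_inv (G x) ** ddir v G x ** matrix_inv (G x))"
proof -
  let ?K = "\<lambda>x. matrix_inv (G x)"
  have d: "?K differentiable (at x)" "G differentiable (at x)"
    using smooth_on_differentiable S G smooth_on_matrix_inv by blast+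
  have "ddir v (\<lambda>x. ?K x ** G x) x = ddir v (\<lambda>x. mat 1 :: real^'n^'n) x"
    by (rule ddir_cong[OF S]) (use matrix_inv_works[OF G(2)] in auto)
  then have "ddir v ?K x ** G x = - (?K x ** ddir v G x)"
    by (simp add: ddir_matrix_mul[OF d] eq_neg_iff_add_eq_0 add.commute)
  then have "ddir v ?K x ** (G x ** ?K x) = - (?K x ** ddir v G x) ** ?K x"
    by (simp add: matrix_mul_assoc)
  then show ?thesis
    by (simp add: matrix_inv_works[OF G(2)[OF S(2)]] matrix_mul_simps)
qed

subsection \<open>The derivative of the determinant\<close>

text \<open>At the identity every factor of a summand of the Leibniz formula but one is a Kronecker symbol, and
  a permutation fixing all indices but one is the identity.\<close>

lemma has_derivative_det_at_identity:
  fixes N :: "'a::real_normed_vector \<Rightarrow> real^'n::finite^'n"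
  assumes "N differentiable (at x)" "N x = mat 1"
  shows "((\<lambda>y. det (N y)) has_derivative (\<lambda>v. trace (ddir v N x))) (at x)"
proof -
  have e: "((\<lambda>y. N y $ i $ j) has_derivative (\<lambda>v. ddir v N x $ i $ j)) (at x)" for i j
    by (rule bounded_linear.has_derivative[OF bounded_linear_entry has_derivative_ddir[OF assms(1)]])
  have "((\<lambda>y. det (N y)) has_derivative (\<lambda>v. \<Sum>p | p permutes UNIV.
      of_int (sign p) * (\<Sum>i\<in>UNIV. ddir v N x $ i $ p i * (\<Prod>j\<in>UNIV - {i}. N x $ j $ p j)))) (at x)"
    unfolding det_def
    by (intro has_derivative_sum has_derivative_mult_right has_derivative_prod e)
  moreover have "(\<Sum>p | p permutes UNIV.
      of_int (sign p) * (\<Sum>i\<in>UNIV. ddir v N x $ i $ p i * (\<Prod>j\<in>UNIV - {i}. N x $ j $ p j)))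
    = trace (ddir v N x)" for v
  proof -
    have "of_int (sign p) * (\<Sum>i\<in>UNIV. ddir v N x $ i $ p i * (\<Prod>j\<in>UNIV - {i}. N x $ j $ p j))
        = (if p = id then trace (ddir v N x) else 0)" if p: "p permutes UNIV" for p
    proof (cases "p = id")
      case True
      then show ?thesis by (simp add: assms(2) mat_nth trace_def)
    next
      case False
      have "(\<Prod>j\<in>UNIV - {i}. N x $ j $ p j) = 0" for i
      proof -
        obtain j where j: "p j \<noteq> j" using False by (auto simp: fun_eq_iff)
        then have "p (p j) \<noteq> p j" using permutes_inj[OF p] by (metis injD)
        then have "\<exists>k. k \<noteq> i \<and> p k \<noteq> k" using j by metis
        then obtain k where "k \<in> UNIV - {i}" "p k \<noteq> k" by blast
        then show ?thesis by (intro prod_zero) (auto simp: assms(2) mat_nth intro!: bexI[of _ k])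
      qed
      then show ?thesis using False by (simp only: mult_zero_right sum.neutral_const if_False)
    qed
    then have "(\<Sum>p | p permutes UNIV.
      of_int (sign p) * (\<Sum>i\<in>UNIV. ddir v N x $ i $ p i * (\<Prod>j\<in>UNIV - {i}. N x $ j $ p j)))
      = (\<Sum>p | p permutes (UNIV::'n set). if p = id then trace (ddir v N x) else 0)"
      by (intro sum.cong) auto
    then show ?thesis by (simp add: sum.delta permutes_id finite_permutations)
  qed
  ultimately show ?thesis by simp
qed

text \<open>Jacobi's formula, by multiplying with the constant matrix \<open>matrix_inv (G x)\<close>.\<close>

lemma has_derivative_det:
  fixes G :: "'a::real_normed_vector \<Rightarrow> real^'n::finite^'n"
  assumes "G differentiable (at x)" "det (G x) \<noteq> 0"
  shows "((\<lambda>y. det (G y)) has_derivative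
    (\<lambda>v. det (G x) * trace (matrix_inv (G x) ** ddir v G x))) (at x)"
proof -
  let ?K = "matrix_inv (G x)"
  have "((\<lambda>y. det (?K ** G y)) has_derivative (\<lambda>v. trace (ddir v (\<lambda>y. ?K ** G y) x))) (at x)"
    by (rule has_derivative_det_at_identity)
      (use assms in \<open>auto intro!: differentiable_matrix_mul simp: matrix_inv_works\<close>)
  then have "((\<lambda>y. det (G x) * det (?K ** G y)) has_derivative
      (\<lambda>v. det (G x) * trace (?K ** ddir v G x))) (at x)"
    by (intro has_derivative_mult_right) (simp add: ddir_matrix_mul assms matrix_mul_simps)
  moreover have "det (G x) * det (?K ** G y) = det (G y)" for y
  proof -
    have "det (G x) * det ?K = 1" using matrix_inv_works[OF assms(2)] by (metis det_I det_mul)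
    then show ?thesis by (simp add: det_mul flip: mult.assoc)
  qed
  ultimately show ?thesis by simp
qed

lemma has_derivative_volume_density:
  fixes G :: "real^'k::finite \<Rightarrow> real^'k^'k"
  assumes "G differentiable (at x)" "det (G x) \<noteq> 0"
  shows "(volume_density G has_derivative
    (\<lambda>v. volume_density G x * (trace (ginv G x ** ddir v G x) / 2))) (at x)"
proof -
  have "((\<lambda>s. sqrt \<bar>s\<bar>) has_real_derivative
        sgn (det (G x)) * (inverse (sqrt \<bar>det (G x)\<bar>) / 2)) (at (det (G x)))"
    using assms(2) by (auto intro!: derivative_eq_intros abs_derivative)
  from has_derivative_compose[OF has_derivative_det[OF assms] this[unfolded has_field_derivative_def]]
  have "(volume_density G has_derivative (\<lambda>v. sgn (det (G x)) * (inverse (sqrt \<bar>det (G x)\<bar>) / 2)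
      * (det (G x) * trace (matrix_inv (G x) ** ddir v G x)))) (at x)"
    by (simp add: volume_density_def[abs_def])
  moreover
  have "sgn d * (inverse (sqrt \<bar>d\<bar>) / 2) * (d * t) = sqrt \<bar>d\<bar> * (t / 2)" if "d \<noteq> 0" for d t :: real
  proof -
    have "sgn d * d = sqrt \<bar>d\<bar> * sqrt \<bar>d\<bar>" by (simp add: sgn_if)
    then have "sgn d * (inverse (sqrt \<bar>d\<bar>) / 2) * (d * t) = sqrt \<bar>d\<bar> * sqrt \<bar>d\<bar> * (inverse (sqrt \<bar>d\<bar>) / 2) * t"
      by (metis mult.assoc mult.commute)
    then show ?thesis using that by (simp add: field_simps)
  qed
  from this[OF assms(2)] have "(\<lambda>v. sgn (det (G x)) * (inverse (sqrt \<bar>det (G x)\<bar>) / 2)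
      * (det (G x) * trace (matrix_inv (G x) ** ddir v G x)))
    = (\<lambda>v. volume_density G x * (trace (ginv G x ** ddir v G x) / 2))"
    unfolding volume_density_def ginv_def by (rule ext)
  ultimately show ?thesis by metis
qed

text \<open>The logarithmic derivative of the volume density is the only trace of the determinant in the
  divergence, so no determinant of a block matrix ever has to be computed.\<close>

lemma codiff_eq:
  fixes G :: "real^'k::finite \<Rightarrow> real^'k^'k"
  assumes G: "G differentiable (at x)" "det (G x) \<noteq> 0"
    and V: "\<And>i. (\<lambda>y. (ginv G y *v \<omega> y) $ i) differentiable (at x)"
  shows "codiff G \<omega> x = - (\<Sum>i\<in>UNIV. pd i (\<lambda>y. (ginv G y *v \<omega> y) $ i) x
      + trace (ginv G x ** ddir (axis i 1) G x) / 2 * (ginv G x *v \<omega> x) $ i)"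
proof -
  have nz: "volume_density G x \<noteq> 0" using G(2) by (simp add: volume_density_def)
  have "pd i (\<lambda>y. volume_density G y * (ginv G y *v \<omega> y) $ i) x
     = volume_density G x * (pd i (\<lambda>y. (ginv G y *v \<omega> y) $ i) x
      + trace (ginv G x ** ddir (axis i 1) G x) / 2 * (ginv G x *v \<omega> x) $ i)" for i
  proof -
    note v = has_derivative_volume_density[OF G]
    have "volume_density G differentiable (at x)" using v by (rule differentiableI)
    then show ?thesis using V[of i] ddir_unique[OF v, of "axis i 1"]
      by (simp add: pd_eq_ddir ddir_mult algebra_simps)
  qed
  then show ?thesis
    unfolding codiff_def using nz by (simp flip: sum_distrib_left)
qed

section \<open>The third elementary symmetric function\<close>

text \<open>Subsets of \<open>insert a S\<close> are sorted by whether they contain \<open>a\<close>.\<close>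

lemma elementary_symmetric_insert:
  fixes lam :: "'k::finite \<Rightarrow> real"
  assumes "finite S" "a \<notin> S"
  shows "(\<Sum>K\<in>{K. K \<subseteq> insert a S \<and> card K = Suc r}. \<Prod>k\<in>K. lam k)
    = (\<Sum>K\<in>{K. K \<subseteq> S \<and> card K = Suc r}. \<Prod>k\<in>K. lam k)
      + lam a * (\<Sum>K\<in>{K. K \<subseteq> S \<and> card K = r}. \<Prod>k\<in>K. lam k)"
proof -
  let ?B = "{K. K \<subseteq> S \<and> card K = r}"
  have "{K. K \<subseteq> insert a S \<and> card K = Suc r} = {K. K \<subseteq> S \<and> card K = Suc r} \<union> insert a ` ?B"
  proof (intro set_eqI iffI)
    fix K assume K: "K \<in> {K. K \<subseteq> insert a S \<and> card K = Suc r}"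
    show "K \<in> {K. K \<subseteq> S \<and> card K = Suc r} \<union> insert a ` ?B"
    proof (cases "a \<in> K")
      case True
      then have "K = insert a (K - {a})" "K - {a} \<in> ?B" using K by auto
      then show ?thesis by blast
    qed (use K in auto)
  next
    fix K assume K: "K \<in> {K. K \<subseteq> S \<and> card K = Suc r} \<union> insert a ` ?B"
    then consider "K \<subseteq> S \<and> card K = Suc r" | L where "L \<subseteq> S" "card L = r" "K = insert a L" by blast
    then show "K \<in> {K. K \<subseteq> insert a S \<and> card K = Suc r}"
    proof cases
      case 2
      then have "a \<notin> L" using assms(2) by blast
      then show ?thesis using 2 by auto
    qed auto
  qed
  moreover have "{K. K \<subseteq> S \<and> card K = Suc r} \<inter> insert a ` ?B = {}" using assms(2) by blast
  moreover have "inj_on (insert a) ?B"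
  proof (rule inj_onI)
    fix K L assume K: "K \<in> ?B" "L \<in> ?B" and eq: "insert a K = insert a L"
    have "a \<notin> K" "a \<notin> L" using K assms(2) by auto
    then show "K = L" using eq by (simp add: insert_ident)
  qed
  moreover have "(\<Prod>k\<in>insert a K. lam k) = lam a * (\<Prod>k\<in>K. lam k)" if "K \<in> ?B" for K
  proof -
    have "a \<notin> K" using that assms(2) by auto
    then show ?thesis by simp
  qed
  ultimately show ?thesis
    by (simp add: sum.union_disjoint sum.reindex sum_distrib_left)
qed

lemma newton_identities:
  fixes lam :: "'k::finite \<Rightarrow> real"
  defines "e \<equiv> \<lambda>S r. \<Sum>K\<in>{K. K \<subseteq> S \<and> card K = r}. \<Prod>k\<in>K. lam k"
    and "p \<equiv> \<lambda>S r. \<Sum>k\<in>S. lam k ^ r"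
  shows "e S 0 = 1 \<and> e S 1 = p S 1 \<and> e S 2 = ((p S 1)\<^sup>2 - p S 2) / 2
    \<and> e S 3 = ((p S 1) ^ 3 - 3 * p S 1 * p S 2 + 2 * p S 3) / 6"
proof (induction S rule: finite_induct[OF finite])
  case 1
  have "{K. K = {} \<and> card K = r} = (if r = 0 then {{}} else {})" for r :: nat by auto
  then show ?case by (simp add: e_def p_def)
next
  case (2 a S)
  have s: "e (insert a S) (Suc r) = e S (Suc r) + lam a * e S r" for r
    unfolding e_def by (rule elementary_symmetric_insert[OF 2(1,2)])
  have "{K. K \<subseteq> insert a S \<and> card K = 0} = {{}}" by auto
  then have "e (insert a S) 0 = 1" by (simp add: e_def)
  moreover have "p (insert a S) r = lam a ^ r + p S r" for r using 2 by (simp add: p_def)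
  moreover have IH: "e S 0 = 1" "e S 1 = p S 1" "e S 2 = ((p S 1)\<^sup>2 - p S 2) / 2"
    "e S 3 = ((p S 1) ^ 3 - 3 * p S 1 * p S 2 + 2 * p S 3) / 6" using 2(3) by auto
  have "e (insert a S) 1 = e S 1 + lam a * e S 0" "e (insert a S) 2 = e S 2 + lam a * e S 1"
    "e (insert a S) 3 = e S 3 + lam a * e S 2"
    using s[of 0] s[of 1] s[of 2] by (simp_all add: numeral_2_eq_2 numeral_3_eq_3)
  note this[unfolded IH]
  ultimately show ?case
    by (simp add: field_simps power2_eq_square power3_eq_cube)
qed

lemma trace_power_eigenvalues:
  fixes B :: "real^'k::finite^'k"
  assumes "eigenvalue_list B lam"
  shows "trace B = (\<Sum>k\<in>UNIV. lam k)" "trace (B ** B) = (\<Sum>k\<in>UNIV. lam k ^ 2)"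
    "trace (B ** B ** B) = (\<Sum>k\<in>UNIV. lam k ^ 3)" (is ?P1)
proof -
  obtain V :: "real^'k^'k" where V: "invertible V" "\<And>k. B *v column k V = lam k *\<^sub>R column k V"
    using assms unfolding eigenvalue_list_def by blast
  obtain W where W: "V ** W = mat 1" "W ** V = mat 1" using V(1) unfolding invertible_def by blast
  define D :: "real^'k^'k" where "D = (\<chi> i j. if i = j then lam i else 0)"
  have "(B ** V) $ i $ k = (V ** D) $ i $ k" for i k
  proof -
    have "(B ** V) $ i $ k = (B *v column k V) $ i"
      by (simp only: matrix_mul_nth matrix_vector_nth column_def vec_lambda_beta)
    also have "\<dots> = lam k * V $ i $ k" unfolding V(2) by (simp add: column_def)
    also have "\<dots> = (V ** D) $ i $ k"
      by (simp add: matrix_mul_nth D_def if_distrib mult.commute cong: if_cong)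
    finally show ?thesis .
  qed
  then have BV: "B ** V = V ** D" by (rule matrix_eqI)
  have B: "B = V ** D ** W" using BV W by (metis matrix_mul_assoc matrix_mul_rid)
  have c: "X ** W ** V = X" for X :: "real^'k^'k" by (simp add: W flip: matrix_mul_assoc)
  have t: "trace (V ** X ** W) = trace X" for X
    by (metis W(2) matrix_mul_assoc matrix_mul_lid trace_mul_sym)
  have "B ** B = V ** (D ** D) ** W" "B ** B ** B = V ** (D ** D ** D) ** W"
    by (simp_all add: B matrix_mul_assoc c)
  moreover have D: "D ** X = (\<chi> i j. lam i * X $ i $ j)" for X
    by (simp add: vec_eq_iff matrix_mul_nth D_def if_distrib[where f = "\<lambda>x. x * _"] sum.delta' cong: if_cong)
  then have "trace D = (\<Sum>k\<in>UNIV. lam k)" "trace (D ** D) = (\<Sum>k\<in>UNIV. lam k ^ 2)"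
    "trace (D ** (D ** D)) = (\<Sum>k\<in>UNIV. lam k ^ 3)"
    unfolding D by (simp_all add: trace_def D_def power2_eq_square power3_eq_cube mult.assoc)
  ultimately show "trace B = (\<Sum>k\<in>UNIV. lam k)" "trace (B ** B) = (\<Sum>k\<in>UNIV. lam k ^ 2)"
    ?P1
    using t B by (metis matrix_mul_assoc)+
qed

subsection \<open>Diagonalizability of self-adjoint endomorphisms\<close>

text \<open>A maximum point \<open>v\<close> of the Rayleigh quotient on the unit sphere of \<open>S\<close>, with value \<open>l\<close>, is an
  eigenvector: the form $l\, b(x, y) - b(x, B y)$ is positive semidefinite on \<open>S\<close> and vanishes at $(v, v)$, so
  \<open>v\<close> is in its kernel there; $l v - B v$, which lies in \<open>S\<close>, is then orthogonal to itself.\<close>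

lemma self_adjoint_eigenvector:
  fixes B K :: "real^'k::finite^'k" and S :: "(real^'k) set"
  assumes K: "positive_definite K"
    and self_adj: "\<And>u v. (B *v u) \<bullet> (K *v v) = u \<bullet> (K *v (B *v v))"
    and S: "subspace S" "\<And>u. u \<in> S \<Longrightarrow> B *v u \<in> S" and ne: "\<exists>u\<in>S. u \<noteq> 0"
  obtains v l where "v \<in> S" "v \<noteq> 0" "B *v v = l *\<^sub>R v"
proof -
  define b where "b u v = u \<bullet> (K *v v)" for u v
  have b_pos: "b v v > 0" if "v \<noteq> 0" for v using K that by (simp add: positive_definite_def b_def)
  have b_sym: "b u v = b v u" for u v
    using K unfolding positive_definite_def b_def by (metis dot_lmul_matrix inner_commute transpose_matrix_vector)
  have b_lin: "b (x + y) z = b x z + b y z" "b (r *\<^sub>R x) z = r * b x z"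
    "b z (x + y) = b z x + b z y" "b z (r *\<^sub>R x) = r * b z x" for x y z r
    by (simp_all add: b_def algebra_simps matrix_vector_right_distrib inner_add_right inner_add_left
        matrix_vector_mult_scaleR)
  have adj: "b (B *v x) y = b x (B *v y)" for x y using self_adj by (simp add: b_def)
  define q where "q v = b v (B *v v) / b v v" for v
  let ?C = "S \<inter> sphere 0 1"
  have cpt: "compact ?C" using closed_subspace[OF S(1)] by (rule closed_Int_compact) simp
  obtain u where u: "u \<in> S" "u \<noteq> 0" using ne by blast
  then have "(1 / norm u) *\<^sub>R u \<in> ?C" using S(1) by (auto simp: subspace_scale)
  then have "?C \<noteq> {}" by blast
  moreover have "continuous_on ?C q"
  proof -
    have c: "continuous_on ?C (\<lambda>v. A *v f v)" if "continuous_on ?C f" for A :: "real^'k^'k" and f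
      by (rule bounded_linear.continuous_on[OF matrix_vector_mul_bounded_linear that])
    have "b v v \<noteq> 0" if "v \<in> ?C" for v using that b_pos[of v] by force
    then show ?thesis unfolding q_def b_def
      by (intro continuous_on_divide continuous_on_inner c continuous_on_id) auto
  qed
  ultimately obtain v where v: "v \<in> ?C" "\<And>w. w \<in> ?C \<Longrightarrow> q w \<le> q v"
    using continuous_attains_sup[OF cpt] by blast
  have v0: "v \<noteq> 0" using v(1) by auto
  define l where "l = q v"
  define s where "s x y = l * b x y - b x (B *v y)" for x y
  have s_lin: "s (x + y) z = s x z + s y z" "s (r *\<^sub>R x) z = r * s x z"
    "s z (x + y) = s z x + s z y" "s z (r *\<^sub>R x) = r * s z x" for x y z r
    by (simp_all add: s_def b_lin algebra_simps matrix_vector_right_distrib matrix_vector_mult_scaleR)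
  have s_sym: "s x y = s y x" for x y unfolding s_def using b_sym adj by metis
  have s_vv: "s v v = 0" using b_pos[OF v0] by (simp add: s_def l_def q_def)
  have s_nn: "s w w \<ge> 0" if w: "w \<in> S" for w
  proof (cases "w = 0")
    case True then show ?thesis by (simp add: s_def b_def)
  next
    case False
    let ?w = "(1 / norm w) *\<^sub>R w"
    have "?w \<in> ?C" using w S(1) False by (auto simp: subspace_scale)
    then have "q ?w \<le> l" using v(2) by (simp add: l_def)
    then have "s ?w ?w \<ge> 0"
      using b_pos[of ?w] False by (simp add: s_def q_def divide_le_eq)
    then show ?thesis using False by (auto simp: s_lin zero_le_divide_iff mult_le_0_iff)
  qed
  have s_v: "s v y = 0" if y: "y \<in> S" for y
  proof -
    have *: "0 \<le> 2 * t * s v y + t * t * s y y" for t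
    proof -
      have "v + t *\<^sub>R y \<in> S" using v(1) y S(1) by (simp add: subspace_add subspace_scale)
      from s_nn[OF this] show ?thesis by (simp add: s_lin s_vv s_sym[of y v] algebra_simps)
    qed
    have syy: "s y y \<ge> 0" using s_nn[OF y] .
    \<comment> \<open>The minimum would be at $- s(v,y) / s(y,y)$; adding 1 keeps the denominator positive.\<close>
    define t where "t = - s v y / (s y y + 1)"
    have "2 * t * s v y + t * t * s y y = - (s v y)\<^sup>2 * (s y y + 2) / (s y y + 1)\<^sup>2"
      using syy unfolding t_def by (simp add: field_simps power2_eq_square add_nonneg_eq_0_iff)
    with *[of t] have "(s v y)\<^sup>2 * (s y y + 2) / (s y y + 1)\<^sup>2 \<le> 0" by simp
    then have "(s v y)\<^sup>2 \<le> 0" using syy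
      by (simp add: divide_le_0_iff mult_le_0_iff zero_less_mult_iff)
    then show ?thesis by simp
  qed
  define y where "y = l *\<^sub>R v + (- 1) *\<^sub>R (B *v v)"
  have "y \<in> S" unfolding y_def using v(1) S by (simp add: subspace_add subspace_scale subspace_diff)
  then have "s v y = 0" by (rule s_v)
  moreover have "b y z = l * b v z - b (B *v v) z" for z by (simp only: y_def b_lin)
  then have "s v y = b y y" by (simp add: s_def adj)
  ultimately have "y = 0" using b_pos[of y] by force
  then show thesis using that[of v l] v(1) v0 by (simp add: y_def)
qed

lemma self_adjoint_eigenvalue_list:
  fixes B K :: "real^'k::finite^'k"
  assumes K: "positive_definite K"
    and self_adj: "\<And>u v. (B *v u) \<bullet> (K *v v) = u \<bullet> (K *v (B *v v))"
  shows "\<exists>lam. eigenvalue_list B lam"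
proof -
  let ?E = "{v. \<exists>l. B *v v = l *\<^sub>R v}"
  have K_sym: "u \<bullet> (K *v v) = v \<bullet> (K *v u)" for u v
    using K unfolding positive_definite_def by (metis dot_lmul_matrix inner_commute transpose_matrix_vector)
  have detK: "det K \<noteq> 0" by (rule positive_definite_det[OF K])
  \<comment> \<open>Otherwise the orthogonal complement of all eigenvectors would contain another eigenvector.\<close>
  have span: "span ?E = UNIV"
  proof (rule ccontr)
    assume "span ?E \<noteq> UNIV"
    then obtain a where a: "a \<noteq> 0" "\<forall>x\<in>span ?E. a \<bullet> x = 0"
      using span_not_UNIV_orthogonal by blast
    let ?S = "{u. \<forall>e\<in>?E. e \<bullet> (K *v u) = 0}"
    obtain v l where v: "v \<in> ?S" "v \<noteq> 0" "B *v v = l *\<^sub>R v"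
    proof (rule self_adjoint_eigenvector[OF K self_adj, of ?S])
      show "subspace ?S"
        by (auto simp: subspace_def matrix_vector_right_distrib inner_add_right matrix_vector_mult_scaleR)
      show "B *v u \<in> ?S" if "u \<in> ?S" for u
      proof clarify
        fix e l assume e: "B *v e = l *\<^sub>R e"
        have "e \<bullet> (K *v (B *v u)) = l * (e \<bullet> (K *v u))"
          by (simp add: e flip: self_adj)
        then show "e \<bullet> (K *v (B *v u)) = 0" using that e by auto
      qed
      let ?u = "matrix_inv K *v a"
      have Ku: "K *v ?u = a" by (simp add: matrix_vector_mul_assoc matrix_inv_works[OF detK])
      show "\<exists>u\<in>?S. u \<noteq> 0"
      proof (rule bexI[of _ ?u])
        show "?u \<noteq> 0" using Ku a(1) by force
        show "?u \<in> ?S"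
        proof (rule CollectI, rule ballI, unfold Ku)
          fix e assume "e \<in> ?E"
          then have "e \<in> span ?E" by (rule span_base)
          then have "a \<bullet> e = 0" by (rule bspec[OF a(2)])
          then show "e \<bullet> a = 0" by (simp only: inner_commute)
        qed
      qed
    qed auto
    then have "v \<bullet> (K *v v) = 0" by auto
    then show False using K v(2) by (auto simp: positive_definite_def)
  qed
  obtain T where T: "T \<subseteq> ?E" "independent T" "?E \<subseteq> span T"
    by (rule maximal_independent_subset)
  then have spanT: "span T = UNIV" using span_minimal[OF T(3) subspace_span] span by auto
  have finT: "finite T" using T(2) by (rule independent_imp_finite)
  have "card T = CARD('k)"
    using dim_eq_card_independent[OF T(2)] dim_span[of T] spanT by (simp add: dim_UNIV)
  then obtain f where f: "bij_betw f (UNIV :: 'k set) T"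
    using finT finite_same_card_bij[OF finite finT] by metis
  define V :: "real^'k^'k" where "V = (\<chi> i j. f j $ i)"
  have col: "column k V = f k" for k by (simp add: V_def column_def vec_eq_iff)
  have "columns V = T" using f by (auto simp: columns_def col bij_betw_def)
  then have "invertible V"
    using spanT matrix_right_invertible_span_columns[of V] by (simp add: invertible_right_inverse span_vec_eq)
  moreover have "\<forall>k. \<exists>l. B *v column k V = l *\<^sub>R column k V"
    using f T(1) by (auto simp: col bij_betw_def)
  ultimately show ?thesis unfolding eigenvalue_list_def by metis
qed

lemma tr_wedge3_eq:
  fixes B K :: "real^'k::finite^'k"
  assumes "positive_definite K" "\<And>u v. (B *v u) \<bullet> (K *v v) = u \<bullet> (K *v (B *v v))"
  shows "tr_wedge3 B = ((trace B) ^ 3 - 3 * trace B * trace (B ** B) + 2 * trace (B ** B ** B)) / 6"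
proof -
  define lam where "lam = (SOME lam. eigenvalue_list B lam)"
  have "eigenvalue_list B lam"
    unfolding lam_def by (rule someI_ex[OF self_adjoint_eigenvalue_list[OF assms]])
  from trace_power_eigenvalues[OF this] show ?thesis
    using newton_identities[of lam UNIV]
    unfolding tr_wedge3_def elementary_symmetric_def lam_def[symmetric] by simp
qed

section \<open>Geometry of a one-parameter family of metrics\<close>

abbreviation dx :: "'n::finite \<Rightarrow> ((real^'n) \<times> real \<Rightarrow> 'b::real_normed_vector) \<Rightarrow> (real^'n) \<times> real \<Rightarrow> 'b" where
  "dx i \<equiv> ddir (axis i 1, 0)"

abbreviation ds :: "((real^'n::finite) \<times> real \<Rightarrow> 'b::real_normed_vector) \<Rightarrow> (real^'n) \<times> real \<Rightarrow> 'b" where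
  "ds \<equiv> ddir (0, 1)"

text \<open>A family of metrics is a function \<open>H\<close> of the coordinates and the parameter on an open set. Working
  there rather than with one metric at a time makes the parameter derivative a directional derivative
  like the coordinate ones, so that it commutes with them.\<close>

locale family_of_metrics =
  fixes \<Omega> :: "((real^'n::finite) \<times> real) set" and H :: "(real^'n) \<times> real \<Rightarrow> real^'n^'n"
  assumes open_\<Omega>: "open \<Omega>" and smooth_H: "smooth_on \<Omega> H"
    and positive_definite_H: "z \<in> \<Omega> \<Longrightarrow> positive_definite (H z)"
begin

abbreviation sm :: "((real^'n) \<times> real \<Rightarrow> 'b::real_normed_vector) \<Rightarrow> bool" where
  "sm \<equiv> smooth_on \<Omega>"

lemma sm_diff: "sm F \<Longrightarrow> z \<in> \<Omega> \<Longrightarrow> F differentiable (at z)"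
  by (rule smooth_on_differentiable[OF open_\<Omega>])

lemmas sm_intros =
  smooth_on_const[OF open_\<Omega>] smooth_on_add[OF open_\<Omega>] smooth_on_diff[OF open_\<Omega>]
  smooth_on_minus[OF open_\<Omega>] smooth_on_mult[OF open_\<Omega>] smooth_on_matrix_mul[OF open_\<Omega>]
  smooth_on_sum[OF open_\<Omega>] smooth_on_ddir[OF open_\<Omega>] smooth_on_entry[OF open_\<Omega>]
  smooth_on_trace[OF open_\<Omega>] smooth_on_bilinear[OF bounded_bilinear_scaleR open_\<Omega>]
  smooth_component[OF open_\<Omega> _ bounded_linear_transpose] smooth_H

lemma sm_matrixI: "(\<And>i j. sm (\<lambda>z. F z $ i $ j)) \<Longrightarrow> sm (F :: _ \<Rightarrow> real^'p::finite^'q::finite)"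
  by (rule smooth_on_matrixI[OF open_\<Omega>])

lemma D_add: "sm F \<Longrightarrow> sm G \<Longrightarrow> z \<in> \<Omega> \<Longrightarrow> ddir v (\<lambda>z. F z + G z) z = ddir v F z + ddir v G z"
  by (simp add: ddir_add sm_diff)

lemma D_diff: "sm F \<Longrightarrow> sm G \<Longrightarrow> z \<in> \<Omega> \<Longrightarrow> ddir v (\<lambda>z. F z - G z) z = ddir v F z - ddir v G z"
  by (simp add: ddir_diff sm_diff)

lemma D_minus: "sm F \<Longrightarrow> z \<in> \<Omega> \<Longrightarrow> ddir v (\<lambda>z. - F z) z = - ddir v F z"
  by (simp add: ddir_minus sm_diff)

lemma D_mult:
  fixes F G :: "(real^'n) \<times> real \<Rightarrow> real"
  shows "sm F \<Longrightarrow> sm G \<Longrightarrow> z \<in> \<Omega> \<Longrightarrow> ddir v (\<lambda>z. F z * G z) z = F z * ddir v G z + ddir v F z * G z"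
  by (simp add: ddir_mult sm_diff)

lemma D_matrix_mul:
  "sm F \<Longrightarrow> sm G \<Longrightarrow> z \<in> \<Omega> \<Longrightarrow> ddir v (\<lambda>z. F z ** G z) z = F z ** ddir v G z + ddir v F z ** G z"
  for F :: "(real^'n) \<times> real \<Rightarrow> real^'n^'n"
  by (simp add: ddir_matrix_mul sm_diff)

lemma D_scaleR_const:
  "sm F \<Longrightarrow> z \<in> \<Omega> \<Longrightarrow> ddir v (\<lambda>z. c *\<^sub>R F z) z = c *\<^sub>R ddir v F z"
  by (rule ddir_bounded_linear[OF bounded_linear_scaleR_right]) (rule sm_diff)

lemma D_entry: "sm F \<Longrightarrow> z \<in> \<Omega> \<Longrightarrow> ddir v (\<lambda>z. F z $ i $ j) z = ddir v F z $ i $ j"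
  for F :: "(real^'n) \<times> real \<Rightarrow> real^'p::finite^'q::finite"
  by (rule ddir_entry) (rule sm_diff)

lemma D_trace: "sm F \<Longrightarrow> z \<in> \<Omega> \<Longrightarrow> ddir v (\<lambda>z. trace (F z)) z = trace (ddir v F z)"
  for F :: "(real^'n) \<times> real \<Rightarrow> real^'n^'n"
  by (rule ddir_trace) (rule sm_diff)

lemma D_transpose: "sm F \<Longrightarrow> z \<in> \<Omega> \<Longrightarrow> ddir v (\<lambda>z. transpose (F z)) z = transpose (ddir v F z)"
  for F :: "(real^'n) \<times> real \<Rightarrow> real^'n^'n"
  by (rule ddir_transpose) (rule sm_diff)

lemma D_sum: "(\<And>i. i \<in> I \<Longrightarrow> sm (F i)) \<Longrightarrow> z \<in> \<Omega> \<Longrightarrow>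
    ddir v (\<lambda>z. \<Sum>i\<in>I. F i z) z = (\<Sum>i\<in>I. ddir v (F i) z)"
  by (rule ddir_sum) (rule sm_diff)

lemma D_commute: "sm F \<Longrightarrow> z \<in> \<Omega> \<Longrightarrow> ddir v (ddir w F) z = ddir w (ddir v F) z"
  for F :: "(real^'n) \<times> real \<Rightarrow> 'b::euclidean_space"
  by (rule ddir_commute[OF open_\<Omega>])

lemma D_cong: "(\<And>z. z \<in> \<Omega> \<Longrightarrow> F z = G z) \<Longrightarrow> z \<in> \<Omega> \<Longrightarrow> ddir v F z = ddir v G z"
  by (rule ddir_cong[OF open_\<Omega>])

lemma D_symmetric:
  fixes F :: "(real^'n) \<times> real \<Rightarrow> real^'n^'n"
  assumes "sm F" "\<And>z. z \<in> \<Omega> \<Longrightarrow> transpose (F z) = F z" "z \<in> \<Omega>"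
  shows "transpose (ddir v F z) = ddir v F z"
  using D_transpose[OF assms(1,3)] D_cong[of "\<lambda>z. transpose (F z)" F] assms(2,3) by metis

subsection \<open>Restriction to a fixed parameter\<close>

text \<open>Geometric quantities of a single metric \<open>G\<close> are compared with functions on \<open>\<Omega>\<close> along a slice
  \<open>s = const\<close>; agreement on the slice determines the coordinate derivatives.\<close>

lemma ddir_slice:
  fixes f :: "real^'n \<Rightarrow> 'b::real_normed_vector"
  assumes F: "sm F" and z: "(y, s) \<in> \<Omega>" and eq: "\<And>y. (y, s) \<in> \<Omega> \<Longrightarrow> f y = F (y, s)"
  shows "ddir (axis i 1) f y = dx i F (y, s)" "f differentiable (at y)"
proof -
  let ?S = "(\<lambda>y. (y, s)) -` \<Omega>"
  have S: "open ?S" by (rule open_vimage[OF open_\<Omega>]) (intro continuous_intros)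
  have y: "y \<in> ?S" using z by simp
  have c: "((\<lambda>y. (y, s)) has_derivative (\<lambda>v. (v, 0))) (at y)"
    by (auto intro!: derivative_eq_intros)
  have "ddir (axis i 1) f y = ddir (axis i 1) (\<lambda>y. F (y, s)) y"
    by (rule ddir_cong[OF S y]) (use eq in auto)
  also have "\<dots> = dx i F (y, s)"
    by (rule ddir_chain[OF c sm_diff[OF F z]])
  finally show "ddir (axis i 1) f y = dx i F (y, s)" .
  have "(\<lambda>y. F (y, s)) differentiable (at y)"
    by (rule differentiableI[OF has_derivative_compose[OF c has_derivative_ddir[OF sm_diff[OF F z]]]])
  then show "f differentiable (at y)" using ddir_cong(2)[OF S y, of f "\<lambda>y. F (y, s)"] eq by simp
qed

lemma pd_slice:
  fixes f :: "real^'n \<Rightarrow> real"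
  assumes "sm F" "(y, s) \<in> \<Omega>" "\<And>y. (y, s) \<in> \<Omega> \<Longrightarrow> f y = F (y, s)"
  shows "pd i f y = dx i F (y, s)"
  unfolding pd_eq_ddir by (rule ddir_slice(1)[OF assms])

subsection \<open>The inverse metric and the Christoffel symbols\<close>

definition K :: "(real^'n) \<times> real \<Rightarrow> real^'n^'n" where "K z = matrix_inv (H z)"

lemma det_H: "z \<in> \<Omega> \<Longrightarrow> det (H z) \<noteq> 0"
  using positive_definite_H positive_definite_det by blast

lemma H_sym [simp]: "z \<in> \<Omega> \<Longrightarrow> transpose (H z) = H z"
  using positive_definite_H by (simp add: positive_definite_def)

lemma K_sym [simp]: "z \<in> \<Omega> \<Longrightarrow> transpose (K z) = K z"
  by (simp add: K_def transpose_matrix_inv det_H)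

lemma HK [simp]: "z \<in> \<Omega> \<Longrightarrow> H z ** K z = mat 1" "z \<in> \<Omega> \<Longrightarrow> K z ** H z = mat 1"
  by (simp_all add: K_def matrix_inv_works det_H)

lemma HK_mul [simp]: "z \<in> \<Omega> \<Longrightarrow> X ** H z ** K z = X" "z \<in> \<Omega> \<Longrightarrow> X ** K z ** H z = X"
  by (simp_all flip: matrix_mul_assoc)

lemma sm_K: "sm K"
  unfolding K_def[abs_def] by (rule smooth_on_matrix_inv[OF open_\<Omega> smooth_H det_H])

lemma D_H_sym [simp]: "z \<in> \<Omega> \<Longrightarrow> transpose (ddir v H z) = ddir v H z"
  by (rule D_symmetric[OF smooth_H]) simp_all

lemma D_K: "z \<in> \<Omega> \<Longrightarrow> ddir v K z = - (K z ** ddir v H z ** K z)"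
  unfolding K_def[abs_def] by (rule ddir_matrix_inv[OF open_\<Omega> _ smooth_H det_H])

text \<open>Twice the Christoffel symbols with the upper index lowered.\<close>

definition Low :: "'n \<Rightarrow> (real^'n) \<times> real \<Rightarrow> real^'n^'n" where
  "Low k z = (\<chi> l j. dx k H z $ l $ j + dx j H z $ l $ k - dx l H z $ k $ j)"

text \<open>\<open>Gam k\<close> is the matrix of the endomorphism $\Gamma^i_{kj}$ of the connection form.\<close>

definition Gam :: "'n \<Rightarrow> (real^'n) \<times> real \<Rightarrow> real^'n^'n" where
  "Gam k z = (1/2) *\<^sub>R (K z ** Low k z)"

lemma sm_Low: "sm (Low k)"
  by (rule sm_matrixI) (simp add: Low_def sm_intros)

lemma sm_Gam: "sm (Gam k)"
  unfolding Gam_def[abs_def] by (intro sm_intros sm_K sm_Low)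

lemmas sm_rules = sm_intros sm_K sm_Gam

lemma Low_swap: "z \<in> \<Omega> \<Longrightarrow> Low k z $ l $ j = Low j z $ l $ k"
  by (simp add: Low_def symmetric_nth[of "dx l H z" k j])

lemma Gam_swap: "z \<in> \<Omega> \<Longrightarrow> Gam k z $ i $ j = Gam j z $ i $ k"
  by (simp add: Gam_def matrix_mul_nth Low_swap[of z k])

lemma H_Gam: "z \<in> \<Omega> \<Longrightarrow> H z ** Gam k z = (1/2) *\<^sub>R Low k z"
  by (simp add: Gam_def matrix_mul_simps matrix_mul_assoc)

text \<open>The metric is parallel; in matrix form this is the symmetrized definition of the Christoffel symbols.\<close>

lemma metric_compatible: "z \<in> \<Omega> \<Longrightarrow> dx k H z = transpose (Gam k z) ** H z + H z ** Gam k z"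
proof -
  assume z: "z \<in> \<Omega>"
  have "transpose (Gam k z) ** H z = transpose (H z ** Gam k z)"
    using z by (simp add: transpose_simps)
  then have "transpose (Gam k z) ** H z + H z ** Gam k z
    = (1/2) *\<^sub>R (transpose (Low k z) + Low k z)"
    by (simp add: H_Gam[OF z] transpose_simps scaleR_add_right)
  also have "\<dots> = dx k H z"
    by (rule matrix_eqI) (use z in \<open>simp add: Low_def symmetric_nth[of "dx _ H z"]\<close>)
  finally show ?thesis ..
qed

lemma dx_K: "z \<in> \<Omega> \<Longrightarrow> dx k K z = - (Gam k z ** K z) - K z ** transpose (Gam k z)"
  by (simp add: D_K metric_compatible matrix_mul_simps matrix_mul_assoc)

lemma trace_Gam: "z \<in> \<Omega> \<Longrightarrow> trace (Gam k z) = trace (K z ** dx k H z) / 2"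
proof -
  assume z: "z \<in> \<Omega>"
  have "trace (K z ** transpose (Gam k z) ** H z) = trace (H z ** K z ** transpose (Gam k z))"
    using trace_mul_sym[of "K z ** transpose (Gam k z)" "H z"] by (simp add: matrix_mul_assoc)
  then show ?thesis
    using z by (simp add: metric_compatible matrix_mul_simps matrix_mul_assoc trace_simps)
qed

lemma christoffel_eq:
  assumes z: "(y, s) \<in> \<Omega>" and G: "\<And>y. (y, s) \<in> \<Omega> \<Longrightarrow> G y = H (y, s)"
  shows "christoffel G i j k y = Gam j (y, s) $ i $ k" (is ?P1) "ginv G y = K (y, s)"
proof -
  show K: "ginv G y = K (y, s)" by (simp add: ginv_def K_def G[OF z])
  have "pd a (\<lambda>y. G y $ b $ c) y = dx a H (y, s) $ b $ c" for a b c
    using pd_slice[OF _ z, of "\<lambda>z. H z $ b $ c"] by (simp add: sm_rules G D_entry[OF smooth_H z])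
  then show ?P1
    by (simp add: christoffel_def K Gam_def matrix_mul_nth Low_def)
qed

subsection \<open>Covariant derivatives and curvature\<close>

definition nab :: "'n \<Rightarrow> ((real^'n) \<times> real \<Rightarrow> real^'n^'n) \<Rightarrow> (real^'n) \<times> real \<Rightarrow> real^'n^'n" where
  "nab k S z = dx k S z - transpose (Gam k z) ** S z - S z ** Gam k z"

text \<open>\<open>nab2 k l S\<close> is $\nabla_l \nabla_k S$.\<close>

definition nab2 :: "'n \<Rightarrow> 'n \<Rightarrow> ((real^'n) \<times> real \<Rightarrow> real^'n^'n) \<Rightarrow> (real^'n) \<times> real \<Rightarrow> real^'n^'n" where
  "nab2 k l S z = dx l (nab k S) z - transpose (Gam l z) ** nab k S z - nab k S z ** Gam l z
     - (\<Sum>m\<in>UNIV. Gam l z $ m $ k *\<^sub>R nab m S z)"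

text \<open>\<open>Riem k l z $ i $ j\<close> is $R^i{}_{jkl}$: the curvature form is the matrix of an endomorphism, so that
  contractions become matrix products.\<close>

definition Riem :: "'n \<Rightarrow> 'n \<Rightarrow> (real^'n) \<times> real \<Rightarrow> real^'n^'n" where
  "Riem k l z = dx l (Gam k) z - dx k (Gam l) z + Gam l z ** Gam k z - Gam k z ** Gam l z"

definition Ric :: "(real^'n) \<times> real \<Rightarrow> real^'n^'n" where
  "Ric z = (\<chi> j k. \<Sum>i\<in>UNIV. Riem k i z $ i $ j)"

lemma sm_nab: "sm S \<Longrightarrow> sm (nab k S)"
  unfolding nab_def[abs_def] by (intro sm_rules)

lemma sm_Riem: "sm (Riem k l)"
  unfolding Riem_def[abs_def] by (intro sm_rules)

lemma sm_Ric: "sm Ric"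
  by (rule sm_matrixI) (simp add: Ric_def, intro sm_rules sm_Riem)

lemma nab_symmetric:
  assumes "sm S" "\<And>z. z \<in> \<Omega> \<Longrightarrow> transpose (S z) = S z" "z \<in> \<Omega>"
  shows "transpose (nab k S z) = nab k S z"
  using D_symmetric[OF assms] assms(2,3) by (simp add: nab_def transpose_simps)

lemma transpose_sum: "transpose (\<Sum>i\<in>I. F i) = (\<Sum>i\<in>I. transpose (F i :: real^'n^'n))"
  by (induction I rule: infinite_finite_induct) (simp_all add: transpose_simps)

lemma nab2_symmetric:
  assumes "sm S" "\<And>z. z \<in> \<Omega> \<Longrightarrow> transpose (S z) = S z" "z \<in> \<Omega>"
  shows "transpose (nab2 k l S z) = nab2 k l S z"
  using D_symmetric[OF sm_nab[OF assms(1)] nab_symmetric[OF assms(1,2)] assms(3)]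
    nab_symmetric[OF assms]
  by (simp add: nab2_def transpose_simps transpose_sum)

lemma nabla_eq:
  assumes z: "(y, s) \<in> \<Omega>" and G: "\<And>y. (y, s) \<in> \<Omega> \<Longrightarrow> G y = H (y, s)"
    and S: "sm S" and T: "\<And>y. (y, s) \<in> \<Omega> \<Longrightarrow> T y = S (y, s)"
  shows "nabla G T i j k y = nab k S (y, s) $ i $ j"
proof -
  have "pd k (\<lambda>y. T y $ i $ j) y = dx k S (y, s) $ i $ j"
    using pd_slice[OF _ z, of "\<lambda>z. S z $ i $ j"] by (simp add: sm_rules S T D_entry[OF S z])
  then show ?thesis
    by (simp add: nabla_def nab_def matrix_mul_nth christoffel_eq[OF z G] T[OF z] sum.distrib mult.commute)
qed

lemma nabla2_eq:
  assumes z: "(y, s) \<in> \<Omega>" and G: "\<And>y. (y, s) \<in> \<Omega> \<Longrightarrow> G y = H (y, s)"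
    and S: "sm S" and T: "\<And>y. (y, s) \<in> \<Omega> \<Longrightarrow> T y = S (y, s)"
  shows "nabla2 G T i j k l y = nab2 k l S (y, s) $ i $ j"
proof -
  have n: "nabla G T i j k y = nab k S (y, s) $ i $ j" if "(y, s) \<in> \<Omega>" for y i j k
    by (rule nabla_eq[OF that G S T])
  have "pd l (nabla G T i j k) y = dx l (nab k S) (y, s) $ i $ j"
    using pd_slice[OF _ z, of "\<lambda>z. nab k S z $ i $ j" "nabla G T i j k" l]
    by (simp add: sm_rules sm_nab S n D_entry[OF sm_nab[OF S] z])
  then show ?thesis
    by (simp add: nabla2_def nab2_def matrix_mul_nth christoffel_eq[OF z G] n[OF z] sum.distrib mult.commute)
qed

lemma curvature_up_eq:
  assumes z: "(y, s) \<in> \<Omega>" and G: "\<And>y. (y, s) \<in> \<Omega> \<Longrightarrow> G y = H (y, s)"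
  shows "curvature_up G i j k l y = Riem k l (y, s) $ i $ j"
proof -
  have c: "christoffel G i j k y = Gam k (y, s) $ i $ j" if "(y, s) \<in> \<Omega>" for y i j k
    using christoffel_eq(1)[OF that G] Gam_swap[OF that] by metis
  have c': "christoffel G i k j y = Gam k (y, s) $ i $ j" if "(y, s) \<in> \<Omega>" for y i j k
    using christoffel_eq(1)[OF that G] .
  have "pd l (christoffel G i j k) y = dx l (Gam k) (y, s) $ i $ j" for k l
    using pd_slice[OF _ z, of "\<lambda>z. Gam k z $ i $ j" "christoffel G i j k" l]
    by (simp add: sm_rules c D_entry[OF sm_Gam z])
  then show ?thesis
    by (simp add: curvature_up_def Riem_def matrix_mul_nth c'[OF z] Gam_swap[OF z, of j] sum_subtractf)
qed

lemma ricci_eq: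
  assumes z: "(y, s) \<in> \<Omega>" and G: "\<And>y. (y, s) \<in> \<Omega> \<Longrightarrow> G y = H (y, s)"
  shows "ricci G y = Ric (y, s)"
  by (simp add: ricci_def Ric_def curvature_up_eq[OF z G])

lemma curvature_eq:
  assumes z: "(y, s) \<in> \<Omega>" and G: "\<And>y. (y, s) \<in> \<Omega> \<Longrightarrow> G y = H (y, s)"
  shows "curvature G i j k l y = (H (y, s) ** Riem k l (y, s)) $ i $ j"
  by (simp add: curvature_def curvature_up_eq[OF z G] G[OF z] matrix_mul_nth)

lemma Riem_antisym: "Riem k l z = - Riem l k z"
  by (simp add: Riem_def)

lemma Riem_Bianchi:
  assumes z: "z \<in> \<Omega>"
  shows "Riem k l z $ i $ j + Riem l j z $ i $ k + Riem j k z $ i $ l = 0"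
proof -
  have d: "dx a (Gam b) z $ i $ c = dx a (Gam c) z $ i $ b" for a b c
  proof -
    have "dx a (\<lambda>z. Gam b z $ i $ c) z = dx a (\<lambda>z. Gam c z $ i $ b) z"
      by (rule D_cong[OF Gam_swap z])
    then show ?thesis by (simp add: D_entry[OF sm_Gam z])
  qed
  have g: "(Gam a z ** Gam b z) $ i $ c = (Gam a z ** Gam c z) $ i $ b" for a b c
    by (simp add: matrix_mul_nth Gam_swap[OF z, of b])
  show ?thesis
    using d[of l k j] d[of k l j] d[of j l k] g[of l k j] g[of k l j] g[of j l k]
    by (simp add: Riem_def)
qed

lemma matrix_sum_right: "A ** (\<Sum>i\<in>I. F i :: real^'n^'n) = (\<Sum>i\<in>I. (A :: real^'n^'n) ** F i)"
  by (induction I rule: infinite_finite_induct) (simp_all add: matrix_mul_simps)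

lemma sum_nth: "(\<Sum>i\<in>I. F i) $ a $ b = (\<Sum>i\<in>I. F i $ a $ b :: real)"
  by (induction I rule: infinite_finite_induct) simp_all

text \<open>The Ricci identity: second covariant derivatives commute up to curvature. The Hessian
  terms cancel since the connection is torsion-free.\<close>

lemma Ricci_identity:
  assumes S: "sm S" and z: "z \<in> \<Omega>"
  shows "nab2 k l S z - nab2 l k S z = - (transpose (Riem k l z) ** S z + S z ** Riem k l z)"
proof -
  have d: "dx a (nab b S) z = dx a (dx b S) z - transpose (Gam b z) ** dx a S z
      - transpose (dx a (Gam b) z) ** S z - S z ** dx a (Gam b) z - dx a S z ** Gam b z" for a b
    unfolding nab_def[abs_def] using S z
    by (simp add: D_diff D_matrix_mul D_transpose sm_rules)
  have c: "dx l (dx k S) z = dx k (dx l S) z" by (rule D_commute[OF S z])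
  have h: "(\<Sum>m\<in>UNIV. Gam l z $ m $ k *\<^sub>R nab m S z) = (\<Sum>m\<in>UNIV. Gam k z $ m $ l *\<^sub>R nab m S z)"
    by (simp add: Gam_swap[OF z, of l])
  show ?thesis
    unfolding nab2_def h d c
    by (simp add: nab_def Riem_def matrix_mul_simps transpose_simps matrix_mul_assoc)
qed

lemma nab_H: "z \<in> \<Omega> \<Longrightarrow> nab k H z = 0"
  by (simp add: nab_def metric_compatible)

text \<open>The Ricci identity for the metric itself, which is parallel.\<close>

lemma Riem_skew:
  assumes z: "z \<in> \<Omega>"
  shows "transpose (Riem k l z) ** H z = - (H z ** Riem k l z)"
proof -
  have "nab2 a b H z = 0" for a b
    using D_cong[of "nab a H" "\<lambda>_. 0", OF nab_H z] by (simp add: nab2_def nab_H[OF z] matrix_mul_simps)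
  then show ?thesis using Ricci_identity[OF smooth_H z, of k l]
    by (metis diff_self eq_neg_iff_add_eq_0 neg_equal_0_iff_equal)
qed

text \<open>A linear combination of four instances of the first Bianchi identity and the two skew symmetries.\<close>

lemma curvature_pair_symmetry:
  assumes z: "z \<in> \<Omega>"
  shows "(H z ** Riem k l z) $ i $ j = (H z ** Riem i j z) $ k $ l"
proof -
  let ?R = "\<lambda>i j k l. (H z ** Riem k l z) $ i $ j"
  have a: "?R i j k l = - ?R i j l k" for i j k l
    by (subst Riem_antisym) (simp add: matrix_mul_simps)
  have b: "?R i j k l = - ?R j i k l" for i j k l
  proof -
    have "transpose (H z ** Riem k l z) = - (H z ** Riem k l z)"
      using Riem_skew[OF z, of k l] z by (simp add: transpose_simps)
    then have "transpose (H z ** Riem k l z) $ j $ i = (- (H z ** Riem k l z)) $ j $ i" by simp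
    then show ?thesis by simp
  qed
  have c: "?R i j k l + ?R i k l j + ?R i l j k = 0" for i j k l
    using Riem_Bianchi[OF z, of k l _ j]
    by (simp add: matrix_mul_nth flip: sum.distrib distrib_left)
  show ?thesis
    using c[of i j k l] c[of j k l i] c[of k l i j] c[of l i j k]
      a[of i j k l] a[of i k l j] a[of i l j k] a[of j k l i] a[of j l i k] a[of j i k l]
      a[of k l i j] a[of k i j l] a[of k j l i] a[of l i j k] a[of l j k i] a[of l k i j]
      b[of i j k l] b[of i k l j] b[of i l j k] b[of j k l i] b[of j l i k] b[of j i k l]
      b[of k l i j] b[of k i j l] b[of k j l i] b[of l i j k] b[of l j k i] b[of l k i j]
      b[of i k j l] b[of j l k i] b[of i l k j] b[of j k i l]
    by linarith
qed

end

context family_of_metrics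
begin

subsection \<open>The variation of the Ricci tensor\<close>

definition theta :: "(real^'n) \<times> real \<Rightarrow> real" where
  "theta z = trace (K z ** ds H z)"

text \<open>Twice the lowered variation of the Christoffel symbols.\<close>

definition Var :: "'n \<Rightarrow> (real^'n) \<times> real \<Rightarrow> real^'n^'n" where
  "Var k z = (\<chi> l j. nab k (ds H) z $ l $ j + nab j (ds H) z $ l $ k - nab l (ds H) z $ k $ j)"

definition nab_Var :: "'n \<Rightarrow> 'n \<Rightarrow> (real^'n) \<times> real \<Rightarrow> real^'n^'n" where
  "nab_Var i k z = dx i (Var k) z - transpose (Gam i z) ** Var k z - Var k z ** Gam i z
     - (\<Sum>m\<in>UNIV. Gam i z $ m $ k *\<^sub>R Var m z)"

definition hess :: "((real^'n) \<times> real \<Rightarrow> real) \<Rightarrow> 'n \<Rightarrow> 'n \<Rightarrow> (real^'n) \<times> real \<Rightarrow> real" where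
  "hess f j k z = dx j (dx k f) z - (\<Sum>m\<in>UNIV. Gam j z $ m $ k * dx m f z)"

lemma sm_ds_H: "sm (ds H)" by (intro sm_rules)

lemma sm_Var: "sm (Var k)"
  by (rule sm_matrixI) (simp add: Var_def sm_rules sm_nab)

lemma sm_theta: "sm theta"
  unfolding theta_def[abs_def] by (intro sm_rules)

lemma ds_Low:
  assumes z: "z \<in> \<Omega>"
  shows "ds (Low k) z $ l $ j = dx k (ds H) z $ l $ j + dx j (ds H) z $ l $ k - dx l (ds H) z $ k $ j"
proof -
  have "ds (Low k) z $ l $ j = ds (\<lambda>z. dx k H z $ l $ j + dx j H z $ l $ k - dx l H z $ k $ j) z"
    using D_entry[OF sm_Low z, of "(0, 1)" k l j] by (simp add: Low_def)
  also have "\<dots> = ds (dx k H) z $ l $ j + ds (dx j H) z $ l $ k - ds (dx l H) z $ k $ j"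
    using z by (simp add: D_diff D_add D_entry sm_rules)
  finally show ?thesis by (simp add: D_commute[OF smooth_H z, of "(0, 1)"])
qed

text \<open>The variation of a connection is a tensor. It is found by differentiating \<open>H ** Gam k = Low k / 2\<close>; the
  terms without derivatives of \<open>ds H\<close> complete the coordinate derivatives to covariant ones.\<close>

lemma ds_Gam:
  assumes z: "z \<in> \<Omega>"
  shows "ds (Gam k) z = (1/2) *\<^sub>R (K z ** Var k z)"
proof -
  have "ds (\<lambda>z. H z ** Gam k z) z = ds (\<lambda>z. (1/2) *\<^sub>R Low k z) z"
    by (rule D_cong[OF H_Gam z])
  then have 1: "H z ** ds (Gam k) z + ds H z ** Gam k z = (1/2) *\<^sub>R ds (Low k) z"
    using z by (simp add: D_matrix_mul sm_rules D_scaleR_const sm_Low)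
  have s: "ds H z $ a $ b = ds H z $ b $ a" for a b
    using D_H_sym[OF z] by (rule symmetric_nth)
  have "Var k z = ds (Low k) z - 2 *\<^sub>R (ds H z ** Gam k z)"
  proof (rule matrix_eqI)
    fix l j
    show "Var k z $ l $ j = (ds (Low k) z - 2 *\<^sub>R (ds H z ** Gam k z)) $ l $ j"
      using Gam_swap[OF z, of j _ k] Gam_swap[OF z, of l _ k] Gam_swap[OF z, of l _ j]
      by (simp add: Var_def ds_Low[OF z] nab_def matrix_mul_nth s[of k] mult.commute)
  qed
  then have "ds (Low k) z = Var k z + 2 *\<^sub>R (ds H z ** Gam k z)" by simp
  with 1 have "H z ** ds (Gam k) z = (1/2) *\<^sub>R Var k z" by (simp add: scaleR_add_right)
  then have "K z ** (H z ** ds (Gam k) z) = (1/2) *\<^sub>R (K z ** Var k z)"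
    by (simp add: matrix_mul_simps)
  then show ?thesis using z by (simp add: matrix_mul_assoc)
qed

text \<open>The trace of the connection is half the logarithmic derivative of the determinant, so its variation
  is half the derivative of \<open>theta\<close>.\<close>

lemma ds_trace_connection:
  assumes z: "z \<in> \<Omega>"
  shows "ds (\<lambda>z. trace (K z ** dx j H z)) z = dx j theta z"
proof -
  have "trace (K z ** ds H z ** K z ** dx j H z) = trace (K z ** dx j H z ** K z ** ds H z)"
    using trace_mul_sym[of "K z ** ds H z" "K z ** dx j H z"] by (simp add: matrix_mul_assoc)
  then show ?thesis
    unfolding theta_def[abs_def] using z
    by (simp add: D_trace D_matrix_mul sm_rules D_K trace_simps matrix_mul_simps D_commute[OF smooth_H z, of "(0,1)"])
qed

lemma trace_ds_Gam:
  assumes z: "z \<in> \<Omega>"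
  shows "(\<Sum>i\<in>UNIV. ds (Gam i) z $ i $ j) = dx j theta z / 2"
proof -
  have "ds (Gam i) z $ i $ j = ds (Gam j) z $ i $ i" for i
    using D_cong[of "\<lambda>z. Gam i z $ i $ j" "\<lambda>z. Gam j z $ i $ i", OF Gam_swap z] by (simp add: D_entry[OF sm_Gam z])
  then have "(\<Sum>i\<in>UNIV. ds (Gam i) z $ i $ j) = trace (ds (Gam j) z)"
    by (simp add: trace_def)
  also have "\<dots> = ds (\<lambda>z. trace (Gam j z)) z" by (rule D_trace[OF sm_Gam z, symmetric])
  also have "\<dots> = ds (\<lambda>z. (1/2) *\<^sub>R trace (K z ** dx j H z)) z"
    by (rule D_cong[OF _ z]) (simp add: trace_Gam)
  also have "\<dots> = (1/2) *\<^sub>R ds (\<lambda>z. trace (K z ** dx j H z)) z"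
    by (rule D_scaleR_const[OF _ z]) (intro sm_rules)
  finally show ?thesis by (simp add: ds_trace_connection[OF z])
qed

text \<open>The upper index of the variation of the connection is raised with \<open>K\<close>, which is parallel.\<close>

lemma divergence_ds_Gam:
  assumes z: "z \<in> \<Omega>"
  shows "dx i (ds (Gam k)) z + Gam i z ** ds (Gam k) z - ds (Gam k) z ** Gam i z
      - (\<Sum>m\<in>UNIV. Gam i z $ m $ k *\<^sub>R ds (Gam m) z) = (1/2) *\<^sub>R (K z ** nab_Var i k z)"
proof -
  have "dx i (ds (Gam k)) z = dx i (\<lambda>z. (1/2) *\<^sub>R (K z ** Var k z)) z"
    by (rule D_cong[OF ds_Gam z])
  also have "\<dots> = (1/2) *\<^sub>R (K z ** dx i (Var k) z - Gam i z ** K z ** Var k z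
      - K z ** transpose (Gam i z) ** Var k z)"
    using z by (simp add: D_scaleR_const D_matrix_mul sm_rules sm_Var dx_K matrix_mul_simps)
  finally show ?thesis
    by (simp add: ds_Gam[OF z] nab_Var_def matrix_mul_simps matrix_mul_assoc matrix_sum_right
        scaleR_diff_right scaleR_add_right scaleR_sum_right)
qed

lemma nab_Var_nth:
  assumes z: "z \<in> \<Omega>"
  shows "nab_Var i k z $ l $ j
    = nab2 k i (ds H) z $ l $ j + nab2 j i (ds H) z $ l $ k - nab2 l i (ds H) z $ k $ j"
proof -
  have "dx i (Var k) z $ l $ j
      = dx i (\<lambda>z. nab k (ds H) z $ l $ j + nab j (ds H) z $ l $ k - nab l (ds H) z $ k $ j) z"
    using D_entry[OF sm_Var z, of "(axis i 1, 0)" k l j] by (simp add: Var_def)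
  also have "\<dots> = dx i (nab k (ds H)) z $ l $ j + dx i (nab j (ds H)) z $ l $ k - dx i (nab l (ds H)) z $ k $ j"
    using z by (simp add: D_diff D_add D_entry sm_rules sm_nab)
  finally have d: "dx i (Var k) z $ l $ j
    = dx i (nab k (ds H)) z $ l $ j + dx i (nab j (ds H)) z $ l $ k - dx i (nab l (ds H)) z $ k $ j" .
  show ?thesis
    by (simp add: nab_Var_def nab2_def d matrix_mul_nth sum_nth Var_def sum.distrib sum_subtractf
        algebra_simps)
qed

text \<open>The Palatini identity: the variation of the Ricci tensor is the divergence of the variation of the
  connection minus the covariant derivative of its trace.\<close>

lemma ds_Ric:
  assumes z: "z \<in> \<Omega>"
  shows "ds Ric z $ j $ k = (\<Sum>i\<in>UNIV. \<Sum>l\<in>UNIV. K z $ i $ l *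
      (nab2 k i (ds H) z $ l $ j + nab2 j i (ds H) z $ l $ k - nab2 l i (ds H) z $ k $ j)) / 2
    - hess theta k j z / 2"
proof -
  have "ds Ric z $ j $ k = ds (\<lambda>z. \<Sum>i\<in>UNIV. Riem k i z $ i $ j) z"
    using D_entry[OF sm_Ric z, of "(0, 1)" j k] by (simp add: Ric_def)
  also have "\<dots> = (\<Sum>i\<in>UNIV. ds (Riem k i) z $ i $ j)"
    using z by (simp add: D_sum sm_rules sm_Riem D_entry[OF sm_Riem])
  also have "\<dots> = (\<Sum>i\<in>UNIV. (dx i (ds (Gam k)) z + Gam i z ** ds (Gam k) z - ds (Gam k) z ** Gam i z) $ i $ j)
      - (\<Sum>i\<in>UNIV. (Gam k z ** ds (Gam i) z) $ i $ j)
      + (\<Sum>i\<in>UNIV. (ds (Gam i) z ** Gam k z) $ i $ j)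
      - (\<Sum>i\<in>UNIV. dx k (ds (Gam i)) z $ i $ j)"
  proof -
    have "ds (Riem k i) z = dx i (ds (Gam k)) z - dx k (ds (Gam i)) z
       + (Gam i z ** ds (Gam k) z + ds (Gam i) z ** Gam k z)
       - (Gam k z ** ds (Gam i) z + ds (Gam k) z ** Gam i z)" for i
      unfolding Riem_def[abs_def] using z
      by (simp add: D_diff D_add D_matrix_mul sm_rules D_commute[OF sm_Gam z, of "(0, 1)"])
    then show ?thesis by (simp add: sum.distrib sum_subtractf)
  qed
  also have "(\<Sum>i\<in>UNIV. (Gam k z ** ds (Gam i) z) $ i $ j)
      = (\<Sum>i\<in>UNIV. (\<Sum>m\<in>UNIV. Gam i z $ m $ k *\<^sub>R ds (Gam m) z) $ i $ j)"
    unfolding matrix_mul_nth sum_nth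
    by (subst sum.swap) (simp add: Gam_swap[OF z, of k])
  also have "(\<Sum>i\<in>UNIV. (ds (Gam i) z ** Gam k z) $ i $ j) = (\<Sum>m\<in>UNIV. Gam k z $ m $ j * dx m theta z) / 2"
    unfolding matrix_mul_nth
    by (subst sum.swap) (simp only: sum_distrib_right[symmetric] trace_ds_Gam[OF z],
        simp add: sum_divide_distrib mult.commute)
  also have "(\<Sum>i\<in>UNIV. dx k (ds (Gam i)) z $ i $ j) = dx k (dx j theta) z / 2"
  proof -
    have "(\<Sum>i\<in>UNIV. dx k (ds (Gam i)) z $ i $ j) = dx k (\<lambda>z. \<Sum>i\<in>UNIV. ds (Gam i) z $ i $ j) z"
      using z by (simp add: D_sum sm_rules D_entry)
    also have "\<dots> = dx k (\<lambda>z. (1/2) *\<^sub>R dx j theta z) z"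
      by (rule D_cong[OF _ z]) (simp add: trace_ds_Gam)
    also have "\<dots> = (1/2) *\<^sub>R dx k (dx j theta) z"
      by (rule D_scaleR_const[OF _ z]) (intro sm_rules sm_theta)
    finally show ?thesis by simp
  qed
  finally have "ds Ric z $ j $ k = (\<Sum>i\<in>UNIV. (dx i (ds (Gam k)) z + Gam i z ** ds (Gam k) z
      - ds (Gam k) z ** Gam i z - (\<Sum>m\<in>UNIV. Gam i z $ m $ k *\<^sub>R ds (Gam m) z)) $ i $ j)
      - hess theta k j z / 2"
    by (simp add: sum.distrib sum_subtractf hess_def diff_divide_distrib)
  then show ?thesis
    by (simp add: divergence_ds_Gam[OF z] matrix_mul_nth nab_Var_nth[OF z] flip: sum_divide_distrib)
qed

subsection \<open>The Bach tensor\<close>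

lemma nab_scaleR: "sm S \<Longrightarrow> z \<in> \<Omega> \<Longrightarrow> nab k (\<lambda>z. c *\<^sub>R S z) z = c *\<^sub>R nab k S z"
  by (simp add: nab_def D_scaleR_const matrix_mul_simps scaleR_diff_right)

lemma nab2_scaleR:
  assumes "sm S" "z \<in> \<Omega>"
  shows "nab2 k l (\<lambda>z. c *\<^sub>R S z) z = c *\<^sub>R nab2 k l S z"
proof -
  have "dx l (nab k (\<lambda>z. c *\<^sub>R S z)) z = dx l (\<lambda>z. c *\<^sub>R nab k S z) z"
    by (rule D_cong[OF nab_scaleR[OF assms(1)] assms(2)])
  then show ?thesis
    using assms by (simp add: nab2_def D_scaleR_const sm_nab nab_scaleR matrix_mul_simps
        scaleR_diff_right scaleR_sum_right mult.commute)
qed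

text \<open>Since \<open>K\<close> is parallel, contraction commutes with covariant differentiation; the right-hand side
  is the covariant derivative of the divergence of \<open>S\<close>.\<close>

lemma nab_divergence:
  assumes S: "sm S" and z: "z \<in> \<Omega>"
  shows "(\<Sum>i\<in>UNIV. (K z ** nab2 i j S z) $ i $ k)
    = dx j (\<lambda>z. \<Sum>i\<in>UNIV. (K z ** nab i S z) $ i $ k) z
      - (\<Sum>m\<in>UNIV. Gam j z $ m $ k * (\<Sum>i\<in>UNIV. (K z ** nab i S z) $ i $ m))"
proof -
  have "dx j (\<lambda>z. \<Sum>i\<in>UNIV. (K z ** nab i S z) $ i $ k) z
      = (\<Sum>i\<in>UNIV. dx j (\<lambda>z. K z ** nab i S z) z $ i $ k)"
    using z by (simp add: D_sum D_entry sm_rules sm_nab S)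
  also have "\<dots> = (\<Sum>i\<in>UNIV. (K z ** dx j (nab i S) z - Gam j z ** K z ** nab i S z
      - K z ** transpose (Gam j z) ** nab i S z) $ i $ k)"
    using z by (simp add: D_matrix_mul sm_rules sm_nab S dx_K matrix_mul_simps algebra_simps)
  also have "\<dots> = (\<Sum>i\<in>UNIV. (K z ** nab2 i j S z) $ i $ k)
      + (\<Sum>i\<in>UNIV. (K z ** nab i S z ** Gam j z) $ i $ k)
      + (\<Sum>i\<in>UNIV. (\<Sum>m\<in>UNIV. Gam j z $ m $ i *\<^sub>R (K z ** nab m S z)) $ i $ k)
      - (\<Sum>i\<in>UNIV. (Gam j z ** (K z ** nab i S z)) $ i $ k)"
    by (simp add: nab2_def matrix_mul_simps matrix_mul_assoc matrix_sum_right sum.distrib sum_subtractf)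
  also have "(\<Sum>i\<in>UNIV. (\<Sum>m\<in>UNIV. Gam j z $ m $ i *\<^sub>R (K z ** nab m S z)) $ i $ k)
      = (\<Sum>i\<in>UNIV. (Gam j z ** (K z ** nab i S z)) $ i $ k)"
    unfolding matrix_mul_nth[of "Gam j z"] sum_nth by (subst sum.swap) simp
  also have "(\<Sum>i\<in>UNIV. (K z ** nab i S z ** Gam j z) $ i $ k)
      = (\<Sum>m\<in>UNIV. Gam j z $ m $ k * (\<Sum>i\<in>UNIV. (K z ** nab i S z) $ i $ m))"
    unfolding matrix_mul_nth[of _ "Gam j z"] by (subst sum.swap) (simp add: sum_distrib_left mult.commute)
  finally show ?thesis by simp
qed

lemma sum_sandwich: "(\<Sum>a\<in>UNIV. \<Sum>b\<in>UNIV. A $ a $ b * (X $ i $ b * Y $ a $ j)) = (X ** transpose A ** Y) $ i $ j"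
  for A X Y :: "real^'n^'n"
  by (simp add: matrix_mul_nth sum_distrib_left sum_distrib_right mult_ac)

text \<open>By pair symmetry the contraction of the curvature with a symmetric tensor is symmetric; it is written
  in the form in which the commutator of second covariant derivatives of \<open>P\<close> produces it, so that
  both cancel in the Bach tensor.\<close>

lemma weyl_contraction:
  assumes z: "(y, s) \<in> \<Omega>" and G: "\<And>y. (y, s) \<in> \<Omega> \<Longrightarrow> G y = H (y, s)"
    and P: "P = schouten G y" "transpose P = P"
  defines "z \<equiv> (y, s)"
  shows "(\<Sum>a\<in>UNIV. \<Sum>b\<in>UNIV. raise G (schouten G) y $ a $ b * weyl G a i j b y)
    = (\<Sum>a\<in>UNIV. (K z ** P ** Riem i a z) $ a $ j)
      + 2 * (P ** K z ** P) $ i $ j - trace (K z ** P ** K z ** P) * H z $ i $ j - trace (K z ** P) * P $ i $ j"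
proof -
  have z': "z \<in> \<Omega>" using z by (simp add: z_def)
  define A where "A = K z ** P ** K z"
  have A: "transpose A = A" using z' by (simp add: A_def transpose_simps P(2) matrix_mul_assoc)
  have raise: "raise G (schouten G) y = A"
    using christoffel_eq(2)[OF z G] z' by (simp add: raise_def A_def P(1) z_def)
  have R: "(H z ** Riem j b z) $ a $ i = (H z ** Riem i a z) $ b $ j" for a b
  proof -
    have "(H z ** Riem j b z) $ a $ i = (H z ** Riem a i z) $ j $ b"
      by (rule curvature_pair_symmetry[OF z'])
    also have "\<dots> = - (H z ** Riem i a z) $ j $ b"
      by (subst Riem_antisym) (simp add: matrix_mul_simps)
    also have "\<dots> = (transpose (Riem i a z) ** H z) $ j $ b" by (simp add: Riem_skew[OF z'])
    also have "\<dots> = transpose (H z ** Riem i a z) $ j $ b" using z' by (simp add: transpose_simps)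
    finally show ?thesis by simp
  qed
  have "A $ a $ b * weyl G a i j b y = A $ a $ b * (H z ** Riem i a z) $ b $ j
      + A $ a $ b * (H z $ i $ b * P $ a $ j) + A $ a $ b * (P $ i $ b * H z $ a $ j)
      - A $ a $ b * P $ a $ b * H z $ i $ j - A $ a $ b * H z $ a $ b * P $ i $ j" for a b
    by (simp add: weyl_def curvature_eq[OF z G] flip: P(1) z_def)
      (simp add: G[OF z] R algebra_simps flip: z_def)
  then have "(\<Sum>a\<in>UNIV. \<Sum>b\<in>UNIV. A $ a $ b * weyl G a i j b y)
      = (\<Sum>a\<in>UNIV. \<Sum>b\<in>UNIV. A $ a $ b * (H z ** Riem i a z) $ b $ j)
      + (H z ** transpose A ** P) $ i $ j + (P ** transpose A ** H z) $ i $ j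
      - (\<Sum>a\<in>UNIV. \<Sum>b\<in>UNIV. A $ a $ b * P $ a $ b) * H z $ i $ j
      - (\<Sum>a\<in>UNIV. \<Sum>b\<in>UNIV. A $ a $ b * H z $ a $ b) * P $ i $ j"
    by (simp only: sum.distrib sum_subtractf sum_sandwich sum_distrib_right)
  also have "(\<Sum>a\<in>UNIV. \<Sum>b\<in>UNIV. A $ a $ b * (H z ** Riem i a z) $ b $ j)
      = (\<Sum>a\<in>UNIV. (A ** (H z ** Riem i a z)) $ a $ j)"
    by (simp only: matrix_mul_nth)
  also have "\<dots> = (\<Sum>a\<in>UNIV. (K z ** P ** Riem i a z) $ a $ j)"
    using z' by (simp add: A_def matrix_mul_assoc)
  also have "(\<Sum>a\<in>UNIV. \<Sum>b\<in>UNIV. A $ a $ b * P $ a $ b) = trace (A ** P)"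
    using symmetric_nth[OF P(2)] by (simp add: trace_mul)
  also have "(\<Sum>a\<in>UNIV. \<Sum>b\<in>UNIV. A $ a $ b * H z $ a $ b) = trace (A ** H z)"
    using symmetric_nth[OF H_sym[OF z']] by (simp add: trace_mul)
  finally show ?thesis
    using z' by (simp add: raise A) (simp add: A_def matrix_mul_assoc)
qed

text \<open>All second covariant derivatives in the variation of the Ricci tensor in the direction of
  the Schouten tensor are those of the Bach tensor, up to one commutator; the divergence of the
  Schouten tensor being the differential of its trace, the Hessian of \<open>theta\<close> drops out.\<close>

lemma ds_Ric_eq_bach:
  assumes z: "(y, s) \<in> \<Omega>" and G: "\<And>y. (y, s) \<in> \<Omega> \<Longrightarrow> G y = H (y, s)"
    and P: "\<And>y. (y, s) \<in> \<Omega> \<Longrightarrow> schouten G y = (1/2) *\<^sub>R ds H (y, s)"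
    and div: "\<And>y k. (y, s) \<in> \<Omega> \<Longrightarrow> (\<Sum>i\<in>UNIV. (K (y, s) ** nab i (ds H) (y, s)) $ i $ k) = dx k theta (y, s)"
    and Ric: "Ric (y, s) = ((real CARD('n) - 2) / 2) *\<^sub>R ds H (y, s) + (theta (y, s) / 2) *\<^sub>R H (y, s)"
  defines "z \<equiv> (y, s)"
  shows "ds Ric z + bach G y = (real CARD('n) / 4) *\<^sub>R (ds H z ** K z ** ds H z)
    - (trace (K z ** ds H z ** K z ** ds H z) / 4) *\<^sub>R H z"
proof (rule matrix_eqI)
  fix j k
  have z': "z \<in> \<Omega>" using z by (simp add: z_def)
  define Q where "Q = schouten G y"
  have Q: "Q = (1/2) *\<^sub>R ds H z" using P[OF z] by (simp add: Q_def z_def)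
  have Q_sym: "transpose Q = Q" using z' by (simp add: Q transpose_simps)
  let ?n = "\<lambda>k l i j. nab2 k l (ds H) z $ i $ j"
  have n_sym: "?n k l i j = ?n k l j i" for k l i j
    by (rule symmetric_nth, rule nab2_symmetric[OF sm_ds_H _ z']) simp
  have K_sym': "K z $ a $ b = K z $ b $ a" for a b
    using K_sym[OF z'] by (rule symmetric_nth)
  have nabla2: "nabla2 G (schouten G) i j k l y = ?n k l i j / 2" for i j k l
    using nabla2_eq[OF z G, of "\<lambda>z. (1/2) *\<^sub>R ds H z" "schouten G" i j k l]
    by (simp add: sm_rules P nab2_scaleR[OF sm_ds_H z'] flip: z_def)
  let ?S = "\<lambda>f. \<Sum>i\<in>UNIV. \<Sum>l\<in>UNIV. K z $ i $ l * f i l"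
  let ?W = "\<Sum>a\<in>UNIV. \<Sum>b\<in>UNIV. raise G (schouten G) y $ a $ b * weyl G a j k b y"
  have swap: "?S f = ?S (\<lambda>i l. f l i)" for f
    by (subst sum.swap) (simp add: K_sym')
  have "bach G y $ j $ k = ?S (\<lambda>a b. ?n a b j k / 2) - ?S (\<lambda>a b. ?n k b j a / 2) + ?W"
    by (simp add: bach_def nabla2 christoffel_eq(2)[OF z G] flip: z_def)
  also have "?S (\<lambda>a b. ?n a b j k / 2) = ?S (\<lambda>i l. ?n l i k j / 2)"
    by (subst swap) (simp add: n_sym[of _ _ j k])
  also have "?S (\<lambda>a b. ?n k b j a / 2) = ?S (\<lambda>i l. ?n k i l j / 2)"
    by (subst swap) (simp add: n_sym[of _ _ j])
  finally have bach: "bach G y $ j $ k = ?S (\<lambda>i l. ?n l i k j / 2) - ?S (\<lambda>i l. ?n k i l j / 2) + ?W" .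
  have "ds Ric z $ j $ k = ?S (\<lambda>i l. ?n k i l j / 2) + ?S (\<lambda>i l. ?n j i l k / 2) - ?S (\<lambda>i l. ?n l i k j / 2)
      - hess theta k j z / 2"
    by (simp add: ds_Ric[OF z'] algebra_simps sum.distrib sum_subtractf add_divide_distrib diff_divide_distrib
        sum_divide_distrib)
  then have 1: "(ds Ric z + bach G y) $ j $ k = ?S (\<lambda>i l. ?n j i l k / 2) - hess theta k j z / 2 + ?W"
    by (simp add: bach)
  have 2: "?S (\<lambda>i l. ?n j i l k / 2) = (\<Sum>i\<in>UNIV. (K z ** nab2 j i (ds H) z) $ i $ k) / 2"
    by (simp add: matrix_mul_nth sum_divide_distrib)
  have "(\<Sum>i\<in>UNIV. (K z ** nab2 j i (ds H) z) $ i $ k)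
    = (\<Sum>i\<in>UNIV. (K z ** nab2 i j (ds H) z) $ i $ k)
      - (\<Sum>i\<in>UNIV. (K z ** transpose (Riem j i z) ** ds H z) $ i $ k)
      - (\<Sum>i\<in>UNIV. (K z ** ds H z ** Riem j i z) $ i $ k)"
  proof -
    have "K z ** nab2 j i (ds H) z = K z ** nab2 i j (ds H) z
      - K z ** transpose (Riem j i z) ** ds H z - K z ** ds H z ** Riem j i z" for i
    proof -
      have "nab2 j i (ds H) z = nab2 i j (ds H) z - transpose (Riem j i z) ** ds H z - ds H z ** Riem j i z"
        using Ricci_identity[OF sm_ds_H z', of j i] by (simp add: algebra_simps)
      then show ?thesis by (simp add: matrix_mul_simps matrix_mul_assoc)
    qed
    then show ?thesis by (simp add: sum_subtractf)
  qed
  also have "(\<Sum>i\<in>UNIV. (K z ** nab2 i j (ds H) z) $ i $ k) = hess theta k j z"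
  proof -
    have "dx j (\<lambda>z. \<Sum>i\<in>UNIV. (K z ** nab i (ds H) z) $ i $ k) z = dx j (dx k theta) z"
    proof -
      let ?f = "\<lambda>y. \<Sum>i\<in>UNIV. (K (y, s) ** nab i (ds H) (y, s)) $ i $ k"
      have "pd j ?f y = dx j (\<lambda>z. \<Sum>i\<in>UNIV. (K z ** nab i (ds H) z) $ i $ k) (y, s)"
        by (rule pd_slice[OF _ z]) (auto intro!: sm_rules sm_nab)
      moreover have "pd j ?f y = dx j (dx k theta) (y, s)"
        by (rule pd_slice[OF _ z]) (auto intro!: sm_rules sm_theta simp: div)
      ultimately show ?thesis by (simp add: z_def)
    qed
    then show ?thesis
      unfolding nab_divergence[OF sm_ds_H z'] hess_def using div[OF z]
      by (simp add: D_commute[OF sm_theta z', of _ "(axis k 1, 0)"] Gam_swap[OF z', of j] flip: z_def)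
  qed
  also have "(\<Sum>i\<in>UNIV. (K z ** transpose (Riem j i z) ** ds H z) $ i $ k)
      = - (transpose (Ric z) ** (K z ** ds H z)) $ j $ k"
  proof -
    have "K z ** transpose (Riem j i z) = - (Riem j i z ** K z)" for i
    proof -
      have "K z ** (transpose (Riem j i z) ** H z) ** K z = - (K z ** (H z ** Riem j i z) ** K z)"
        by (simp add: Riem_skew[OF z'] matrix_mul_simps)
      then show ?thesis using z' by (simp add: matrix_mul_assoc)
    qed
    then have "(\<Sum>i\<in>UNIV. (K z ** transpose (Riem j i z) ** ds H z) $ i $ k)
      = - (\<Sum>i\<in>UNIV. (Riem j i z ** (K z ** ds H z)) $ i $ k)"
      by (simp add: matrix_mul_simps matrix_mul_assoc sum_negf)
    also have "(\<Sum>i\<in>UNIV. (Riem j i z ** (K z ** ds H z)) $ i $ k) = (transpose (Ric z) ** (K z ** ds H z)) $ j $ k"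
      unfolding matrix_mul_nth[of "Riem j _ z"] matrix_mul_nth[of "transpose (Ric z)"] transpose_nth
      by (subst sum.swap) (simp add: Ric_def sum_distrib_right)
    finally show ?thesis .
  qed
  also have "transpose (Ric z) = ((real CARD('n) - 2) / 2) *\<^sub>R ds H z + (theta z / 2) *\<^sub>R H z"
    using Ric z' by (simp add: z_def transpose_simps)
  finally have 3: "(\<Sum>i\<in>UNIV. (K z ** nab2 j i (ds H) z) $ i $ k) = hess theta k j z
      + ((((real CARD('n) - 2) / 2) *\<^sub>R ds H z + (theta z / 2) *\<^sub>R H z) ** (K z ** ds H z)) $ j $ k
      - (\<Sum>i\<in>UNIV. (K z ** ds H z ** Riem j i z) $ i $ k)" by simp
  have "((((real CARD('n) - 2) / 2) *\<^sub>R ds H z + (theta z / 2) *\<^sub>R H z) ** (K z ** ds H z)) $ j $ k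
    = (real CARD('n) - 2) / 2 * (ds H z ** K z ** ds H z) $ j $ k + theta z / 2 * ds H z $ j $ k"
    using z' by (simp add: matrix_mul_simps matrix_mul_assoc)
  with 3 have 3: "?S (\<lambda>i l. ?n j i l k / 2) = hess theta k j z / 2
     + (real CARD('n) - 2) / 4 * (ds H z ** K z ** ds H z) $ j $ k + theta z / 4 * ds H z $ j $ k
     - (\<Sum>i\<in>UNIV. (K z ** ds H z ** Riem j i z) $ i $ k) / 2"
    unfolding 2 by (simp add: field_simps)
  have "?W = (\<Sum>i\<in>UNIV. (K z ** ds H z ** Riem j i z) $ i $ k) / 2
      + (ds H z ** K z ** ds H z) $ j $ k / 2
      - trace (K z ** ds H z ** K z ** ds H z) / 4 * H z $ j $ k
      - theta z / 4 * ds H z $ j $ k"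
    using weyl_contraction[OF z G Q_def Q_sym, of j k]
    by (simp add: Q matrix_mul_simps trace_simps theta_def flip: z_def sum_divide_distrib)
  then show "(ds Ric z + bach G y) $ j $ k = ((real CARD('n) / 4) *\<^sub>R (ds H z ** K z ** ds H z)
    - (trace (K z ** ds H z ** K z ** ds H z) / 4) *\<^sub>R H z) $ j $ k"
    unfolding 1 3 by (simp add: algebra_simps) (simp add: field_simps)
qed

end

section \<open>The Ricci tensor of the Poincare--Einstein metric\<close>

lemma sum_option: "(\<Sum>a\<in>UNIV. f a) = f None + (\<Sum>i\<in>UNIV. f (Some i))"
  for f :: "'n::finite option \<Rightarrow> 'b::comm_monoid_add"
  by (simp add: UNIV_option_conv sum.reindex)

text \<open>The metric $r^{-2}(dr^2 + g_r)$ on the set \<open>N\<close> of those pairs $(y, r)$ where $g_r = g(- r^2 / 2)$.\<close>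

locale plus_family = family_of_metrics \<Omega> H
  for \<Omega> :: "((real^'n::finite) \<times> real) set" and H +
  fixes gr :: "real \<Rightarrow> real^'n \<Rightarrow> real^'n^'n" and N :: "((real^'n) \<times> real) set"
  assumes open_N: "open N"
    and N: "\<And>y r. (y, r) \<in> N \<Longrightarrow> r \<noteq> 0 \<and> (y, - r\<^sup>2 / 2) \<in> \<Omega> \<and> gr r y = H (y, - r\<^sup>2 / 2)"
begin

definition base :: "real^'n option \<Rightarrow> real^'n" where "base z = (\<chi> i. z $ Some i)"

definition pt :: "real^'n option \<Rightarrow> (real^'n) \<times> real" where
  "pt z = (base z, - (z $ None)\<^sup>2 / 2)"

definition plus_dom :: "(real^'n option) set" where "plus_dom = {z. (base z, z $ None) \<in> N}"

lemma bounded_linear_base: "bounded_linear base"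
  unfolding linear_conv_bounded_linear[symmetric] linear_iff by (simp add: base_def vec_eq_iff)

lemma open_plus_dom: "open plus_dom"
proof -
  have "continuous_on UNIV (\<lambda>z. (base z, z $ None))"
    by (intro continuous_intros linear_continuous_on bounded_linear_base)
  from open_vimage[OF open_N this] show ?thesis by (simp add: plus_dom_def vimage_def)
qed

lemma plus_dom: "z \<in> plus_dom \<Longrightarrow> z $ None \<noteq> 0" "z \<in> plus_dom \<Longrightarrow> pt z \<in> \<Omega>"
  using N by (auto simp: plus_dom_def pt_def)

lemma pt_derivative: "(pt has_derivative (\<lambda>v. (base v, - (z $ None * v $ None)))) (at z)"
  unfolding pt_def[abs_def]
  by (auto intro!: derivative_eq_intros bounded_linear_imp_has_derivative bounded_linear_base
      simp: power2_eq_square)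

text \<open>All components of the metric and of its Christoffel symbols are sums of at most two terms
  $\alpha(r) F(y, - r^2 / 2)$. The factor \<open>- z $ None\<close> is the derivative of $- r^2 / 2$.\<close>

lemma pd_plus:
  fixes F1 F2 :: "(real^'n) \<times> real \<Rightarrow> real"
  assumes z: "z \<in> plus_dom" and f: "\<And>z. z \<in> plus_dom \<Longrightarrow> f z = \<alpha> (z $ None) * F1 (pt z) + \<beta> (z $ None) * F2 (pt z)"
    and F: "sm F1" "sm F2"
    and \<alpha>: "(\<alpha> has_real_derivative \<alpha>') (at (z $ None))" and \<beta>: "(\<beta> has_real_derivative \<beta>') (at (z $ None))"
  shows "pd (Some i) f z = \<alpha> (z $ None) * dx i F1 (pt z) + \<beta> (z $ None) * dx i F2 (pt z)" (is ?P1)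
    "pd None f z = \<alpha>' * F1 (pt z) - z $ None * \<alpha> (z $ None) * ds F1 (pt z)
       + \<beta>' * F2 (pt z) - z $ None * \<beta> (z $ None) * ds F2 (pt z)" (is ?P2)
proof -
  note dF = F[THEN sm_diff[OF _ plus_dom(2)[OF z]]]
  have r: "((\<lambda>z. z $ None) has_derivative (\<lambda>v. v $ None)) (at z)"
    by (rule bounded_linear_imp_has_derivative) (rule bounded_linear_vec_nth)
  have 1: "((\<lambda>z. \<gamma> (z $ None) * F (pt z)) has_derivative (\<lambda>v. \<gamma> (z $ None)
      * ddir (base v, - (z $ None * v $ None)) F (pt z) + (v $ None * \<gamma>') * F (pt z))) (at z)"
    if "F differentiable (at (pt z))" "(\<gamma> has_real_derivative \<gamma>') (at (z $ None))" for F :: "_ \<Rightarrow> real" and \<gamma> \<gamma>'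
    using has_derivative_mult[OF has_derivative_compose[OF r that(2)[unfolded has_field_derivative_def]]
        has_derivative_compose[OF pt_derivative has_derivative_ddir[OF that(1)]]]
    by (simp add: mult.commute)
  have 2: "ddir v f z = \<alpha> (z $ None) * ddir (base v, - (z $ None * v $ None)) F1 (pt z)
       + v $ None * \<alpha>' * F1 (pt z)
       + (\<beta> (z $ None) * ddir (base v, - (z $ None * v $ None)) F2 (pt z) + v $ None * \<beta>' * F2 (pt z))" for v
  proof -
    have "ddir v f z = ddir v (\<lambda>z. \<alpha> (z $ None) * F1 (pt z) + \<beta> (z $ None) * F2 (pt z)) z"
      by (rule ddir_cong[OF open_plus_dom z f])
    also have "\<dots> = \<alpha> (z $ None) * ddir (base v, - (z $ None * v $ None)) F1 (pt z)
       + v $ None * \<alpha>' * F1 (pt z)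
       + (\<beta> (z $ None) * ddir (base v, - (z $ None * v $ None)) F2 (pt z) + v $ None * \<beta>' * F2 (pt z))"
      by (rule ddir_unique[OF has_derivative_add[OF 1[OF dF(1) \<alpha>] 1[OF dF(2) \<beta>]]])
    finally show ?thesis .
  qed
  have b: "base (axis (Some i) 1) = axis i 1" "base (axis None 1) = 0"
    by (auto simp: base_def axis_def vec_eq_iff)
  show ?P1
    by (simp add: pd_eq_ddir 2 b) (simp add: axis_def)
  have s: "ddir (0, - (z $ None)) F (pt z) = - (z $ None) * ds F (pt z)"
    if "F differentiable (at (pt z))" for F :: "_ \<Rightarrow> real"
    using ddir_scale_direction[OF that, of "- (z $ None)" "(0, 1)"] by simp
  show ?P2
    by (simp add: pd_eq_ddir 2 b) (simp add: axis_def s[OF dF(1)] s[OF dF(2)])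
qed

lemma pd_plus_const:
  assumes z: "z \<in> plus_dom" and f: "\<And>z. z \<in> plus_dom \<Longrightarrow> f z = (c::real)"
  shows "pd a f z = 0"
proof -
  have "ddir (axis a 1) f z = ddir (axis a 1) (\<lambda>_. c) z" by (rule ddir_cong[OF open_plus_dom z f])
  then show ?thesis by (simp add: pd_eq_ddir)
qed

abbreviation "gp \<equiv> plus_metric gr"

lemma gp_nth:
  assumes "z \<in> plus_dom"
  shows "gp z $ None $ None = 1 / (z $ None)\<^sup>2" "gp z $ None $ Some j = 0" "gp z $ Some i $ None = 0"
    "gp z $ Some i $ Some j = 1 / (z $ None)\<^sup>2 * H (pt z) $ i $ j"
  using N[of "base z" "z $ None"] assms
  by (simp_all add: plus_metric_def Let_def plus_dom_def base_def pt_def)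

lemma gp_inv:
  assumes z: "z \<in> plus_dom"
  shows "ginv gp z $ None $ None = (z $ None)\<^sup>2" "ginv gp z $ None $ Some j = 0" "ginv gp z $ Some i $ None = 0"
    "ginv gp z $ Some i $ Some j = (z $ None)\<^sup>2 * K (pt z) $ i $ j"
proof -
  let ?r = "z $ None"
  define B :: "real^'n option^'n option" where "B = (\<chi> a b. case (a, b) of (None, None) \<Rightarrow> ?r\<^sup>2
    | (Some i, Some j) \<Rightarrow> ?r\<^sup>2 * K (pt z) $ i $ j | _ \<Rightarrow> 0)"
  have "gp z ** B = mat 1"
  proof (rule matrix_eqI)
    fix a b
    have "(\<Sum>k\<in>UNIV. H (pt z) $ i $ k * K (pt z) $ k $ j) = (if i = j then 1 else 0)" for i j
      by (simp only: matrix_mul_nth[symmetric] HK(1)[OF plus_dom(2)[OF z]] mat_nth)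
    then show "(gp z ** B) $ a $ b = mat 1 $ a $ b"
      using plus_dom(1)[OF z] gp_nth[OF z]
      by (cases a; cases b) (simp_all add: matrix_mul_nth sum_option B_def mat_nth)
  qed
  then have "ginv gp z = B" unfolding ginv_def by (rule matrix_inv_unique(1))
  then show "ginv gp z $ None $ None = ?r\<^sup>2" "ginv gp z $ None $ Some j = 0" "ginv gp z $ Some i $ None = 0"
    "ginv gp z $ Some i $ Some j = ?r\<^sup>2 * K (pt z) $ i $ j"
    by (simp_all add: B_def)
qed

lemma pd_gp:
  assumes z: "z \<in> plus_dom"
  shows "pd None (\<lambda>z. gp z $ None $ None) z = - 2 / (z $ None) ^ 3" (is ?P1)
    "pd (Some k) (\<lambda>z. gp z $ None $ None) z = 0" (is ?P2)
    "pd a (\<lambda>z. gp z $ None $ Some j) z = 0" (is ?P3) "pd a (\<lambda>z. gp z $ Some i $ None) z = 0"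
    "pd None (\<lambda>z. gp z $ Some i $ Some j) z = - 2 / (z $ None) ^ 3 * H (pt z) $ i $ j
       - 1 / z $ None * ds H (pt z) $ i $ j" (is ?P4)
    "pd (Some k) (\<lambda>z. gp z $ Some i $ Some j) z = 1 / (z $ None)\<^sup>2 * dx k H (pt z) $ i $ j" (is ?P5)
proof -
  have r: "z $ None \<noteq> 0" by (rule plus_dom(1)[OF z])
  have d: "((\<lambda>r. 1 / r\<^sup>2) has_real_derivative - 2 / (z $ None) ^ 3) (at (z $ None))"
    using r by (auto intro!: derivative_eq_intros simp: field_simps power2_eq_square power3_eq_cube)
  have d0: "((\<lambda>r. 0) has_real_derivative 0) (at (z $ None))" by simp
  show ?P1 ?P2
    using pd_plus[OF z _ _ _ d d0, of "\<lambda>z. gp z $ None $ None" "\<lambda>_. 1" "\<lambda>_. 1"]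
    by (simp_all add: gp_nth sm_rules)
  show ?P3 "pd a (\<lambda>z. gp z $ Some i $ None) z = 0"
    by (rule pd_plus_const[OF z], simp add: gp_nth)+
  show ?P4 ?P5
    using pd_plus[OF z _ _ _ d d0, of "\<lambda>z. gp z $ Some i $ Some j" "\<lambda>z. H z $ i $ j" "\<lambda>_. 1"] r
    by (simp_all add: gp_nth sm_rules D_entry[OF smooth_H plus_dom(2)[OF z]] power2_eq_square)
qed

text \<open>The mixed Christoffel symbols $\Gamma^i_{rj}$.\<close>

definition shape :: "real \<Rightarrow> (real^'n) \<times> real \<Rightarrow> real^'n^'n" where
  "shape r z = (- 1 / r) *\<^sub>R mat 1 + (- r / 2) *\<^sub>R (K z ** ds H z)"

lemma christoffel_gp:
  assumes z: "z \<in> plus_dom"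
  shows "christoffel gp None None None z = - 1 / z $ None" (is ?P1)
    "christoffel gp None None (Some j) z = 0" "christoffel gp None (Some j) None z = 0"
    "christoffel gp None (Some i) (Some j) z = 1 / z $ None * H (pt z) $ i $ j + z $ None / 2 * ds H (pt z) $ i $ j" (is ?P2)
    "christoffel gp (Some i) None None z = 0"
    "christoffel gp (Some i) None (Some j) z = shape (z $ None) (pt z) $ i $ j" (is ?P3)
    "christoffel gp (Some i) (Some j) None z = shape (z $ None) (pt z) $ i $ j" (is ?P4)
    "christoffel gp (Some i) (Some j) (Some k) z = Gam j (pt z) $ i $ k" (is ?P5)
proof -
  have r: "z $ None \<noteq> 0" by (rule plus_dom(1)[OF z])
  note s = christoffel_def sum_option gp_inv[OF z] pd_gp[OF z]
  show ?P1
    "christoffel gp None None (Some j) z = 0" "christoffel gp None (Some j) None z = 0"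
    ?P2
    "christoffel gp (Some i) None None z = 0"
    using r by (simp_all add: s) (simp_all add: field_simps power2_eq_square power3_eq_cube)
  have "christoffel gp (Some i) (Some j) (Some k) z = (\<Sum>l\<in>UNIV. (z $ None)\<^sup>2 * K (pt z) $ i $ l
      * (1 / (z $ None)\<^sup>2 * Low j (pt z) $ l $ k)) / 2"
    by (simp add: s Low_def add_divide_distrib diff_divide_distrib)
  also have "\<dots> = Gam j (pt z) $ i $ k"
    using r by (simp add: Gam_def matrix_mul_nth)
  finally show ?P5 .
  have "(\<Sum>l\<in>UNIV. (z $ None)\<^sup>2 * K (pt z) $ i $ l * (- 2 / (z $ None) ^ 3 * H (pt z) $ l $ j
       - 1 / z $ None * ds H (pt z) $ l $ j)) / 2
    = - 1 / z $ None * (\<Sum>l\<in>UNIV. K (pt z) $ i $ l * H (pt z) $ l $ j)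
      - z $ None / 2 * (\<Sum>l\<in>UNIV. K (pt z) $ i $ l * ds H (pt z) $ l $ j)"
    unfolding sum_divide_distrib sum_distrib_left sum_subtractf[symmetric]
    by (rule sum.cong) (use r in \<open>simp_all add: field_simps power2_eq_square power3_eq_cube\<close>)
  also have "\<dots> = shape (z $ None) (pt z) $ i $ j"
    using HK(2)[OF plus_dom(2)[OF z]] by (simp add: shape_def flip: matrix_mul_nth)
  finally have *: "(\<Sum>l\<in>UNIV. (z $ None)\<^sup>2 * K (pt z) $ i $ l * (- 2 / (z $ None) ^ 3 * H (pt z) $ l $ j
       - 1 / z $ None * ds H (pt z) $ l $ j)) / 2 = shape (z $ None) (pt z) $ i $ j" .
  show ?P3 ?P4
    unfolding *[symmetric] by (simp_all add: s)
qed

lemma sm_M: "sm (\<lambda>z. K z ** ds H z)" by (intro sm_rules)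

lemma pd_christoffel_gp:
  assumes z: "z \<in> plus_dom"
  shows "pd None (christoffel gp None None None) z = 1 / (z $ None)\<^sup>2" (is ?P1)
    "pd (Some k) (christoffel gp None None None) z = 0" (is ?P2)
    "pd a (christoffel gp None None (Some j)) z = 0" (is ?P3) "pd a (christoffel gp None (Some j) None) z = 0"
    "pd None (christoffel gp None (Some i) (Some j)) z = - 1 / (z $ None)\<^sup>2 * H (pt z) $ i $ j
       - 1 / 2 * ds H (pt z) $ i $ j - (z $ None)\<^sup>2 / 2 * ds (ds H) (pt z) $ i $ j" (is ?P4)
    "pd a (christoffel gp (Some i) None None) z = 0" (is ?P5)
    "pd None (christoffel gp (Some i) None (Some j)) z = 1 / (z $ None)\<^sup>2 * mat 1 $ i $ j
       - 1 / 2 * (K (pt z) ** ds H (pt z)) $ i $ j + (z $ None)\<^sup>2 / 2 * ds (\<lambda>z. K z ** ds H z) (pt z) $ i $ j" (is ?P6)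
    "pd (Some k) (christoffel gp (Some i) None (Some j)) z = - (z $ None) / 2 * dx k (\<lambda>z. K z ** ds H z) (pt z) $ i $ j" (is ?P7)
    "pd (Some l) (christoffel gp (Some i) (Some j) (Some k)) z = dx l (Gam j) (pt z) $ i $ k" (is ?P8)
proof -
  have r: "z $ None \<noteq> 0" by (rule plus_dom(1)[OF z])
  have d1: "((\<lambda>r. 1 / r) has_real_derivative - 1 / (z $ None)\<^sup>2) (at (z $ None))"
    "((\<lambda>r. - 1 / r) has_real_derivative 1 / (z $ None)\<^sup>2) (at (z $ None))"
    "((\<lambda>r. r / 2) has_real_derivative 1 / 2) (at (z $ None))"
    "((\<lambda>r. - r / 2) has_real_derivative - 1 / 2) (at (z $ None))"
    using r by (auto intro!: derivative_eq_intros simp: field_simps power2_eq_square)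
  have d0: "((\<lambda>r. 0) has_real_derivative 0) (at (z $ None))"
    "((\<lambda>r. 1) has_real_derivative 0) (at (z $ None))" by simp_all
  show ?P1 ?P2
    using pd_plus[OF z _ _ _ d1(2) d0(1), of "christoffel gp None None None" "\<lambda>_. 1" "\<lambda>_. 1"]
    by (simp_all add: christoffel_gp sm_rules)
  show ?P3 "pd a (christoffel gp None (Some j) None) z = 0"
    ?P5
    by (rule pd_plus_const[OF z], simp add: christoffel_gp)+
  show ?P4
    using pd_plus(2)[OF z _ _ _ d1(1) d1(3), of "christoffel gp None (Some i) (Some j)"
        "\<lambda>z. H z $ i $ j" "\<lambda>z. ds H z $ i $ j"] r
    by (simp add: christoffel_gp sm_rules D_entry[OF smooth_H plus_dom(2)[OF z]]
        D_entry[OF sm_ds_H plus_dom(2)[OF z]] power2_eq_square)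
  show ?P6 ?P7
    using pd_plus[OF z _ _ _ d1(2) d1(4), of "christoffel gp (Some i) None (Some j)"
        "\<lambda>z. mat 1 $ i $ j" "\<lambda>z. (K z ** ds H z) $ i $ j"] r
    by (simp_all add: christoffel_gp sm_rules shape_def D_entry[OF sm_M plus_dom(2)[OF z]] power2_eq_square)
  show ?P8
    using pd_plus(1)[OF z _ _ _ d0(2) d0(1), of "christoffel gp (Some i) (Some j) (Some k)"
        "\<lambda>z. Gam j z $ i $ k" "\<lambda>_. 1"]
    by (simp add: christoffel_gp sm_rules D_entry[OF sm_Gam plus_dom(2)[OF z]])
qed

lemma pd_christoffel_gp':
  assumes z: "z \<in> plus_dom"
  shows "pd (Some l) (christoffel gp (Some i) (Some j) (Some k)) z = dx l (Gam k) (pt z) $ i $ j" (is ?P1)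
    "pd a (christoffel gp (Some i) (Some j) None) z = pd a (christoffel gp (Some i) None (Some j)) z" (is ?P2)
proof -
  have "dx l (\<lambda>z. Gam j z $ i $ k) (pt z) = dx l (\<lambda>z. Gam k z $ i $ j) (pt z)"
    by (rule D_cong[OF Gam_swap plus_dom(2)[OF z]])
  then show ?P1
    by (simp add: pd_christoffel_gp[OF z] D_entry[OF sm_Gam plus_dom(2)[OF z]])
  show ?P2
    unfolding pd_eq_ddir by (rule ddir_cong[OF open_plus_dom z]) (simp add: christoffel_gp)
qed

text \<open>The tangential components of the Einstein defect, as a function of the parameter $\rho = - r^2 / 2$.\<close>

definition tangential :: "(real^'n) \<times> real \<Rightarrow> real^'n^'n" where
  "tangential z = Ric z - (real CARD('n) / 2 - 1) *\<^sub>R ds H z - (theta z / 2) *\<^sub>R H z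
    + snd z *\<^sub>R (ds (ds H) z + (theta z / 2) *\<^sub>R ds H z - ds H z ** K z ** ds H z)"

lemma ricci_gp_tangential:
  assumes z: "z \<in> plus_dom"
  shows "ricci gp z $ Some j $ Some k + real CARD('n) * gp z $ Some j $ Some k = tangential (pt z) $ j $ k"
proof -
  have r: "z $ None \<noteq> 0" and p: "pt z \<in> \<Omega>" using plus_dom[OF z] by auto
  let ?r = "z $ None"
  define Y where "Y = (1 / ?r) *\<^sub>R H (pt z) + (?r / 2) *\<^sub>R ds H (pt z)"
  define X where "X = shape ?r (pt z)"
  have c: "christoffel gp None (Some i) (Some j) z = Y $ i $ j"
    "christoffel gp (Some i) None (Some j) z = X $ i $ j" "christoffel gp (Some i) (Some j) None z = X $ i $ j" for i j
    by (simp_all add: christoffel_gp[OF z] Y_def X_def)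
  have "ricci gp z $ Some j $ Some k = (- 1 / ?r\<^sup>2 * H (pt z) $ j $ k
       - 1 / 2 * ds H (pt z) $ j $ k - ?r\<^sup>2 / 2 * ds (ds H) (pt z) $ j $ k)
     - 1 / ?r * Y $ j $ k - (Y ** X) $ k $ j + Ric (pt z) $ j $ k + trace X * Y $ j $ k
     - (Y ** X) $ j $ k"
    by (simp add: ricci_def sum_option curvature_up_def christoffel_gp(1-3,5,8)[OF z] c Gam_swap[OF p, of j]
        pd_christoffel_gp(1-8)[OF z] pd_christoffel_gp'[OF z]
        Ric_def Riem_def matrix_mul_nth trace_def sum.distrib sum_subtractf)
      (simp add: sum_distrib_left mult.commute)
  moreover have YX: "Y ** X = - ((1 / ?r\<^sup>2) *\<^sub>R H (pt z) + ds H (pt z)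
      + (?r\<^sup>2 / 4) *\<^sub>R (ds H (pt z) ** K (pt z) ** ds H (pt z)))"
    using p r by (simp add: Y_def X_def shape_def matrix_mul_simps matrix_mul_assoc)
      (simp add: vec_eq_iff field_simps power2_eq_square)
  moreover have "(Y ** X) $ k $ j = (Y ** X) $ j $ k"
    by (rule symmetric_nth) (use p in \<open>simp add: YX transpose_simps matrix_mul_assoc\<close>)
  moreover have "trace X = - real CARD('n) / ?r - ?r / 2 * theta (pt z)"
    by (simp add: X_def shape_def trace_simps trace_I theta_def)
  ultimately show ?thesis
    using r by (simp add: gp_nth[OF z] tangential_def Y_def pt_def[of z])
      (simp add: field_simps power2_eq_square flip: pt_def)
qed

lemma ricci_gp_normal:
  assumes z: "z \<in> plus_dom"
  shows "ricci gp z $ None $ None + real CARD('n) * gp z $ None $ None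
    = - ((z $ None)\<^sup>2 / 2) * (ds theta (pt z) + trace (K (pt z) ** ds H (pt z) ** K (pt z) ** ds H (pt z)) / 2)"
proof -
  have r: "z $ None \<noteq> 0" and p: "pt z \<in> \<Omega>" using plus_dom[OF z] by auto
  let ?r = "z $ None"
  let ?M = "\<lambda>z. K z ** ds H z"
  define X where "X = shape ?r (pt z)"
  have c: "christoffel gp (Some i) None (Some j) z = X $ i $ j" "christoffel gp (Some i) (Some j) None z = X $ i $ j" for i j
    by (simp_all add: christoffel_gp[OF z] X_def)
  have "ricci gp z $ None $ None = - (\<Sum>i\<in>UNIV. 1 / ?r\<^sup>2 * mat 1 $ i $ i
       - 1 / 2 * ?M (pt z) $ i $ i + ?r\<^sup>2 / 2 * ds ?M (pt z) $ i $ i) - 1 / ?r * trace X - trace (X ** X)"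
    by (simp add: ricci_def sum_option curvature_up_def christoffel_gp(1-3,5)[OF z] c
        pd_christoffel_gp(1-8)[OF z] pd_christoffel_gp'[OF z]
        matrix_mul_nth trace_def sum.distrib sum_subtractf sum_distrib_left sum_negf mult.commute)
  moreover have "trace X = - real CARD('n) / ?r - ?r / 2 * theta (pt z)"
    by (simp add: X_def shape_def trace_simps trace_I theta_def)
  moreover have "trace (X ** X) = real CARD('n) / ?r\<^sup>2 + theta (pt z)
      + ?r\<^sup>2 / 4 * trace (K (pt z) ** ds H (pt z) ** K (pt z) ** ds H (pt z))"
    using r by (simp add: X_def shape_def matrix_mul_simps trace_simps trace_I theta_def matrix_mul_assoc)
      (simp add: field_simps power2_eq_square)
  moreover have "(\<Sum>i\<in>UNIV. 1 / ?r\<^sup>2 * mat 1 $ i $ i - 1 / 2 * ?M (pt z) $ i $ i + ?r\<^sup>2 / 2 * ds ?M (pt z) $ i $ i)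
    = real CARD('n) / ?r\<^sup>2 - theta (pt z) / 2 + ?r\<^sup>2 / 2 * ds theta (pt z)"
    unfolding theta_def[abs_def] D_trace[OF sm_M p]
    by (simp add: sum.distrib sum_subtractf mat_nth trace_def flip: sum_distrib_left sum_divide_distrib)
  ultimately show ?thesis
    using r by (simp add: gp_nth[OF z]) (simp add: field_simps power2_eq_square)
qed

text \<open>The mixed components contain the divergence of \<open>ds H\<close>: that the divergence of the Schouten tensor is
  the differential of its trace thus comes from the Einstein equation.\<close>

lemma ricci_gp_mixed:
  assumes z: "z \<in> plus_dom"
  shows "ricci gp z $ None $ Some k + real CARD('n) * gp z $ None $ Some k
    = - (z $ None / 2) * ((\<Sum>i\<in>UNIV. (K (pt z) ** nab i (ds H) (pt z)) $ i $ k) - dx k theta (pt z))"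
proof -
  have r: "z $ None \<noteq> 0" and p: "pt z \<in> \<Omega>" using plus_dom[OF z] by auto
  let ?r = "z $ None"
  let ?M = "\<lambda>z. K z ** ds H z"
  define X where "X = shape ?r (pt z)"
  have c: "christoffel gp (Some i) None (Some j) z = X $ i $ j" "christoffel gp (Some i) (Some j) None z = X $ i $ j" for i j
    by (simp_all add: christoffel_gp[OF z] X_def)
  have "ricci gp z $ None $ Some k = - ?r / 2 * ((\<Sum>i\<in>UNIV. dx i ?M (pt z) $ i $ k) - trace (dx k ?M (pt z)))
     + ((\<Sum>i\<in>UNIV. (Gam i (pt z) ** X) $ i $ k) - trace (Gam k (pt z) ** X))"
    by (simp add: ricci_def sum_option curvature_up_def christoffel_gp(1-3,5,8)[OF z] c
        pd_christoffel_gp(1-8)[OF z] pd_christoffel_gp'[OF z]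
        matrix_mul_nth trace_def sum.distrib sum_subtractf sum_distrib_left right_diff_distrib mult.commute)
  also have "(\<Sum>i\<in>UNIV. (Gam i (pt z) ** X) $ i $ k) - trace (Gam k (pt z) ** X)
    = - ?r / 2 * ((\<Sum>i\<in>UNIV. (Gam i (pt z) ** ?M (pt z)) $ i $ k) - trace (Gam k (pt z) ** ?M (pt z)))"
  proof -
    have "(\<Sum>i\<in>UNIV. Gam i (pt z) $ i $ k) = trace (Gam k (pt z))"
      by (simp add: trace_def Gam_swap[OF p, of _ _ k])
    then show ?thesis
      by (simp add: X_def shape_def matrix_mul_simps trace_simps sum_negf sum_subtractf right_diff_distrib
          flip: sum_divide_distrib sum_distrib_left)
  qed
  also have "trace (dx k ?M (pt z)) = dx k theta (pt z)"
    unfolding theta_def[abs_def] D_trace[OF sm_M p] ..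
  finally have ric: "ricci gp z $ None $ Some k
    = - ?r / 2 * ((\<Sum>i\<in>UNIV. dx i ?M (pt z) $ i $ k) - dx k theta (pt z))
      + - ?r / 2 * ((\<Sum>i\<in>UNIV. (Gam i (pt z) ** ?M (pt z)) $ i $ k) - trace (Gam k (pt z) ** ?M (pt z)))" .
  have nab: "(\<Sum>i\<in>UNIV. (K (pt z) ** nab i (ds H) (pt z)) $ i $ k)
    = (\<Sum>i\<in>UNIV. dx i ?M (pt z) $ i $ k) + (\<Sum>i\<in>UNIV. (Gam i (pt z) ** ?M (pt z)) $ i $ k)
      - trace (Gam k (pt z) ** ?M (pt z))"
  proof -
    have "K (pt z) ** nab i (ds H) (pt z) = dx i ?M (pt z) + Gam i (pt z) ** ?M (pt z) - ?M (pt z) ** Gam i (pt z)" for i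
      using p by (simp add: D_matrix_mul sm_rules nab_def dx_K matrix_mul_simps matrix_mul_assoc)
    moreover have "(\<Sum>i\<in>UNIV. (?M (pt z) ** Gam i (pt z)) $ i $ k) = trace (Gam k (pt z) ** ?M (pt z))"
      unfolding trace_mul_sym[of "Gam k (pt z)"]
      by (simp add: trace_def matrix_mul_nth[of "?M (pt z)"] Gam_swap[OF p, of _ _ k])
    ultimately show ?thesis by (simp add: sum.distrib sum_subtractf)
  qed
  show ?thesis
    unfolding ric nab gp_nth[OF z] by (simp add: field_simps)
qed

end

section \<open>The Taylor coefficients of the family at the boundary\<close>

lemma smooth_on_bounded_linear:
  assumes "open S" "bounded_linear L" shows "smooth_on S L"
proof -
  have d: "ddir v L x = L v" for v x by (rule ddir_unique[OF bounded_linear_imp_has_derivative[OF assms(2)]])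
  have "Ck_on k S L" for k
  proof (cases k)
    case 0 then show ?thesis using linear_continuous_on[OF assms(2)] by simp
  next
    case (Suc m)
    have "Ck_on m S (ddir v L)" for v
      unfolding d[abs_def] by (rule Ck_on_const[OF assms(1)])
    then show ?thesis unfolding Suc Ck_on_Suc[OF assms(1)]
      using bounded_linear_imp_differentiable[OF assms(2)] by blast
  qed
  then show ?thesis by (simp add: smooth_on_def)
qed

lemma bigo_power_quotient:
  fixes f :: "real \<Rightarrow> real"
  assumes "f \<in> O[at_right 0](\<lambda>r. r ^ m)" "k < m"
  shows "((\<lambda>r. f r / r ^ k) \<longlongrightarrow> 0) (at_right 0)"
proof -
  obtain c where c: "\<forall>\<^sub>F r in at_right 0. norm (f r) \<le> c * norm (r ^ m)"
    using landau_o.bigE[OF assms(1)] by blast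
  have pos: "\<forall>\<^sub>F r :: real in at_right 0. r > 0" by (rule eventually_at_right_less)
  have "\<forall>\<^sub>F r in at_right 0. norm (f r / r ^ k) \<le> c * r ^ (m - k)"
    using c pos
  proof eventually_elim
    case (elim r)
    have "r ^ m = r ^ (m - k) * r ^ k" using assms(2) by (simp flip: power_add)
    then show ?case using elim by (simp add: divide_le_eq mult.assoc)
  qed
  moreover have "((\<lambda>r :: real. c * r ^ (m - k)) \<longlongrightarrow> 0) (at_right 0)"
  proof -
    have "((\<lambda>r :: real. c * r ^ (m - k)) \<longlongrightarrow> c * 0 ^ (m - k)) (at_right 0)"
      by (intro tendsto_intros)
    then show ?thesis using assms(2) by (simp add: power_0_left)
  qed
  ultimately show ?thesis by (rule Lim_null_comparison)
qed

lemma filterlim_minus_square: "filterlim (\<lambda>r :: real. - r\<^sup>2 / 2) (at 0) (at_right 0)"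
proof -
  have "((\<lambda>r :: real. - r\<^sup>2 / 2) \<longlongrightarrow> - 0\<^sup>2 / 2) (at_right 0)" by (intro tendsto_intros) auto
  moreover have "\<forall>\<^sub>F r :: real in at_right 0. - r\<^sup>2 / 2 \<noteq> 0"
    using eventually_at_right_less[of "0 :: real"] by eventually_elim simp
  ultimately show ?thesis by (simp add: filterlim_at)
qed

lemma taylor0_vanishes:
  fixes F :: "real \<Rightarrow> real"
  assumes "isCont F 0" "((\<lambda>r. F (- r\<^sup>2 / 2)) \<longlongrightarrow> 0) (at_right 0)"
  shows "F 0 = 0"
proof -
  have "((\<lambda>r. F (- r\<^sup>2 / 2)) \<longlongrightarrow> F 0) (at_right 0)"
    by (rule filterlim_compose[OF assms(1)[unfolded isCont_def] filterlim_minus_square])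
  then show ?thesis using assms(2) tendsto_unique trivial_limit_at_right_real by blast
qed

text \<open>The parameter $\rho = - r^2 / 2$ is quadratic in $r$, so two orders in $r$ give one in $\rho$.\<close>

lemma taylor1_vanishes:
  fixes F :: "real \<Rightarrow> real"
  assumes "(F has_real_derivative d) (at 0)" "F 0 = 0" "((\<lambda>r. F (- r\<^sup>2 / 2) / r\<^sup>2) \<longlongrightarrow> 0) (at_right 0)"
  shows "d = 0"
proof -
  have "((\<lambda>h. F h / h) \<longlongrightarrow> d) (at 0)" using assms(1,2) by (simp add: DERIV_def)
  from filterlim_compose[OF this filterlim_minus_square]
  have "((\<lambda>r. F (- r\<^sup>2 / 2) / (- r\<^sup>2 / 2)) \<longlongrightarrow> d) (at_right 0)" .
  moreover have "((\<lambda>r. - 2 * (F (- r\<^sup>2 / 2) / r\<^sup>2)) \<longlongrightarrow> - 2 * 0) (at_right 0)"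
    by (intro tendsto_mult tendsto_const assms(3))
  moreover have "(\<lambda>r. F (- r\<^sup>2 / 2) / (- r\<^sup>2 / 2)) = (\<lambda>r. - 2 * (F (- r\<^sup>2 / 2) / r\<^sup>2))"
    by (simp add: fun_eq_iff field_simps)
  ultimately show ?thesis using tendsto_unique trivial_limit_at_right_real by fastforce
qed

lemma (in family_of_metrics) sm_snd: "sm snd"
  by (rule smooth_on_bounded_linear[OF open_\<Omega> bounded_linear_snd])

locale einstein_family = plus_family \<Omega> H gr N
  for \<Omega> :: "((real^'n::finite) \<times> real) set" and H gr N +
  fixes G :: "real^'n \<Rightarrow> real^'n^'n"
  assumes near: "\<And>y. (y, 0) \<in> \<Omega> \<Longrightarrow> \<forall>\<^sub>F r in at_right 0. (y, r) \<in> N"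
    and einstein: "\<And>y. (y, 0) \<in> \<Omega> \<Longrightarrow> asymptotically_einstein G gr y"
    and G: "\<And>y. (y, 0) \<in> \<Omega> \<Longrightarrow> G y = H (y, 0)"
    and dim: "CARD('n) \<ge> 3" "CARD('n) \<noteq> 4"
begin

text \<open>For even $n \ne 4$ the defect is of order $n - 2 \ge 4$, and of order at least 6 unless $n = 6$.\<close>

lemma defect_bigo:
  assumes "(y, 0) \<in> \<Omega>"
  shows "\<exists>m\<ge>4. (\<lambda>r. einstein_defect gr r y $ a $ b) \<in> O[at_right 0](\<lambda>r. r ^ m)" (is ?P1)
    "CARD('n) \<noteq> 6 \<Longrightarrow> \<exists>m\<ge>6. (\<lambda>r. einstein_defect gr r y $ a $ b) \<in> O[at_right 0](\<lambda>r. r ^ m)"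
proof -
  have "\<exists>m\<ge>k. (\<lambda>r. einstein_defect gr r y $ a $ b) \<in> O[at_right 0](\<lambda>r. r ^ m)"
    if "odd CARD('n) \<or> CARD('n) - 2 \<ge> k" for k
    using that einstein[OF assms] unfolding asymptotically_einstein_def
    by (cases "odd CARD('n)") auto
  moreover have "odd CARD('n) \<or> CARD('n) - 2 \<ge> 4" using dim by presburger
  moreover have "odd CARD('n) \<or> CARD('n) - 2 \<ge> 6" if "CARD('n) \<noteq> 6" using dim that by presburger
  ultimately show ?P1
    "CARD('n) \<noteq> 6 \<Longrightarrow> \<exists>m\<ge>6. (\<lambda>r. einstein_defect gr r y $ a $ b) \<in> O[at_right 0](\<lambda>r. r ^ m)" by blast+
qed

lemma defect_limit:
  assumes "(y, 0) \<in> \<Omega>"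
  shows "k < 4 \<Longrightarrow> ((\<lambda>r. einstein_defect gr r y $ a $ b / r ^ k) \<longlongrightarrow> 0) (at_right 0)"
    "CARD('n) \<noteq> 6 \<Longrightarrow> k < 6 \<Longrightarrow> ((\<lambda>r. einstein_defect gr r y $ a $ b / r ^ k) \<longlongrightarrow> 0) (at_right 0)"
proof -
  have *: "((\<lambda>r. einstein_defect gr r y $ a $ b / r ^ k) \<longlongrightarrow> 0) (at_right 0)"
    if m: "\<exists>m\<ge>l. (\<lambda>r. einstein_defect gr r y $ a $ b) \<in> O[at_right 0](\<lambda>r. r ^ m)" and k: "k < l" for l
  proof -
    obtain m where "l \<le> m" "(\<lambda>r. einstein_defect gr r y $ a $ b) \<in> O[at_right 0](\<lambda>r. r ^ m)"
      using m by blast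
    then show ?thesis using k by (intro bigo_power_quotient[where m = m]) auto
  qed
  show "k < 4 \<Longrightarrow> ((\<lambda>r. einstein_defect gr r y $ a $ b / r ^ k) \<longlongrightarrow> 0) (at_right 0)"
    "CARD('n) \<noteq> 6 \<Longrightarrow> k < 6 \<Longrightarrow> ((\<lambda>r. einstein_defect gr r y $ a $ b / r ^ k) \<longlongrightarrow> 0) (at_right 0)"
    using *[OF defect_bigo(1)[OF assms]] *[OF defect_bigo(2)[OF assms]] by auto
qed

lemma plus_point_in:
  assumes "(y, r) \<in> N"
  shows "plus_point r y \<in> plus_dom" "pt (plus_point r y) = (y, - r\<^sup>2 / 2)" "plus_point r y $ None = r"
proof -
  have "base (plus_point r y) = y" "plus_point r y $ None = r"
    by (simp_all add: base_def plus_point_def)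
  then show "plus_point r y \<in> plus_dom" "pt (plus_point r y) = (y, - r\<^sup>2 / 2)" "plus_point r y $ None = r"
    using assms by (simp_all add: plus_dom_def pt_def)
qed

lemma defect_nth:
  assumes "(y, r) \<in> N"
  shows "einstein_defect gr r y $ Some j $ Some k = tangential (y, - r\<^sup>2 / 2) $ j $ k"
    "einstein_defect gr r y $ None $ None = - (r\<^sup>2 / 2) * (ds theta (y, - r\<^sup>2 / 2)
      + trace (K (y, - r\<^sup>2 / 2) ** ds H (y, - r\<^sup>2 / 2) ** K (y, - r\<^sup>2 / 2) ** ds H (y, - r\<^sup>2 / 2)) / 2)"
    "einstein_defect gr r y $ None $ Some k = - (r / 2) * ((\<Sum>i\<in>UNIV. (K (y, - r\<^sup>2 / 2)
      ** nab i (ds H) (y, - r\<^sup>2 / 2)) $ i $ k) - dx k theta (y, - r\<^sup>2 / 2))"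
  using ricci_gp_tangential[OF plus_point_in(1)[OF assms]] ricci_gp_normal[OF plus_point_in(1)[OF assms]]
    ricci_gp_mixed[OF plus_point_in(1)[OF assms]]
  by (simp_all add: einstein_defect_def plus_point_in(2,3)[OF assms])

lemma derivative_parameter:
  fixes F :: "(real^'n) \<times> real \<Rightarrow> real"
  assumes "sm F" "(y, s) \<in> \<Omega>"
  shows "((\<lambda>s. F (y, s)) has_real_derivative ds F (y, s)) (at s)"
proof -
  have c: "((\<lambda>s. (y, s)) has_derivative (\<lambda>t. (0, t))) (at s)"
    by (auto intro!: derivative_eq_intros)
  have "((\<lambda>s. F (y, s)) has_derivative (\<lambda>t. ddir (0, t) F (y, s))) (at s)"
    by (rule has_derivative_compose[OF c has_derivative_ddir[OF sm_diff[OF assms]]])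
  moreover have "ddir (0, t) F (y, s) = ds F (y, s) * t" for t
    using ddir_scale_direction[OF sm_diff[OF assms], of t "(0, 1)"] by simp
  then have "(\<lambda>t. ddir (0, t) F (y, s)) = (*) (ds F (y, s))" by (rule ext)
  ultimately show ?thesis unfolding has_field_derivative_def by (simp only:)
qed

lemma vanish0:
  fixes F :: "(real^'n) \<times> real \<Rightarrow> real"
  assumes "sm F" "(y, 0) \<in> \<Omega>" "((\<lambda>r. f r / r ^ k) \<longlongrightarrow> 0) (at_right 0)"
    and "\<And>r. r \<noteq> 0 \<Longrightarrow> (y, r) \<in> N \<Longrightarrow> F (y, - r\<^sup>2 / 2) = c * (f r / r ^ k)"
  shows "F (y, 0) = 0"
proof (rule taylor0_vanishes[where F = "\<lambda>s. F (y, s)"])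
  show "isCont (\<lambda>s. F (y, s)) 0" by (rule DERIV_isCont[OF derivative_parameter[OF assms(1,2)]])
  have "((\<lambda>r. c * (f r / r ^ k)) \<longlongrightarrow> c * 0) (at_right 0)"
    by (intro tendsto_mult tendsto_const assms(3))
  moreover have "\<forall>\<^sub>F r in at_right 0. c * (f r / r ^ k) = F (y, - r\<^sup>2 / 2)"
    using near[OF assms(2)] eventually_at_right_less by eventually_elim (use assms(4) in auto)
  ultimately show "((\<lambda>r. F (y, - r\<^sup>2 / 2)) \<longlongrightarrow> 0) (at_right 0)"
    using tendsto_cong by fastforce
qed

lemma vanish1:
  fixes F :: "(real^'n) \<times> real \<Rightarrow> real"
  assumes "sm F" "(y, 0) \<in> \<Omega>" "F (y, 0) = 0" "((\<lambda>r. f r / r ^ (k + 2)) \<longlongrightarrow> 0) (at_right 0)"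
    and "\<And>r. r \<noteq> 0 \<Longrightarrow> (y, r) \<in> N \<Longrightarrow> F (y, - r\<^sup>2 / 2) = c * (f r / r ^ k)"
  shows "ds F (y, 0) = 0"
proof (rule taylor1_vanishes[where F = "\<lambda>s. F (y, s)"])
  show "((\<lambda>s. F (y, s)) has_real_derivative ds F (y, 0)) (at 0)"
    by (rule derivative_parameter[OF assms(1,2)])
  have "((\<lambda>r. c * (f r / r ^ (k + 2))) \<longlongrightarrow> c * 0) (at_right 0)"
    by (intro tendsto_mult tendsto_const assms(4))
  moreover have "\<forall>\<^sub>F r in at_right 0. c * (f r / r ^ (k + 2)) = F (y, - r\<^sup>2 / 2) / r\<^sup>2"
    using near[OF assms(2)] eventually_at_right_less
    by eventually_elim (use assms(5) in \<open>auto simp: field_simps power_add power2_eq_square\<close>)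
  ultimately show "((\<lambda>r. F (y, - r\<^sup>2 / 2) / r\<^sup>2) \<longlongrightarrow> 0) (at_right 0)"
    using tendsto_cong by fastforce
qed (rule assms(3))

lemma sm_tangential: "sm tangential"
  unfolding tangential_def[abs_def] divide_inverse
  by (intro sm_rules sm_Ric sm_theta sm_snd)

abbreviation "normal z \<equiv> ds theta z + trace (K z ** ds H z ** K z ** ds H z) / 2"

lemma sm_normal: "sm (\<lambda>z. normal z)"
  unfolding divide_inverse by (intro sm_rules sm_theta)

lemma tangential_vanishes:
  assumes y: "(y, 0) \<in> \<Omega>"
  shows "tangential (y, 0) = 0" "ds tangential (y, 0) = 0"
proof -
  have sm: "sm (\<lambda>z. tangential z $ j $ k)" for j k by (intro sm_rules sm_tangential)
  note lim = defect_limit(1)[OF y]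
  have 0: "tangential (y, 0) $ j $ k = 0" for j k
    by (rule vanish0[OF sm y lim[of 0 "Some j" "Some k"], where c = 1]) (simp_all add: defect_nth(1))
  have "ds (\<lambda>z. tangential z $ j $ k) (y, 0) = 0" for j k
    by (rule vanish1[OF sm y 0, where k = 0 and c = 1 and f = "\<lambda>r. einstein_defect gr r y $ Some j $ Some k"])
      (use lim[of 2] in \<open>simp_all add: defect_nth(1) power2_eq_square\<close>)
  then show "tangential (y, 0) = 0" "ds tangential (y, 0) = 0"
    using 0 by (auto intro!: matrix_eqI simp: D_entry[OF sm_tangential y])
qed

text \<open>The normal component of the defect carries a factor $r^2$, which costs one order in the parameter.\<close>

lemma normal_vanishes:
  assumes y: "(y, 0) \<in> \<Omega>"
  shows "normal (y, 0) = 0" "CARD('n) \<noteq> 6 \<Longrightarrow> ds (\<lambda>z. normal z) (y, 0) = 0"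
proof -
  have e: "normal (y, - r\<^sup>2 / 2) = - 2 * (einstein_defect gr r y $ None $ None / r\<^sup>2)" if "r \<noteq> 0" "(y, r) \<in> N" for r
    unfolding defect_nth(2)[OF that(2)] using that(1) by simp (simp add: field_simps)
  show 0: "normal (y, 0) = 0"
    using vanish0[OF sm_normal y defect_limit(1)[OF y, of 2] e] by simp
  show "ds (\<lambda>z. normal z) (y, 0) = 0" if "CARD('n) \<noteq> 6"
    using vanish1[OF sm_normal y 0 _ e] defect_limit(2)[OF y that, of "2 + 2"] by simp
qed

lemma divergence_eq:
  assumes y: "(y, 0) \<in> \<Omega>"
  shows "(\<Sum>i\<in>UNIV. (K (y, 0) ** nab i (ds H) (y, 0)) $ i $ k) = dx k theta (y, 0)"
proof -
  let ?F = "\<lambda>z. (\<Sum>i\<in>UNIV. (K z ** nab i (ds H) z) $ i $ k) - dx k theta z"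
  have "sm ?F" by (intro sm_rules sm_nab sm_theta)
  moreover have "?F (y, - r\<^sup>2 / 2) = - 2 * (einstein_defect gr r y $ None $ Some k / r ^ 1)"
    if "r \<noteq> 0" "(y, r) \<in> N" for r
    unfolding defect_nth(3)[OF that(2)] using that(1) by simp (simp add: field_simps)
  ultimately have "?F (y, 0) = 0"
    by (intro vanish0[where F = ?F and c = "- 2", OF _ y defect_limit(1)[OF y, of 1 None "Some k"]]) auto
  then show ?thesis by simp
qed

lemma Ric_boundary:
  assumes y: "(y, 0) \<in> \<Omega>"
  shows "Ric (y, 0) = ((real CARD('n) - 2) / 2) *\<^sub>R ds H (y, 0) + (theta (y, 0) / 2) *\<^sub>R H (y, 0)"
  using tangential_vanishes(1)[OF y] by (simp add: tangential_def algebra_simps diff_divide_distrib)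

lemma ds_Ric_boundary:
  assumes y: "(y, 0) \<in> \<Omega>"
  shows "ds Ric (y, 0) = (real CARD('n) / 2 - 2) *\<^sub>R ds (ds H) (y, 0) + (ds theta (y, 0) / 2) *\<^sub>R H (y, 0)
    + ds H (y, 0) ** K (y, 0) ** ds H (y, 0)"
proof -
  let ?R = "\<lambda>z. ds (ds H) z + (theta z / 2) *\<^sub>R ds H z - ds H z ** K z ** ds H z"
  have smR: "sm ?R" unfolding divide_inverse by (intro sm_rules sm_theta)
  have t: "sm (\<lambda>z. theta z / 2)" unfolding divide_inverse by (intro sm_rules sm_theta)
  have D_scaleR: "ddir v (\<lambda>z. f z *\<^sub>R F z) (y, 0) = f (y, 0) *\<^sub>R ddir v F (y, 0) + ddir v f (y, 0) *\<^sub>R F (y, 0)"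
    if "sm f" "sm F" for v f and F :: "(real^'n) \<times> real \<Rightarrow> real^'n^'n"
    by (rule ddir_bounded_bilinear[OF bounded_bilinear_scaleR sm_diff[OF that(1) y] sm_diff[OF that(2) y]])
  have th: "ds (\<lambda>z. theta z / 2) (y, 0) = ds theta (y, 0) / 2"
    using ddir_cmult[OF sm_diff[OF sm_theta y], of "(0, 1)" "1 / 2"] by simp
  have sn: "ds snd (y, 0 :: real) = (1 :: real)"
    by (simp add: ddir_unique[OF bounded_linear_imp_has_derivative[OF bounded_linear_snd]])
  have "0 = ds tangential (y, 0)" using tangential_vanishes(2)[OF y] by simp
  also have "\<dots> = ds Ric (y, 0) - (real CARD('n) / 2 - 1) *\<^sub>R ds (ds H) (y, 0)
      - ((theta (y, 0) / 2) *\<^sub>R ds H (y, 0) + (ds theta (y, 0) / 2) *\<^sub>R H (y, 0)) + ?R (y, 0)"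
    unfolding tangential_def[abs_def]
    using D_scaleR[OF sm_snd smR, of "(0, 1)"] D_scaleR[OF t smooth_H, of "(0, 1)"] y
      smooth_on_bilinear[OF bounded_bilinear_scaleR open_\<Omega> sm_snd smR]
      smooth_on_bilinear[OF bounded_bilinear_scaleR open_\<Omega> t smooth_H]
    by (simp add: D_add D_diff D_scaleR_const sm_rules sm_Ric th sn)
  finally have "ds Ric (y, 0) = (real CARD('n) / 2 - 1) *\<^sub>R ds (ds H) (y, 0)
      + ((theta (y, 0) / 2) *\<^sub>R ds H (y, 0) + (ds theta (y, 0) / 2) *\<^sub>R H (y, 0)) - ?R (y, 0)"
    by (simp add: algebra_simps)
  also have "\<dots> = (real CARD('n) / 2 - 2) *\<^sub>R ds (ds H) (y, 0) + (ds theta (y, 0) / 2) *\<^sub>R H (y, 0)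
    + ds H (y, 0) ** K (y, 0) ** ds H (y, 0)"
    by (simp add: vec_eq_iff algebra_simps)
  finally show ?thesis .
qed

lemma schouten_scalar_boundary:
  assumes y: "(y, 0) \<in> \<Omega>"
  shows "schouten_scalar G y = theta (y, 0) / 2"
proof -
  have "scal G y = trace (K (y, 0) ** transpose (Ric (y, 0)))"
    by (simp add: scal_def ricci_eq[OF y G] christoffel_eq(2)[OF y G] trace_mul)
  also have "\<dots> = (real CARD('n) - 1) * theta (y, 0)"
    using y by (simp add: Ric_boundary[OF y] transpose_simps matrix_mul_simps trace_simps trace_I
        flip: theta_def) (simp add: field_simps)
  finally show ?thesis using dim by (simp add: schouten_scalar_def field_simps)
qed

lemma schouten_boundary:
  assumes y: "(y, 0) \<in> \<Omega>"
  shows "schouten G y = (1/2) *\<^sub>R ds H (y, 0)"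
  using dim by (simp add: schouten_def ricci_eq[OF y G] schouten_scalar_boundary[OF y] G[OF y]
      Ric_boundary[OF y])

text \<open>The first order of the tangential equation, with the variation of the Ricci tensor expressed by the
  Bach tensor. For $n = 4$ the coefficient of the second derivative would vanish.\<close>

lemma bach_boundary:
  assumes y: "(y, 0) \<in> \<Omega>"
  shows "bach G y = ((real CARD('n) - 4) / 4) *\<^sub>R (ds H (y, 0) ** K (y, 0) ** ds H (y, 0))
    - ((real CARD('n) - 4) / 2) *\<^sub>R ds (ds H) (y, 0)"
proof -
  have "ds theta (y, 0) = - trace (K (y, 0) ** ds H (y, 0) ** K (y, 0) ** ds H (y, 0)) / 2"
    using normal_vanishes(1)[OF y] by simp
  moreover have "bach G y = (real CARD('n) / 4) *\<^sub>R (ds H (y, 0) ** K (y, 0) ** ds H (y, 0))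
    - (trace (K (y, 0) ** ds H (y, 0) ** K (y, 0) ** ds H (y, 0)) / 4) *\<^sub>R H (y, 0) - ds Ric (y, 0)"
    using ds_Ric_eq_bach[OF y G schouten_boundary divergence_eq Ric_boundary[OF y]]
    by (simp add: algebra_simps)
  ultimately show ?thesis
    by (simp add: ds_Ric_boundary[OF y]) (simp add: vec_eq_iff field_simps)
qed

end

section \<open>The ambient Laplacian on homogeneous functions\<close>

context family_of_metrics
begin

text \<open>Divergence form operators at a fixed parameter: \<open>div_op Q f\<close> is the divergence of the
  vector field $Q^{ij} \partial_j f$ and \<open>grad_inner Q\<close> is the symbol of \<open>div_op Q\<close>.\<close>

definition divergence :: "('n \<Rightarrow> (real^'n) \<times> real \<Rightarrow> real) \<Rightarrow> (real^'n) \<times> real \<Rightarrow> real" where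
  "divergence V z = (\<Sum>i\<in>UNIV. dx i (V i) z + trace (Gam i z) * V i z)"

definition div_op :: "((real^'n) \<times> real \<Rightarrow> real^'n^'n) \<Rightarrow> ((real^'n) \<times> real \<Rightarrow> real) \<Rightarrow> (real^'n) \<times> real \<Rightarrow> real" where
  "div_op Q f = divergence (\<lambda>i z. \<Sum>j\<in>UNIV. Q z $ i $ j * dx j f z)"

definition grad_inner :: "((real^'n) \<times> real \<Rightarrow> real^'n^'n) \<Rightarrow> ((real^'n) \<times> real \<Rightarrow> real) \<Rightarrow>
    ((real^'n) \<times> real \<Rightarrow> real) \<Rightarrow> (real^'n) \<times> real \<Rightarrow> real" where
  "grad_inner Q f g z = (\<Sum>i\<in>UNIV. dx i f z * (\<Sum>j\<in>UNIV. Q z $ i $ j * dx j g z))"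

abbreviation "Lap \<equiv> div_op K"

lemma sm_divergence: "(\<And>i. sm (V i)) \<Longrightarrow> sm (divergence V)"
  unfolding divergence_def[abs_def] by (intro sm_rules)

lemma sm_div_op: "sm Q \<Longrightarrow> sm f \<Longrightarrow> sm (div_op Q f)"
  unfolding div_op_def by (intro sm_divergence sm_rules)

lemma sm_grad_inner: "sm Q \<Longrightarrow> sm f \<Longrightarrow> sm g \<Longrightarrow> sm (grad_inner Q f g)"
  unfolding grad_inner_def[abs_def] by (intro sm_rules)

text \<open>The derivative of the volume density has become the trace of the connection.\<close>

lemma codiff_slice:
  assumes z: "(y, s) \<in> \<Omega>" and G: "\<And>y. (y, s) \<in> \<Omega> \<Longrightarrow> G y = H (y, s)"
    and V: "\<And>i. sm (V i)" "\<And>y i. (y, s) \<in> \<Omega> \<Longrightarrow> (ginv G y *v \<omega> y) $ i = V i (y, s)"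
  shows "codiff G \<omega> y = - divergence V (y, s)"
proof -
  have "codiff G \<omega> y = - (\<Sum>i\<in>UNIV. pd i (\<lambda>y. (ginv G y *v \<omega> y) $ i) y
      + trace (ginv G y ** ddir (axis i 1) G y) / 2 * (ginv G y *v \<omega> y) $ i)"
  proof (rule codiff_eq)
    show "G differentiable (at y)" by (rule ddir_slice(2)[OF smooth_H z G])
    show "det (G y) \<noteq> 0" using det_H[OF z] G[OF z] by simp
    show "(\<lambda>y. (ginv G y *v \<omega> y) $ i) differentiable (at y)" for i
      by (rule ddir_slice(2)[OF V(1) z V(2)])
  qed
  moreover have "pd i (\<lambda>y. (ginv G y *v \<omega> y) $ i) y = dx i (V i) (y, s)" for i
    by (rule pd_slice[OF V(1) z V(2)])
  moreover have "trace (ginv G y ** ddir (axis i 1) G y) / 2 = trace (Gam i (y, s))" for i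
    by (simp add: trace_Gam[OF z] christoffel_eq(2)[OF z G] ddir_slice(1)[OF smooth_H z G])
  ultimately show ?thesis by (simp add: divergence_def V(2)[OF z])
qed

lemma codiff_eq_div_op:
  assumes z: "(y, s) \<in> \<Omega>" and G: "\<And>y. (y, s) \<in> \<Omega> \<Longrightarrow> G y = H (y, s)"
    and Q: "sm Q" "\<And>y. (y, s) \<in> \<Omega> \<Longrightarrow> K (y, s) ** T y = Q (y, s)"
    and f: "sm F" "\<And>y. (y, s) \<in> \<Omega> \<Longrightarrow> f y = F (y, s)"
  shows "codiff G (\<lambda>y. T y *v differential f y) y = - div_op Q F (y, s)"
  unfolding div_op_def
proof (rule codiff_slice[OF z G])
  show "sm (\<lambda>z. \<Sum>j\<in>UNIV. Q z $ i $ j * dx j F z)" for i by (intro sm_rules Q f)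
  show "(ginv G y *v (T y *v differential f y)) $ i = (\<Sum>j\<in>UNIV. Q (y, s) $ i $ j * dx j F (y, s))"
    if y: "(y, s) \<in> \<Omega>" for y i
    by (simp add: christoffel_eq(2)[OF y G] matrix_vector_mul_assoc Q(2)[OF y] matrix_vector_nth
        differential_def pd_slice[OF f(1) y f(2)])
qed

lemma laplacian_eq_Lap:
  assumes z: "(y, s) \<in> \<Omega>" and G: "\<And>y. (y, s) \<in> \<Omega> \<Longrightarrow> G y = H (y, s)"
    and f: "sm F" "\<And>y. (y, s) \<in> \<Omega> \<Longrightarrow> f y = F (y, s)"
  shows "laplacian G f y = Lap F (y, s)"
  using codiff_eq_div_op[OF z G sm_K _ f, of "\<lambda>_. mat 1"] by (simp add: laplacian_def)

text \<open>The operator induced by the ambient Laplacian on functions homogeneous of degree \<open>w\<close>.\<close>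

definition amb :: "real \<Rightarrow> ((real^'n) \<times> real \<Rightarrow> real) \<Rightarrow> (real^'n) \<times> real \<Rightarrow> real" where
  "amb w f z = Lap f z - 2 * snd z * ds (ds f) z
    + (2 * w + real CARD('n) - 2 - snd z * theta z) * ds f z + w / 2 * (theta z * f z)"

lemma sm_amb: "sm f \<Longrightarrow> sm (amb w f)"
  unfolding amb_def[abs_def] by (intro sm_rules sm_div_op sm_theta sm_snd)

end

lemma option_option_induct [case_names None SomeNone SomeSome]:
  "P None \<Longrightarrow> P (Some None) \<Longrightarrow> (\<And>i. P (Some (Some i))) \<Longrightarrow> P a"
  by (metis not_Some_eq)

locale ambient = family_of_metrics \<Omega> H
  for \<Omega> :: "((real^'n::finite) \<times> real) set" and H +
  fixes h :: "real \<Rightarrow> real^'n \<Rightarrow> real^'n^'n"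
  assumes h: "\<And>y \<rho>. (y, \<rho>) \<in> \<Omega> \<Longrightarrow> h \<rho> y = H (y, \<rho>)"
begin

definition apt :: "real^'n option option \<Rightarrow> (real^'n) \<times> real" where
  "apt z = ((\<chi> i. z $ Some (Some i)), z $ Some None)"

definition amb_dom :: "(real^'n option option) set" where "amb_dom = {z. z $ None > 0 \<and> apt z \<in> \<Omega>}"

lemma bounded_linear_apt: "bounded_linear apt"
  unfolding linear_conv_bounded_linear[symmetric] linear_iff by (simp add: apt_def vec_eq_iff)

lemma open_amb_dom: "open amb_dom"
proof -
  have "open {z :: real^'n option option. z $ None > 0}"
    by (intro open_Collect_less continuous_intros)
  moreover have "open (apt -` \<Omega>)"
    by (rule open_vimage[OF open_\<Omega> linear_continuous_on[OF bounded_linear_apt]])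
  moreover have "amb_dom = {z. z $ None > 0} \<inter> apt -` \<Omega>" by (auto simp: amb_dom_def)
  ultimately show ?thesis by (simp add: open_Int)
qed

text \<open>The components of the ambient metric, and the fluxes below, are products of a function of \<open>t\<close> and
  a function of the point \<open>apt z\<close> of \<open>\<Omega>\<close>.\<close>

lemma pd_ambient:
  fixes F :: "(real^'n) \<times> real \<Rightarrow> real"
  assumes z: "z \<in> amb_dom" and f: "\<And>z. z \<in> amb_dom \<Longrightarrow> f z = \<phi> (z $ None) * F (apt z)"
    and F: "sm F" and \<phi>: "(\<phi> has_real_derivative \<phi>') (at (z $ None))"
  shows "pd None f z = \<phi>' * F (apt z)" "pd (Some None) f z = \<phi> (z $ None) * ds F (apt z)" (is ?P1)
    "pd (Some (Some i)) f z = \<phi> (z $ None) * dx i F (apt z)" (is ?P2) "f differentiable (at z)"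
proof -
  have dF: "F differentiable (at (apt z))" using z sm_diff[OF F] by (simp add: amb_dom_def)
  have r: "((\<lambda>z. z $ None) has_derivative (\<lambda>v. v $ None)) (at z)"
    by (rule bounded_linear_imp_has_derivative) (rule bounded_linear_vec_nth)
  have 1: "((\<lambda>z. \<phi> (z $ None) * F (apt z)) has_derivative (\<lambda>v. \<phi> (z $ None)
      * ddir (apt v) F (apt z) + (v $ None * \<phi>') * F (apt z))) (at z)"
    using has_derivative_mult[OF has_derivative_compose[OF r \<phi>[unfolded has_field_derivative_def]]
        has_derivative_compose[OF bounded_linear_imp_has_derivative[OF bounded_linear_apt] has_derivative_ddir[OF dF]]]
    by (simp add: mult.commute)
  note c = ddir_cong[OF open_amb_dom z f]
  show "f differentiable (at z)"
    using c(2) differentiableI[OF 1] by simp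
  have 2: "ddir v f z = \<phi> (z $ None) * ddir (apt v) F (apt z) + v $ None * \<phi>' * F (apt z)" for v
    using c(1) ddir_unique[OF 1] by simp
  have b: "apt (axis None 1) = (0, 0)" "apt (axis (Some None) 1) = (0, 1)" "apt (axis (Some (Some i)) 1) = (axis i 1, 0)"
    by (auto simp: apt_def axis_def vec_eq_iff)
  have "ddir (0, 0) F (apt z) = 0"
    using ddir_scale_direction[OF dF, of 0 "(0, 0)"] by simp
  then show "pd None f z = \<phi>' * F (apt z)" by (simp add: pd_eq_ddir 2 b)
  show ?P1 ?P2
    by (simp add: pd_eq_ddir 2 b, simp add: axis_def)+
qed

abbreviation "ga \<equiv> ambient_metric h"

lemma sum_option_option: "(\<Sum>a\<in>UNIV. f a) = f None + (f (Some None) + (\<Sum>i\<in>UNIV. f (Some (Some i))))"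
  for f :: "'n option option \<Rightarrow> real"
  by (simp add: sum_option)

lemma ga_nth:
  assumes "z \<in> amb_dom"
  shows "ga z $ None $ None = 2 * snd (apt z)" "ga z $ None $ Some None = z $ None"
    "ga z $ Some None $ None = z $ None" "ga z $ Some None $ Some None = 0"
    "ga z $ None $ Some (Some i) = 0" "ga z $ Some (Some i) $ None = 0"
    "ga z $ Some None $ Some (Some i) = 0" "ga z $ Some (Some i) $ Some None = 0"
    "ga z $ Some (Some i) $ Some (Some j) = (z $ None)\<^sup>2 * H (apt z) $ i $ j"
  using h[of "\<chi> i. z $ Some (Some i)" "z $ Some None"] assms
  by (simp_all add: ambient_metric_def Let_def amb_dom_def apt_def)

lemma ga_inv:
  assumes z: "z \<in> amb_dom"
  shows "ginv ga z $ None $ None = 0" "ginv ga z $ None $ Some None = 1 / z $ None"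
    "ginv ga z $ Some None $ None = 1 / z $ None" (is ?P1) "ginv ga z $ Some None $ Some None = - 2 * snd (apt z) / (z $ None)\<^sup>2"
    "ginv ga z $ None $ Some (Some i) = 0" "ginv ga z $ Some (Some i) $ None = 0"
    "ginv ga z $ Some None $ Some (Some i) = 0" "ginv ga z $ Some (Some i) $ Some None = 0"
    "ginv ga z $ Some (Some i) $ Some (Some j) = 1 / (z $ None)\<^sup>2 * K (apt z) $ i $ j" (is ?P2)
    "det (ga z) \<noteq> 0"
proof -
  have t: "z $ None \<noteq> 0" and p: "apt z \<in> \<Omega>" using z by (auto simp: amb_dom_def)
  let ?t = "z $ None"
  define B :: "real^'n option option^'n option option" where "B = (\<chi> a b. case (a, b) of
      (None, None) \<Rightarrow> 0 | (None, Some None) \<Rightarrow> 1 / ?t | (Some None, None) \<Rightarrow> 1 / ?t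
    | (Some None, Some None) \<Rightarrow> - 2 * snd (apt z) / ?t\<^sup>2
    | (Some (Some i), Some (Some j)) \<Rightarrow> 1 / ?t\<^sup>2 * K (apt z) $ i $ j | _ \<Rightarrow> 0)"
  have B: "B $ None $ None = 0" "B $ None $ Some None = 1 / ?t" "B $ Some None $ None = 1 / ?t"
    "B $ Some None $ Some None = - 2 * snd (apt z) / ?t\<^sup>2"
    "B $ None $ Some (Some i) = 0" "B $ Some (Some i) $ None = 0"
    "B $ Some None $ Some (Some i) = 0" "B $ Some (Some i) $ Some None = 0"
    "B $ Some (Some i) $ Some (Some j) = 1 / ?t\<^sup>2 * K (apt z) $ i $ j" for i j
    by (simp_all add: B_def)
  have HK': "(\<Sum>k\<in>UNIV. H (apt z) $ i $ k * K (apt z) $ k $ j) = (if i = j then 1 else 0)" for i j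
    by (simp only: matrix_mul_nth[symmetric] HK(1)[OF p] mat_nth)
  have "ga z ** B = mat 1"
  proof (rule matrix_eqI)
    fix a b :: "'n option option"
    show "(ga z ** B) $ a $ b = mat 1 $ a $ b"
      using t by (induct a rule: option_option_induct; induct b rule: option_option_induct)
        (simp_all add: matrix_mul_nth sum_option_option B ga_nth[OF z] mat_nth HK' power2_eq_square)
  qed
  note u = matrix_inv_unique[OF this]
  have "ginv ga z = B" unfolding ginv_def by (rule u(1))
  then show "ginv ga z $ None $ None = 0" "ginv ga z $ None $ Some None = 1 / z $ None"
    ?P1 "ginv ga z $ Some None $ Some None = - 2 * snd (apt z) / (z $ None)\<^sup>2"
    "ginv ga z $ None $ Some (Some i) = 0" "ginv ga z $ Some (Some i) $ None = 0"
    "ginv ga z $ Some None $ Some (Some i) = 0" "ginv ga z $ Some (Some i) $ Some None = 0"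
    ?P2
    by (simp_all add: B)
  show "det (ga z) \<noteq> 0" by (rule u(2))
qed

lemma pd_ga:
  assumes z: "z \<in> amb_dom"
  shows "pd None (\<lambda>z. ga z $ None $ None) z = 0" (is ?P1) "pd (Some None) (\<lambda>z. ga z $ None $ None) z = 2"
    "pd (Some (Some i)) (\<lambda>z. ga z $ None $ None) z = 0" (is ?P2)
    "pd None (\<lambda>z. ga z $ None $ Some None) z = 1" (is ?P3) "pd (Some b) (\<lambda>z. ga z $ None $ Some None) z = 0"
    "pd None (\<lambda>z. ga z $ Some None $ None) z = 1" (is ?P4) "pd (Some b) (\<lambda>z. ga z $ Some None $ None) z = 0"
    "pd None (\<lambda>z. ga z $ Some (Some k) $ Some (Some l)) z = 2 * z $ None * H (apt z) $ k $ l" (is ?P5)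
    "pd (Some None) (\<lambda>z. ga z $ Some (Some k) $ Some (Some l)) z = (z $ None)\<^sup>2 * ds H (apt z) $ k $ l" (is ?P6)
    "pd (Some (Some i)) (\<lambda>z. ga z $ Some (Some k) $ Some (Some l)) z = (z $ None)\<^sup>2 * dx i H (apt z) $ k $ l" (is ?P7)
    "pd None (\<lambda>z. ga z $ Some None $ Some None) z = 0" (is ?P8)
    "pd (Some b) (\<lambda>z. ga z $ Some None $ Some None) z = 0" (is ?P9)
    "ga differentiable (at z)"
proof -
  have p: "apt z \<in> \<Omega>" using z by (simp add: amb_dom_def)
  have d: "((\<lambda>t. 1) has_real_derivative 0) (at (z $ None))" "((\<lambda>t. t) has_real_derivative 1) (at (z $ None))"
    "((\<lambda>t. t\<^sup>2) has_real_derivative 2 * z $ None) (at (z $ None))"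
    by (auto intro!: derivative_eq_intros)
  have sn: "ddir v (\<lambda>z. 2 * snd z) (apt z) = 2 * snd v" for v :: "(real^'n) \<times> real"
    using ddir_cmult[OF sm_diff[OF sm_snd p], of v 2]
    by (simp add: ddir_unique[OF bounded_linear_imp_has_derivative[OF bounded_linear_snd]])
  have plus_dom: "sm (\<lambda>z. 2 * snd z)" by (intro sm_rules sm_snd)
  note 1 = pd_ambient[OF z _ plus_dom d(1), of "\<lambda>z. ga z $ None $ None"]
  show ?P1 "pd (Some None) (\<lambda>z. ga z $ None $ None) z = 2"
    ?P2
    using 1 by (simp_all add: ga_nth sn)
  note 2 = pd_ambient[OF z _ sm_rules(1) d(2), of "\<lambda>z. ga z $ None $ Some None" 1]
    pd_ambient[OF z _ sm_rules(1) d(2), of "\<lambda>z. ga z $ Some None $ None" 1]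
  show ?P3 "pd (Some b) (\<lambda>z. ga z $ None $ Some None) z = 0"
    ?P4 "pd (Some b) (\<lambda>z. ga z $ Some None $ None) z = 0"
    using 2 by (cases b, simp_all add: ga_nth)+
  note 3 = pd_ambient[OF z _ sm_rules(9)[OF smooth_H] d(3), of "\<lambda>z. ga z $ Some (Some k) $ Some (Some l)" k l for k l]
  show ?P5 ?P6 ?P7
    using 3(1-3) by (simp_all add: ga_nth D_entry[OF smooth_H p])
  show ?P8 ?P9
    using pd_ambient[OF z _ sm_rules(1) d(1), of "\<lambda>z. ga z $ Some None $ Some None" 0]
    by (cases b, simp_all add: ga_nth)+
  have 0: "f differentiable (at z)" if "\<And>z. z \<in> amb_dom \<Longrightarrow> f z = 0" for f :: "real^'n option option \<Rightarrow> real"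
    by (rule pd_ambient(4)[OF z _ sm_rules(1) d(1), of _ 0]) (simp add: that)
  have nz: "(\<lambda>z. ga z $ None $ None) differentiable (at z)"
    "(\<lambda>z. ga z $ None $ Some None) differentiable (at z)"
    "(\<lambda>z. ga z $ Some None $ None) differentiable (at z)"
    "(\<lambda>z. ga z $ Some (Some k) $ Some (Some l)) differentiable (at z)" for k l
    by (rule 1(4) 2(4,8) 3(4), simp add: ga_nth)+
  show "ga differentiable (at z)"
  proof (rule differentiable_matrixI)
    fix a b :: "'n option option"
    show "(\<lambda>z. ga z $ a $ b) differentiable (at z)"
      by (induct a rule: option_option_induct; induct b rule: option_option_induct)
        ((rule nz | rule 0, simp add: ga_nth; fail)+)
  qed
qed

lemma trace_connection_ga:
  assumes z: "z \<in> amb_dom"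
  shows "trace (ginv ga z ** ddir (axis None 1) ga z) / 2 = (real CARD('n) + 1) / z $ None" (is ?P1)
    "trace (ginv ga z ** ddir (axis (Some None) 1) ga z) / 2 = theta (apt z) / 2" (is ?P2)
    "trace (ginv ga z ** ddir (axis (Some (Some i)) 1) ga z) / 2 = trace (Gam i (apt z))" (is ?P3)
proof -
  have t: "z $ None \<noteq> 0" and p: "apt z \<in> \<Omega>" using z by (auto simp: amb_dom_def)
  have e: "ddir v ga z $ a $ b = ddir v (\<lambda>z. ga z $ a $ b) z" for v a b
    by (rule ddir_entry[OF pd_ga(13)[OF z], symmetric])
  have tr: "(\<Sum>k\<in>UNIV. \<Sum>l\<in>UNIV. K (apt z) $ k $ l * X $ l $ k) = trace (K (apt z) ** X)" for X
    by (simp add: trace_mul)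
  note s = trace_mul sum_option_option ga_inv[OF z] e pd_eq_ddir[symmetric] pd_ga(1-12)[OF z]
  have "trace (ginv ga z ** ddir (axis None 1) ga z) / 2 = 1 / z $ None
      + 1 / z $ None * (\<Sum>k\<in>UNIV. \<Sum>l\<in>UNIV. K (apt z) $ k $ l * H (apt z) $ l $ k)"
    using t by (simp add: s sum_distrib_left sum_divide_distrib field_simps power2_eq_square)
  then show ?P1
    using p by (simp add: tr trace_I add_divide_distrib)
  show ?P2
    using t by (simp add: s theta_def)
  show ?P3
    using t by (simp add: s trace_Gam[OF p])
qed

lemma ambient_laplacian:
  assumes z: "z \<in> amb_dom" and f: "sm f"
    and F: "\<And>z. z \<in> amb_dom \<Longrightarrow> F z = z $ None powr w * f (apt z)"
  shows "laplacian ga F z = z $ None powr (w - 2) * amb w f (apt z)"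
proof -
  have t: "z $ None > 0" and p: "apt z \<in> \<Omega>" using z by (auto simp: amb_dom_def)
  let ?t = "z $ None"
  have d: "((\<lambda>t. t powr a) has_real_derivative a * t powr (a - 1)) (at t)" if "t > 0" for a t :: real
    using has_real_derivative_powr[OF that, of a] .
  have dF: "differential F z $ None = w * z $ None powr (w - 1) * f (apt z)"
    "differential F z $ Some None = z $ None powr w * ds f (apt z)"
    "differential F z $ Some (Some i) = z $ None powr w * dx i f (apt z)" if "z \<in> amb_dom" for z i
    using pd_ambient(1-3)[OF that F f d] that by (simp_all add: differential_def amb_dom_def)
  \<comment> \<open>The component of the gradient in the direction of the parameter is \<open>t powr (w - 2) * q\<close>.\<close>
  define q where "q z = w * f z - 2 * snd z * ds f z" for z
  have smq: "sm q" unfolding q_def[abs_def] by (intro sm_rules sm_snd f)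
  have smV: "sm (\<lambda>z. \<Sum>j\<in>UNIV. K z $ i $ j * dx j f z)" for i by (intro sm_rules f)
  let ?V = "\<lambda>z. ginv ga z *v differential F z"
  have V: "?V z $ None = z $ None powr (w - 1) * ds f (apt z)"
    "?V z $ Some None = z $ None powr (w - 2) * q (apt z)"
    "?V z $ Some (Some i) = z $ None powr (w - 2) * (\<Sum>j\<in>UNIV. K (apt z) $ i $ j * dx j f (apt z))"
    if "z \<in> amb_dom" for z i
  proof -
    have t: "z $ None > 0" using that by (simp add: amb_dom_def)
    have pw: "z $ None powr (w - 1) = z $ None powr w / z $ None"
      "z $ None powr (w - 2) = z $ None powr w / (z $ None)\<^sup>2"
      using t by (simp_all add: powr_diff powr_numeral)
    show "?V z $ None = z $ None powr (w - 1) * ds f (apt z)"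
      "?V z $ Some None = z $ None powr (w - 2) * q (apt z)"
      "?V z $ Some (Some i) = z $ None powr (w - 2) * (\<Sum>j\<in>UNIV. K (apt z) $ i $ j * dx j f (apt z))"
      using t by (simp_all add: matrix_vector_nth sum_option_option ga_inv[OF that] dF[OF that] q_def pw)
        (simp_all add: field_simps power2_eq_square sum_distrib_left sum_divide_distrib)
  qed
  have V': "pd None (\<lambda>z. ?V z $ None) z = (w - 1) * ?t powr (w - 1 - 1) * ds f (apt z)"
    "(\<lambda>z. ?V z $ None) differentiable (at z)"
    by (rule pd_ambient(1,4)[OF z V(1) smooth_on_ddir[OF open_\<Omega> f] d[OF t]]; assumption)+
  have W': "pd (Some None) (\<lambda>z. ?V z $ Some None) z = ?t powr (w - 2) * ds q (apt z)"
    "(\<lambda>z. ?V z $ Some None) differentiable (at z)"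
    by (rule pd_ambient(2,4)[OF z V(2) smq d[OF t]]; assumption)+
  have V'': "pd (Some (Some i)) (\<lambda>z. ?V z $ Some (Some i)) z
      = ?t powr (w - 2) * dx i (\<lambda>z. \<Sum>j\<in>UNIV. K z $ i $ j * dx j f z) (apt z)"
    "(\<lambda>z. ?V z $ Some (Some i)) differentiable (at z)" for i
    by (rule pd_ambient(3,4)[OF z V(3) smV d[OF t]]; assumption)+
  have "codiff ga (differential F) z = - (\<Sum>i\<in>UNIV. pd i (\<lambda>z. ?V z $ i) z
      + trace (ginv ga z ** ddir (axis i 1) ga z) / 2 * ?V z $ i)"
  proof (rule codiff_eq[OF pd_ga(13)[OF z] ga_inv(10)[OF z]])
    fix a :: "'n option option"
    show "(\<lambda>z. ?V z $ a) differentiable (at z)"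
      by (induct a rule: option_option_induct) (rule V'(2), rule W'(2), rule V''(2))
  qed
  note cod = this
  have "laplacian ga F z = (w - 1) * ?t powr (w - 1 - 1) * ds f (apt z)
      + (real CARD('n) + 1) / ?t * (?t powr (w - 1) * ds f (apt z))
      + (?t powr (w - 2) * ds q (apt z) + theta (apt z) / 2 * (?t powr (w - 2) * q (apt z)))
      + ?t powr (w - 2) * Lap f (apt z)"
    unfolding laplacian_def cod sum_option_option V'(1) W'(1) V''(1) trace_connection_ga[OF z] V[OF z]
    by (simp add: div_op_def divergence_def sum_distrib_left algebra_simps)
  also have "ds q (apt z) = (w - 2) * ds f (apt z) - 2 * snd (apt z) * ds (ds f) (apt z)"
  proof -
    have "ds snd (apt z) = (1 :: real)"
      by (simp add: ddir_unique[OF bounded_linear_imp_has_derivative[OF bounded_linear_snd]])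
    then show ?thesis
      unfolding q_def[abs_def] using p f
      by (simp add: D_diff D_mult sm_rules sm_snd) (simp add: algebra_simps)
  qed
  also have "(real CARD('n) + 1) / ?t * (?t powr (w - 1) * ds f (apt z))
      = ?t powr (w - 2) * ((real CARD('n) + 1) * ds f (apt z))"
    using t by (simp add: powr_diff powr_numeral power2_eq_square)
  finally show ?thesis
    by (simp add: amb_def q_def field_simps)
qed

lemma gjms_eq_amb:
  assumes y: "(y, 0) \<in> \<Omega>" and f: "sm (\<lambda>(y, s). U y s)"
  shows "gjms 3 h U y = amb (- 1 - real CARD('n) / 2) (amb (1 - real CARD('n) / 2)
    (amb (3 - real CARD('n) / 2) (\<lambda>(y, s). U y s))) (y, 0)"
proof -
  let ?w = "3 - real CARD('n) / 2"
  let ?f = "\<lambda>(y, s). U y s"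
  define F where "F z = (z $ None) powr ?w * U (\<chi> i. z $ Some (Some i)) (z $ Some None)" for z :: "real^'n option option"
  have p: "ambient_point 1 0 y \<in> amb_dom" "apt (ambient_point 1 0 y) = (y, 0)" "ambient_point 1 0 y $ None = 1"
  proof -
    show "apt (ambient_point 1 0 y) = (y, 0)" "ambient_point 1 0 y $ None = 1"
      by (simp_all add: apt_def ambient_point_def)
    then show "ambient_point 1 0 y \<in> amb_dom" using y by (simp add: amb_dom_def)
  qed
  have 0: "F z = z $ None powr ?w * ?f (apt z)" for z by (simp add: F_def apt_def)
  have 1: "laplacian ga F z = z $ None powr (?w - 2) * amb ?w ?f (apt z)" if "z \<in> amb_dom" for z
    by (rule ambient_laplacian[OF that f 0])
  have 2: "laplacian ga (laplacian ga F) z = z $ None powr (?w - 2 - 2) * amb (?w - 2) (amb ?w ?f) (apt z)" if "z \<in> amb_dom" for z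
    by (rule ambient_laplacian[OF that sm_amb[OF f] 1])
  have "laplacian ga (laplacian ga (laplacian ga F)) (ambient_point 1 0 y) = amb (?w - 2 - 2) (amb (?w - 2) (amb ?w ?f)) (y, 0)"
    using ambient_laplacian[OF p(1) sm_amb[OF sm_amb[OF f]] 2] p(2,3) by simp
  then show ?thesis
    by (simp add: gjms_def F_def[abs_def] numeral_3_eq_3)
qed

end

section \<open>Differential operators in divergence form\<close>

context family_of_metrics
begin

lemma divergence_add:
  "(\<And>i. sm (V i)) \<Longrightarrow> (\<And>i. sm (W i)) \<Longrightarrow> z \<in> \<Omega> \<Longrightarrow>
    divergence (\<lambda>i z. V i z + W i z) z = divergence V z + divergence W z"
  by (simp add: divergence_def D_add sum.distrib algebra_simps)

lemma divergence_mult: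
  "sm a \<Longrightarrow> (\<And>i. sm (V i)) \<Longrightarrow> z \<in> \<Omega> \<Longrightarrow>
    divergence (\<lambda>i z. a z * V i z) z = a z * divergence V z + (\<Sum>i\<in>UNIV. dx i a z * V i z)"
  by (simp add: divergence_def D_mult sum.distrib sum_distrib_left algebra_simps)

lemma sm_flux:
  fixes Q :: "(real^'n) \<times> real \<Rightarrow> real^'n^'n" and f :: "(real^'n) \<times> real \<Rightarrow> real"
  shows "sm Q \<Longrightarrow> sm f \<Longrightarrow> sm (\<lambda>z. \<Sum>j\<in>UNIV. Q z $ i $ j * dx j f z)"
  by (intro sm_rules)

lemma divergence_cong:
  assumes "\<And>i z. z \<in> \<Omega> \<Longrightarrow> V i z = W i z" "z \<in> \<Omega>"
  shows "divergence V z = divergence W z"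
proof -
  have "dx i (V i) z = dx i (W i) z" for i by (rule D_cong[OF assms])
  then show ?thesis by (simp add: divergence_def assms)
qed

lemma div_op_add:
  assumes "sm Q" "sm f" "sm g" "z \<in> \<Omega>"
  shows "div_op Q (\<lambda>z. f z + g z) z = div_op Q f z + div_op Q g z"
proof -
  have "div_op Q (\<lambda>z. f z + g z) z = divergence (\<lambda>i z. (\<Sum>j\<in>UNIV. Q z $ i $ j * dx j f z) + (\<Sum>j\<in>UNIV. Q z $ i $ j * dx j g z)) z"
    unfolding div_op_def
    by (rule divergence_cong) (use assms in \<open>simp_all add: D_add sum.distrib distrib_left\<close>)
  then show ?thesis using assms by (simp add: divergence_add sm_flux div_op_def)
qed

lemma grad_inner_sym:
  assumes "transpose (Q z) = Q z" shows "grad_inner Q f g z = grad_inner Q g f z"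
  unfolding grad_inner_def sum_distrib_left
  by (subst sum.swap) (simp add: symmetric_nth[OF assms] mult_ac)

lemma div_op_mult:
  assumes "sm Q" "sm f" "sm g" "z \<in> \<Omega>" "transpose (Q z) = Q z"
  shows "div_op Q (\<lambda>z. f z * g z) z = f z * div_op Q g z + g z * div_op Q f z + 2 * grad_inner Q f g z"
proof -
  have "div_op Q (\<lambda>z. f z * g z) z = divergence (\<lambda>i z. f z * (\<Sum>j\<in>UNIV. Q z $ i $ j * dx j g z) + g z * (\<Sum>j\<in>UNIV. Q z $ i $ j * dx j f z)) z"
    unfolding div_op_def
    by (rule divergence_cong) (use assms in \<open>simp_all add: D_mult sum.distrib sum_distrib_left algebra_simps\<close>)
  also have "\<dots> = f z * div_op Q g z + grad_inner Q f g z + (g z * div_op Q f z + grad_inner Q g f z)"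
    using assms by (simp add: divergence_add divergence_mult sm_flux sm_rules div_op_def grad_inner_def)
  finally show ?thesis using grad_inner_sym[of Q z f g, OF assms(5)] by simp
qed

lemma div_op_scaleR:
  assumes "sm Q" "sm a" "sm f" "z \<in> \<Omega>"
  shows "div_op (\<lambda>z. a z *\<^sub>R Q z) f z = a z * div_op Q f z + grad_inner Q a f z"
proof -
  have "div_op (\<lambda>z. a z *\<^sub>R Q z) f z = divergence (\<lambda>i z. a z * (\<Sum>j\<in>UNIV. Q z $ i $ j * dx j f z)) z"
    by (simp add: div_op_def sum_distrib_left mult_ac)
  then show ?thesis using assms by (simp add: divergence_mult sm_flux div_op_def grad_inner_def)
qed

lemma div_op_add_left:
  assumes "sm Q" "sm R" "sm f" "z \<in> \<Omega>"
  shows "div_op (\<lambda>z. Q z + R z) f z = div_op Q f z + div_op R f z"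
proof -
  have "div_op (\<lambda>z. Q z + R z) f z = divergence (\<lambda>i z. (\<Sum>j\<in>UNIV. Q z $ i $ j * dx j f z) + (\<Sum>j\<in>UNIV. R z $ i $ j * dx j f z)) z"
    by (simp add: div_op_def sum.distrib distrib_right)
  then show ?thesis using assms by (simp add: divergence_add sm_flux div_op_def)
qed

lemma grad_inner_const [simp]: "grad_inner Q (\<lambda>_. c) f z = 0" "grad_inner Q f (\<lambda>_. c) z = 0"
  by (simp_all add: grad_inner_def)

lemma div_op_cmult:
  assumes "sm Q" "sm f" "z \<in> \<Omega>"
  shows "div_op Q (\<lambda>z. c * f z) z = c * div_op Q f z"
proof -
  have "div_op Q (\<lambda>z. c * f z) z = divergence (\<lambda>i z. c * (\<Sum>j\<in>UNIV. Q z $ i $ j * dx j f z)) z"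
    unfolding div_op_def
    by (rule divergence_cong) (use assms in \<open>simp_all add: D_mult sm_rules sum_distrib_left mult_ac\<close>)
  then show ?thesis using assms by (simp add: divergence_mult sm_flux sm_rules div_op_def)
qed

lemma grad_inner_add:
  assumes "sm f" "sm g" "z \<in> \<Omega>"
  shows "grad_inner Q (\<lambda>z. f z + g z) h z = grad_inner Q f h z + grad_inner Q g h z"
    "grad_inner Q h (\<lambda>z. f z + g z) z = grad_inner Q h f z + grad_inner Q h g z"
  using assms by (simp_all add: grad_inner_def D_add sum.distrib algebra_simps)

lemma grad_inner_mult:
  assumes "sm f" "sm g" "z \<in> \<Omega>"
  shows "grad_inner Q (\<lambda>z. f z * g z) h z = f z * grad_inner Q g h z + g z * grad_inner Q f h z"
    "grad_inner Q h (\<lambda>z. f z * g z) z = f z * grad_inner Q h g z + g z * grad_inner Q h f z"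
  using assms by (simp_all add: grad_inner_def D_mult sum.distrib sum_distrib_left algebra_simps)

subsection \<open>Dependence on the parameter\<close>

text \<open>The coefficients of the divergence depend on the parameter through the trace of the connection.\<close>

lemma ds_divergence:
  assumes V: "\<And>i. sm (V i)" and z: "z \<in> \<Omega>"
  shows "ds (divergence V) z = divergence (\<lambda>i. ds (V i)) z + (\<Sum>i\<in>UNIV. dx i theta z * V i z) / 2"
proof -
  have tr: "ds (\<lambda>z. trace (Gam i z)) z = dx i theta z / 2" for i
  proof -
    have "ds (\<lambda>z. trace (Gam i z)) z = ds (\<lambda>z. (1/2) *\<^sub>R trace (K z ** dx i H z)) z"
      by (rule D_cong[OF _ z]) (simp add: trace_Gam)
    also have "\<dots> = (1/2) *\<^sub>R ds (\<lambda>z. trace (K z ** dx i H z)) z"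
      by (rule D_scaleR_const[OF _ z]) (intro sm_rules)
    finally show ?thesis by (simp add: ds_trace_connection[OF z])
  qed
  have "ds (divergence V) z = (\<Sum>i\<in>UNIV. ds (\<lambda>z. dx i (V i) z + trace (Gam i z) * V i z) z)"
    unfolding divergence_def[abs_def] by (rule D_sum[OF _ z]) (intro sm_rules V)
  also have "\<dots> = (\<Sum>i\<in>UNIV. dx i (ds (V i)) z + (trace (Gam i z) * ds (V i) z + dx i theta z / 2 * V i z))"
    using z V by (simp add: D_add D_mult sm_rules tr D_commute[of _ _ "(0,1)"])
  finally show ?thesis
    by (simp add: divergence_def sum.distrib sum_divide_distrib algebra_simps)
qed

lemma ds_div_op:
  assumes Q: "sm Q" and f: "sm f" and z: "z \<in> \<Omega>"
  shows "ds (div_op Q f) z = div_op (ds Q) f z + div_op Q (ds f) z + grad_inner Q theta f z / 2"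
proof -
  have "divergence (\<lambda>i. ds (\<lambda>z. \<Sum>j\<in>UNIV. Q z $ i $ j * dx j f z)) z
      = divergence (\<lambda>i z. (\<Sum>j\<in>UNIV. ds Q z $ i $ j * dx j f z) + (\<Sum>j\<in>UNIV. Q z $ i $ j * dx j (ds f) z)) z"
  proof (rule divergence_cong[OF _ z])
    fix i z assume z: "z \<in> \<Omega>"
    show "ds (\<lambda>z. \<Sum>j\<in>UNIV. Q z $ i $ j * dx j f z) z
      = (\<Sum>j\<in>UNIV. ds Q z $ i $ j * dx j f z) + (\<Sum>j\<in>UNIV. Q z $ i $ j * dx j (ds f) z)"
      using Q f z by (simp add: D_sum D_mult D_entry sm_rules sum.distrib D_commute[of f _ "(0,1)"])
  qed
  then show ?thesis
    unfolding div_op_def using Q f z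
    by (simp add: ds_divergence sm_flux divergence_add sm_rules grad_inner_def)
qed

lemma ds_grad_inner:
  assumes "sm Q" "sm f" "sm g" "z \<in> \<Omega>"
  shows "ds (grad_inner Q f g) z = grad_inner (ds Q) f g z + grad_inner Q (ds f) g z + grad_inner Q f (ds g) z"
  unfolding grad_inner_def[abs_def] using assms
  by (simp add: D_sum D_mult D_entry sm_rules D_commute[of _ _ "(0,1)"] sum.distrib algebra_simps)

text \<open>The first two derivatives of the Laplacian with respect to the parameter.\<close>

definition Lap1 :: "((real^'n) \<times> real \<Rightarrow> real) \<Rightarrow> (real^'n) \<times> real \<Rightarrow> real" where
  "Lap1 f z = div_op (ds K) f z + grad_inner K theta f z / 2"

definition Lap2 :: "((real^'n) \<times> real \<Rightarrow> real) \<Rightarrow> (real^'n) \<times> real \<Rightarrow> real" where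
  "Lap2 f z = div_op (ds (ds K)) f z + grad_inner (ds K) theta f z + grad_inner K (ds theta) f z / 2"

lemma sm_half: "sm f \<Longrightarrow> sm (\<lambda>z. f z / 2)" for f :: "_ \<Rightarrow> real"
  unfolding divide_inverse by (intro sm_rules)

lemma D_half: "sm f \<Longrightarrow> z \<in> \<Omega> \<Longrightarrow> ddir v (\<lambda>z. f z / 2) z = ddir v f z / 2" for f :: "_ \<Rightarrow> real"
  by (rule ddir_bounded_linear[OF bounded_linear_divide sm_diff])

lemma sm_Lap1: "sm f \<Longrightarrow> sm (Lap1 f)"
  unfolding Lap1_def[abs_def] by (intro sm_rules sm_half sm_div_op sm_grad_inner sm_theta)

lemma ds_Lap: "sm f \<Longrightarrow> z \<in> \<Omega> \<Longrightarrow> ds (Lap f) z = Lap1 f z + Lap (ds f) z"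
  by (simp add: ds_div_op sm_K Lap1_def)

lemma ds_Lap1: "sm f \<Longrightarrow> z \<in> \<Omega> \<Longrightarrow> ds (Lap1 f) z = Lap2 f z + Lap1 (ds f) z"
  unfolding Lap1_def[abs_def] Lap2_def
  by (simp add: D_add D_half sm_half sm_div_op sm_grad_inner sm_rules sm_theta ds_div_op ds_grad_inner add_divide_distrib)

lemmas sm_ops = sm_rules sm_theta sm_snd sm_div_op sm_grad_inner sm_half sm_Lap1 sm_amb

lemma ds_snd: "ds snd z = (1 :: real)"
  by (simp add: ddir_unique[OF bounded_linear_imp_has_derivative[OF bounded_linear_snd]])

text \<open>The parameter derivative of \<open>amb w f\<close>; in contrast to \<open>ds (amb w f)\<close> it can be differentiated
  term by term.\<close>

definition amb1 :: "real \<Rightarrow> ((real^'n) \<times> real \<Rightarrow> real) \<Rightarrow> (real^'n) \<times> real \<Rightarrow> real" where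
  "amb1 w f z = Lap1 f z + Lap (ds f) z + (2 * w + real CARD('n) - 4) * ds (ds f) z - theta z * ds f z
     + w / 2 * (ds theta z * f z + theta z * ds f z)
     - snd z * (2 * ds (ds (ds f)) z + theta z * ds (ds f) z + ds theta z * ds f z)"

lemma ds_amb:
  assumes "sm f" "z \<in> \<Omega>"
  shows "ds (amb w f) z = amb1 w f z"
  unfolding amb_def[abs_def] amb1_def using assms
  by (simp add: D_add D_diff D_mult D_half sm_ops ds_Lap ds_snd) (simp add: field_simps)

lemma ds_ds_amb:
  assumes f: "sm f" and y: "(y, 0) \<in> \<Omega>"
  defines "z \<equiv> (y, 0)"
  shows "ds (ds (amb w f)) z = Lap2 f z + 2 * Lap1 (ds f) z + Lap (ds (ds f)) z
    + (2 * w + real CARD('n) - 6) * ds (ds (ds f)) z - 2 * theta z * ds (ds f) z - 2 * ds theta z * ds f z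
    + w / 2 * (ds (ds theta) z * f z + 2 * ds theta z * ds f z + theta z * ds (ds f) z)"
proof -
  have z: "z \<in> \<Omega>" "snd z = 0" using y by (simp_all add: z_def)
  have "ds (ds (amb w f)) z = ds (amb1 w f) z" by (rule D_cong[OF ds_amb[OF f] z(1)])
  also have "\<dots> = Lap2 f z + 2 * Lap1 (ds f) z + Lap (ds (ds f)) z
    + (2 * w + real CARD('n) - 6) * ds (ds (ds f)) z - 2 * theta z * ds (ds f) z - 2 * ds theta z * ds f z
    + w / 2 * (ds (ds theta) z * f z + 2 * ds theta z * ds f z + theta z * ds (ds f) z)"
    unfolding amb1_def[abs_def] using f z
    by (simp add: D_add D_diff D_mult D_half sm_ops ds_Lap ds_Lap1 ds_snd) (simp add: field_simps)
  finally show ?thesis .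
qed

subsection \<open>Operators on a slice\<close>

lemma dx_slice_cong:
  fixes F G :: "(real^'n) \<times> real \<Rightarrow> real"
  assumes "sm F" "sm G" "\<And>y. (y, s) \<in> \<Omega> \<Longrightarrow> F (y, s) = G (y, s)" "(y, s) \<in> \<Omega>"
  shows "dx i F (y, s) = dx i G (y, s)"
  using pd_slice[OF assms(1,4), of "\<lambda>y. F (y, s)" i] pd_slice[OF assms(2,4), of "\<lambda>y. F (y, s)" i] assms(3)
  by simp

lemma div_op_slice_cong:
  assumes sm: "sm Q" "sm R" "sm f" "sm g"
    and eq: "\<And>y. (y, s) \<in> \<Omega> \<Longrightarrow> Q (y, s) = R (y, s)" "\<And>y. (y, s) \<in> \<Omega> \<Longrightarrow> f (y, s) = g (y, s)"
    and z: "(y, s) \<in> \<Omega>"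
  shows "div_op Q f (y, s) = div_op R g (y, s)"
proof -
  have 1: "(\<Sum>j\<in>UNIV. Q (y, s) $ i $ j * dx j f (y, s)) = (\<Sum>j\<in>UNIV. R (y, s) $ i $ j * dx j g (y, s))"
    if "(y, s) \<in> \<Omega>" for y i
    using dx_slice_cong[OF sm(3,4) eq(2) that] eq(1)[OF that] by simp
  have "dx i (\<lambda>z. \<Sum>j\<in>UNIV. Q z $ i $ j * dx j f z) (y, s) = dx i (\<lambda>z. \<Sum>j\<in>UNIV. R z $ i $ j * dx j g z) (y, s)" for i
    by (rule dx_slice_cong[OF sm_flux[OF sm(1,3)] sm_flux[OF sm(2,4)] 1 z])
  then show ?thesis by (simp add: div_op_def divergence_def 1[OF z])
qed

text \<open>The derivatives of \<open>f\<close> in the parameter direction cancel: the result depends only on the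
  restriction of \<open>f\<close> to the slice.\<close>

lemma amb_cube:
  assumes f: "sm f" and y: "(y, 0) \<in> \<Omega>"
  defines "z \<equiv> (y, 0)" and "m \<equiv> real CARD('n) / 2"
  defines "a \<equiv> (3 - m) / 2" and "b \<equiv> (1 - m) / 2" and "c \<equiv> (- 1 - m) / 2"
  shows "amb (- 1 - m) (amb (1 - m) (amb (3 - m) f)) z
    = Lap (Lap (Lap f)) z + a * Lap (Lap (\<lambda>z. theta z * f z)) z + b * Lap (\<lambda>z. theta z * Lap f z) z
      + a * b * Lap (\<lambda>z. theta z * (theta z * f z)) z
      + c * theta z * (Lap (Lap f) z + a * Lap (\<lambda>z. theta z * f z) z + b * theta z * Lap f z + a * b * (theta z)\<^sup>2 * f z)
      - 4 * (Lap (Lap1 f) z + a * Lap (\<lambda>z. ds theta z * f z) z + Lap1 (Lap f) z + a * Lap1 (\<lambda>z. theta z * f z) z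
        - 2 * (Lap2 f z + a * ds (ds theta) z * f z)
        + (b - 1) * theta z * (Lap1 f z + a * ds theta z * f z)
        + b * ds theta z * (Lap f z + a * theta z * f z))"
proof -
  have z: "z \<in> \<Omega>" "snd z = 0" using y by (simp_all add: z_def)
  have n: "real CARD('n) = 2 * m" by (simp add: m_def)
  define f1 where "f1 = amb (3 - m) f"
  define f2 where "f2 = amb (1 - m) f1"
  have sm1: "sm f1" "sm f2" unfolding f1_def f2_def by (intro sm_ops f)+
  have f1: "f1 (y, 0) = Lap f (y, 0) + 4 * ds f (y, 0) + a * (theta (y, 0) * f (y, 0))" if "(y, 0) \<in> \<Omega>" for y
    by (simp add: f1_def amb_def n a_def)
  have f1': "ds f1 (y, 0) = Lap1 f (y, 0) + Lap (ds f) (y, 0) + 2 * ds (ds f) (y, 0) + (a - 1) * (theta (y, 0) * ds f (y, 0))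
      + a * (ds theta (y, 0) * f (y, 0))" if "(y, 0) \<in> \<Omega>" for y
    unfolding f1_def ds_amb[OF f that] amb1_def n by (simp add: a_def field_simps)
  have f1'': "ds (ds f1) z = Lap2 f z + 2 * Lap1 (ds f) z + Lap (ds (ds f)) z
      + (a - 2) * theta z * ds (ds f) z + (2 * a - 2) * ds theta z * ds f z + a * ds (ds theta) z * f z"
    unfolding f1_def z_def ds_ds_amb[OF f y] n by (simp add: a_def field_simps)
  have f2: "f2 (y, 0) = Lap f1 (y, 0) + b * (theta (y, 0) * f1 (y, 0))" if "(y, 0) \<in> \<Omega>" for y
    by (simp add: f2_def amb_def n b_def)
  have f2': "ds f2 z = Lap1 f1 z + Lap (ds f1) z - 2 * ds (ds f1) z + (b - 1) * theta z * ds f1 z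
      + b * ds theta z * f1 z"
    unfolding f2_def ds_amb[OF sm1(1) z(1)] amb1_def n using z by (simp add: b_def field_simps)
  have Lf1: "Lap f1 (y, 0) = Lap (Lap f) (y, 0) + 4 * Lap (ds f) (y, 0) + a * Lap (\<lambda>z. theta z * f z) (y, 0)"
    if "(y, 0) \<in> \<Omega>" for y
  proof -
    have "Lap f1 (y, 0) = Lap (\<lambda>z. Lap f z + 4 * ds f z + a * (theta z * f z)) (y, 0)"
      by (rule div_op_slice_cong[OF sm_K sm_K sm1(1) _ refl f1 that]) (intro sm_ops f)
    then show ?thesis using f that by (simp add: div_op_add div_op_cmult sm_ops)
  qed
  have Lf2: "Lap f2 z = Lap (Lap (Lap f)) z + 4 * Lap (Lap (ds f)) z + a * Lap (Lap (\<lambda>z. theta z * f z)) z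
      + b * (Lap (\<lambda>z. theta z * Lap f z) z + 4 * Lap (\<lambda>z. theta z * ds f z) z + a * Lap (\<lambda>z. theta z * (theta z * f z)) z)"
  proof -
    have "Lap f2 z = Lap (\<lambda>z. Lap (Lap f) z + 4 * Lap (ds f) z + a * Lap (\<lambda>z. theta z * f z) z
        + b * (theta z * Lap f z + 4 * (theta z * ds f z) + a * (theta z * (theta z * f z)))) z"
      unfolding z_def
      by (rule div_op_slice_cong[OF sm_K sm_K sm1(2) _ refl _ y])
        (intro sm_ops f, simp add: f2 Lf1 f1 algebra_simps)
    then show ?thesis using f z by (simp add: div_op_add div_op_cmult sm_ops)
  qed
  have Lf1': "Lap (ds f1) z = Lap (Lap1 f) z + Lap (Lap (ds f)) z + 2 * Lap (ds (ds f)) z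
      + (a - 1) * Lap (\<lambda>z. theta z * ds f z) z + a * Lap (\<lambda>z. ds theta z * f z) z"
  proof -
    have "Lap (ds f1) z = Lap (\<lambda>z. Lap1 f z + Lap (ds f) z + 2 * ds (ds f) z + (a - 1) * (theta z * ds f z)
      + a * (ds theta z * f z)) z"
      unfolding z_def
      by (rule div_op_slice_cong[where f = "ds f1", OF sm_K sm_K _ _ refl f1' y]) (intro sm_ops f sm1)+
    then show ?thesis using f z by (simp add: div_op_add div_op_cmult sm_ops)
  qed
  have L1f1: "Lap1 f1 z = Lap1 (Lap f) z + 4 * Lap1 (ds f) z + a * Lap1 (\<lambda>z. theta z * f z) z"
  proof -
    have "div_op (ds K) f1 z = div_op (ds K) (\<lambda>z. Lap f z + 4 * ds f z + a * (theta z * f z)) z"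
      unfolding z_def by (rule div_op_slice_cong[OF _ _ sm1(1) _ refl f1 y]) (intro sm_ops f)+
    moreover have "grad_inner K theta f1 z = grad_inner K theta (\<lambda>z. Lap f z + 4 * ds f z + a * (theta z * f z)) z"
    proof -
      have "dx j f1 (y, 0) = dx j (\<lambda>z. Lap f z + 4 * ds f z + a * (theta z * f z)) (y, 0)" for j
        by (rule dx_slice_cong[OF sm1(1) _ f1 y]) (intro sm_ops f)
      then show ?thesis by (simp add: grad_inner_def z_def)
    qed
    moreover have "grad_inner K theta (\<lambda>z. k * g z) z = k * grad_inner K theta g z" if "sm g" for k g
      using grad_inner_mult(2)[OF sm_rules(1) that z(1), of K theta k] by simp
    ultimately show ?thesis
      using f z by (simp add: Lap1_def div_op_add div_op_cmult grad_inner_add sm_ops add_divide_distrib algebra_simps)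
  qed
  have "amb (- 1 - m) f2 z = Lap f2 z - 4 * ds f2 z + c * (theta z * f2 z)"
    using z by (simp add: amb_def n c_def)
  then show ?thesis
    unfolding f1_def[symmetric] f2_def[symmetric]
    using f1[OF y] f1'[OF y] f2[OF y] Lf1[OF y]
    by (simp add: Lf2 f2' Lf1' L1f1 f1'' flip: z_def) (simp add: a_def b_def c_def field_simps power2_eq_square)
qed

end

section \<open>The coefficients of the operator in terms of the family\<close>

lemma matrix_mul_mat: "(A :: real^'n::finite^'n) ** mat a = a *\<^sub>R A" "mat a ** A = a *\<^sub>R A"
  by (simp_all add: vec_eq_iff matrix_mul_nth mat_nth if_distrib if_distribR sum.delta' mult.commute
      cong: if_cong)

context family_of_metrics
begin

lemma K_positive_definite:
  assumes z: "z \<in> \<Omega>" shows "positive_definite (K z)"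
  unfolding positive_definite_def
proof (intro conjI allI impI)
  fix v :: "real^'n" assume v: "v \<noteq> 0"
  have Hv: "H z *v (K z *v v) = v" using z by (simp add: matrix_vector_mul_assoc)
  then have "K z *v v \<noteq> 0" using v by (metis matrix_vector_mult_0_right)
  then have "(K z *v v) \<bullet> (H z *v (K z *v v)) > 0"
    using positive_definite_H[OF z] by (simp add: positive_definite_def)
  then show "v \<bullet> (K z *v v) > 0" by (simp add: Hv inner_commute)
qed (use z in simp)

text \<open>The endomorphism \<open>P ** K z\<close> is self-adjoint for the inner product given by \<open>K z\<close> on one-forms.\<close>

lemma tr_wedge3_endo:
  assumes z: "z \<in> \<Omega>" and P: "transpose P = P"
  shows "tr_wedge3 (P ** K z) = ((trace (P ** K z)) ^ 3 - 3 * trace (P ** K z) * trace (P ** K z ** P ** K z)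
    + 2 * trace (P ** K z ** P ** K z ** P ** K z)) / 6"
proof -
  have "(P ** K z *v u) \<bullet> (K z *v v) = u \<bullet> (K z *v (P ** K z *v v))" for u v
  proof -
    have "(P ** K z *v u) \<bullet> (K z *v v) = u \<bullet> (transpose (P ** K z) *v (K z *v v))"
      by (metis dot_lmul_matrix transpose_transpose transpose_matrix_vector)
    then show ?thesis using z P by (simp add: transpose_simps matrix_vector_mul_assoc matrix_mul_assoc)
  qed
  from tr_wedge3_eq[OF K_positive_definite[OF z] this] show ?thesis by (simp add: matrix_mul_assoc)
qed

lemma D_D_K:
  assumes z: "z \<in> \<Omega>"
  shows "ds (ds K) z = 2 *\<^sub>R (K z ** ds H z ** K z ** ds H z ** K z) - K z ** ds (ds H) z ** K z"
proof -
  have "ds (ds K) z = ds (\<lambda>z. - (K z ** ds H z ** K z)) z"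
    by (rule D_cong[OF D_K z])
  then show ?thesis using z
    by (simp add: D_minus D_matrix_mul sm_rules D_K matrix_mul_simps matrix_mul_assoc scaleR_2)
qed

lemma trace_MM_derivative:
  assumes z: "z \<in> \<Omega>"
  shows "ds (\<lambda>z. trace (K z ** ds H z ** K z ** ds H z)) z
    = 2 * trace (ds (ds H) z ** K z ** ds H z ** K z) - 2 * trace (ds H z ** K z ** ds H z ** K z ** ds H z ** K z)"
proof -
  let ?d = "ds H z" and ?e = "ds (ds H) z" and ?k = "K z"
  let ?M = "\<lambda>z. K z ** ds H z"
  have M: "sm ?M" by (intro sm_rules)
  have M': "ds ?M z = ?k ** ?e - ?k ** ?d ** ?k ** ?d"
    using z by (simp add: D_matrix_mul sm_rules D_K matrix_mul_simps)
  have "ds (\<lambda>z. trace (?M z ** ?M z)) z = trace (?M z ** ds ?M z + ds ?M z ** ?M z)"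
    by (simp only: D_trace[OF smooth_on_matrix_mul[OF open_\<Omega> M M] z] D_matrix_mul[OF M M z])
  then have "ds (\<lambda>z. trace (K z ** ds H z ** K z ** ds H z)) z
    = trace (?k ** ?d ** ?k ** ?e) - trace (?k ** ?d ** ?k ** ?d ** ?k ** ?d)
      + (trace (?k ** ?e ** ?k ** ?d) - trace (?k ** ?d ** ?k ** ?d ** ?k ** ?d))"
    by (simp only: M' matrix_mul_simps matrix_mul_assoc trace_simps)
  moreover have "trace (?k ** ?e ** ?k ** ?d) = trace (?e ** ?k ** ?d ** ?k)"
    using trace_mul_sym[of ?k "?e ** ?k ** ?d"] by (simp add: matrix_mul_assoc)
  moreover have "trace (?k ** ?d ** ?k ** ?e) = trace (?e ** ?k ** ?d ** ?k)"
    using trace_mul_sym[of "?k ** ?d ** ?k" ?e] by (simp add: matrix_mul_assoc)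
  moreover have "trace (?k ** ?d ** ?k ** ?d ** ?k ** ?d) = trace (?d ** ?k ** ?d ** ?k ** ?d ** ?k)"
    using trace_mul_sym[of ?k "?d ** ?k ** ?d ** ?k ** ?d"] by (simp add: matrix_mul_assoc)
  ultimately show ?thesis by simp
qed

end

context einstein_family
begin

lemma J_eq: "(y, 0) \<in> \<Omega> \<Longrightarrow> schouten_scalar G y = (1 / 2) * theta (y, 0)"
  by (simp add: schouten_scalar_boundary)

lemma endo_eq: "(y, 0) \<in> \<Omega> \<Longrightarrow> endo G S y = S y ** K (y, 0)"
  by (simp add: endo_def christoffel_eq(2)[OF _ G])

lemma tensor_inner_eq:
  assumes y: "(y, 0) \<in> \<Omega>" and T: "transpose (T y) = T y"
  shows "tensor_inner G S T y = trace (S y ** K (y, 0) ** T y ** K (y, 0))"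
proof -
  define A where "A = K (y, 0) ** T y ** K (y, 0)"
  have "transpose A = A" using y T by (simp add: A_def transpose_simps matrix_mul_assoc)
  then have A: "A $ i $ j = A $ j $ i" for i j by (rule symmetric_nth)
  have "raise G T y = A" using y by (simp add: raise_def A_def christoffel_eq(2)[OF y G])
  then have "tensor_inner G S T y = (\<Sum>i\<in>UNIV. \<Sum>j\<in>UNIV. S y $ i $ j * A $ j $ i)"
    unfolding tensor_inner_def by (simp only: A[symmetric])
  also have "\<dots> = trace (S y ** A)" by (simp only: trace_mul)
  finally show ?thesis by (simp add: A_def matrix_mul_assoc)
qed

lemma schouten_sym: "(y, 0) \<in> \<Omega> \<Longrightarrow> transpose (schouten G y) = schouten G y"
  by (simp add: schouten_boundary transpose_simps)

lemma norm_P_eq: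
  assumes y: "(y, 0) \<in> \<Omega>"
  shows "tensor_inner G (schouten G) (schouten G) y = (- 1 / 2) * ds theta (y, 0)"
proof -
  have "trace (ds H (y, 0) ** K (y, 0) ** ds H (y, 0) ** K (y, 0)) = trace (K (y, 0) ** ds H (y, 0) ** K (y, 0) ** ds H (y, 0))"
    using trace_mul_sym[of "ds H (y, 0) ** K (y, 0) ** ds H (y, 0)" "K (y, 0)"] by (simp add: matrix_mul_assoc)
  then show ?thesis using normal_vanishes(1)[OF y]
    by (simp add: tensor_inner_eq[where T = "schouten G", OF y schouten_sym[OF y]] schouten_boundary[OF y] matrix_mul_simps trace_simps)
qed

text \<open>\<open>QT2\<close> and \<open>QT4\<close> are \<open>K ** T2 G\<close> and \<open>K ** T4 G\<close> on the boundary, rewritten in terms of the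
  parameter derivatives of \<open>K\<close>: those are the coefficients occurring in \<open>Lap1\<close> and \<open>Lap2\<close>.\<close>

definition QT2 :: "(real^'n) \<times> real \<Rightarrow> real^'n^'n" where
  "QT2 z = ((real CARD('n) / 2 - 1) * theta z) *\<^sub>R K z + 4 *\<^sub>R ds K z"

definition coeff4 :: "(real^'n) \<times> real \<Rightarrow> real" where
  "coeff4 z = (- (3 * (real CARD('n) / 2 - 1)\<^sup>2 - 4) / 4) * (theta z * theta z)
     + (- 2 * (real CARD('n) - 4)) * ds theta z + ((real CARD('n) - 6) / 2) * Lap theta z"

definition QT4 :: "(real^'n) \<times> real \<Rightarrow> real^'n^'n" where
  "QT4 z = coeff4 z *\<^sub>R K z + ((- 4 * (real CARD('n) / 2 - 1)) * theta z) *\<^sub>R ds K z + (- 8) *\<^sub>R ds (ds K) z"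

lemma sm_QT2: "sm QT2" unfolding QT2_def[abs_def] by (intro sm_ops)

lemma sm_coeff4: "sm coeff4" unfolding coeff4_def[abs_def] by (intro sm_ops)

lemma sm_QT4: "sm QT4" unfolding QT4_def[abs_def] by (intro sm_ops sm_coeff4)

lemma laplacian_cmult:
  assumes "sm F" "\<And>y. (y, 0) \<in> \<Omega> \<Longrightarrow> f y = c * F (y, 0)" "(y, 0) \<in> \<Omega>"
  shows "laplacian G f y = c * Lap F (y, 0)"
proof -
  have "laplacian G f y = Lap (\<lambda>z. c * F z) (y, 0)"
    by (rule laplacian_eq_Lap[where F = "\<lambda>z. c * F z" and f = f, OF assms(3) G _ assms(2)])
      (assumption, intro sm_ops assms(1))
  then show ?thesis using assms by (simp add: div_op_cmult sm_K)
qed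

lemma laplacian_J: "(y, 0) \<in> \<Omega> \<Longrightarrow> laplacian G (schouten_scalar G) y = (1 / 2) * Lap theta (y, 0)"
  by (rule laplacian_cmult[where F = theta and f = "schouten_scalar G", OF sm_theta J_eq])

lemma K_T2: "(y, 0) \<in> \<Omega> \<Longrightarrow> K (y, 0) ** T2 G y = QT2 (y, 0)"
  by (simp add: T2_def QT2_def J_eq endo_eq schouten_boundary matrix_mul_simps matrix_mul_mat
      matrix_mul_assoc D_K diff_divide_distrib)

lemma K_T4:
  assumes y: "(y, 0) \<in> \<Omega>"
  shows "K (y, 0) ** T4 G y = QT4 (y, 0)"
proof -
  let ?k = "K (y, 0)" and ?d = "ds H (y, 0)" and ?e = "ds (ds H) (y, 0)"
  have n4: "real CARD('n) - 4 \<noteq> 0" using dim by auto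
  have B: "(16 / (real CARD('n) - 4)) *\<^sub>R (?k ** endo G (bach G) y)
      = 4 *\<^sub>R (?k ** ?d ** ?k ** ?d ** ?k) - 8 *\<^sub>R (?k ** ?e ** ?k)"
  proof -
    have c: "(16 / c) *\<^sub>R ((c / 4) *\<^sub>R X - (c / 2) *\<^sub>R Y) = 4 *\<^sub>R X - 8 *\<^sub>R Y" if "c \<noteq> 0"
      for c and X Y :: "real^'n^'n" using that by (simp add: scaleR_diff_right)
    have "?k ** endo G (bach G) y = ((real CARD('n) - 4) / 4) *\<^sub>R (?k ** ?d ** ?k ** ?d ** ?k)
        - ((real CARD('n) - 4) / 2) *\<^sub>R (?k ** ?e ** ?k)"
      by (simp only: endo_eq[OF y] bach_boundary[OF y] matrix_mul_simps matrix_mul_assoc)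
    then show ?thesis by (simp only: c[OF n4])
  qed
  have "K (y, 0) ** T4 G y = (- (3 * (real CARD('n) / 2 - 1)\<^sup>2 - 4) * ((1 / 2) * theta (y, 0))\<^sup>2
           + 4 * (real CARD('n) - 4) * ((- 1 / 2) * ds theta (y, 0))) *\<^sub>R ?k
      + (16 * (real CARD('n) / 2 - 1) * ((1 / 2) * theta (y, 0))) *\<^sub>R ((1 / 2) *\<^sub>R (?k ** ?d ** ?k))
      + ((real CARD('n) - 6) * ((1 / 2) * Lap theta (y, 0))) *\<^sub>R ?k
      - 48 *\<^sub>R ((1 / 4) *\<^sub>R (?k ** ?d ** ?k ** ?d ** ?k))
      - (4 *\<^sub>R (?k ** ?d ** ?k ** ?d ** ?k) - 8 *\<^sub>R (?k ** ?e ** ?k))"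
    unfolding B[symmetric] T4_def Let_def norm_P_eq[OF y] laplacian_J[OF y] J_eq[OF y]
    by (simp only: matrix_mul_simps matrix_mul_mat endo_eq[OF y] schouten_boundary[OF y] matrix_mul_assoc
        scaleR_scaleR) (simp add: matrix_mul_simps matrix_mul_assoc)
  also have "\<dots> = QT4 (y, 0)"
    by (simp add: QT4_def coeff4_def D_K[OF y] D_D_K[OF y])
      (simp add: vec_eq_iff field_simps power2_eq_square)
  finally show ?thesis .
qed

text \<open>Up to the factor $-384$, the coefficient \<open>v6\<close> combines $\mathsf J$, $|\mathsf P|^2$, the trace of
  $\mathsf P^3$ and the inner product with the Bach tensor exactly so that the last two form the second
  derivative of \<open>theta\<close>, which the normal Einstein equation expresses by them.\<close>

lemma v6_eq:
  assumes y: "(y, 0) \<in> \<Omega>" and n6: "CARD('n) \<noteq> 6"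
  shows "- 384 * v6 G y = (theta (y, 0)) ^ 3 + 6 * theta (y, 0) * ds theta (y, 0) + 4 * ds (ds theta) (y, 0)"
proof -
  let ?k = "K (y, 0)" and ?d = "ds H (y, 0)" and ?e = "ds (ds H) (y, 0)"
  have n4: "real CARD('n) - 4 \<noteq> 0" using dim by auto
  define t3 where "t3 = trace (?d ** ?k ** ?d ** ?k ** ?d ** ?k)"
  define q where "q = trace (?e ** ?k ** ?d ** ?k)"
  have t1: "trace (?d ** ?k) = theta (y, 0)"
    by (simp add: theta_def trace_mul_sym[of ?d])
  have t2: "trace (?d ** ?k ** ?d ** ?k) = - 2 * ds theta (y, 0)"
    using norm_P_eq[OF y]
    by (simp add: tensor_inner_eq[where T = "schouten G", OF y schouten_sym[OF y]] schouten_boundary[OF y] matrix_mul_simps trace_simps)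
  have "tr_wedge3 (endo G (schouten G) y) = ((theta (y, 0) / 2) ^ 3 - 3 * (theta (y, 0) / 2) * (- 2 * ds theta (y, 0) / 4)
      + 2 * (t3 / 8)) / 6"
    unfolding endo_eq[OF y] tr_wedge3_endo[OF y schouten_sym[OF y]]
    by (simp add: schouten_boundary[OF y] matrix_mul_simps trace_simps t1 t2 t3_def)
  moreover have "tensor_inner G (bach G) (schouten G) y = (real CARD('n) - 4) / 8 * t3 - (real CARD('n) - 4) / 4 * q"
    by (simp add: tensor_inner_eq[where T = "schouten G", OF y schouten_sym[OF y]] schouten_boundary[OF y] bach_boundary[OF y]
        matrix_mul_simps trace_simps t3_def q_def)
  moreover have "ds (ds theta) (y, 0) = t3 - q"
  proof -
    have "sm (\<lambda>z. trace (K z ** ds H z ** K z ** ds H z))" by (intro sm_ops)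
    then show ?thesis using normal_vanishes(2)[OF y n6] trace_MM_derivative[OF y] y
      by (simp add: D_add D_half sm_ops t3_def q_def) (simp add: field_simps)
  qed
  ultimately show ?thesis
    using n4 by (simp add: v6_def) (simp add: field_simps power3_eq_cube)
qed

lemma Q6_eq:
  assumes y: "(y, 0) \<in> \<Omega>" and n6: "CARD('n) \<noteq> 6"
  defines "m \<equiv> real CARD('n) / 2" and "z \<equiv> (y, 0)"
  shows "Q6 G y = (theta z) ^ 3 + 6 * theta z * ds theta z + 4 * ds (ds theta) z
    - (m + 1) / 4 * Lap (\<lambda>z. theta z * theta z) z - 2 * Lap (ds theta) z - 2 * div_op (ds K) theta z
    + Lap (Lap theta) z / 2 - (m - 3) / 4 * theta z * Lap theta z
    + (2 * m - 6) * theta z * ds theta z + (m\<^sup>2 - 9) / 8 * (theta z) ^ 3"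
proof -
  have n: "real CARD('n) = 2 * m" by (simp add: m_def)
  have 1: "laplacian G (\<lambda>y. (schouten_scalar G y)\<^sup>2) y = (1 / 4) * Lap (\<lambda>z. theta z * theta z) z"
    unfolding z_def by (rule laplacian_cmult[where F = "\<lambda>z. theta z * theta z", OF _ _ y]) (intro sm_ops, simp add: J_eq power2_eq_square)
  have 2: "laplacian G (tensor_inner G (schouten G) (schouten G)) y = (- 1 / 2) * Lap (ds theta) z"
    unfolding z_def by (rule laplacian_cmult[where F = "ds theta" and f = "tensor_inner G (schouten G) (schouten G)",
          OF _ norm_P_eq y]) (intro sm_ops)
  have 3: "laplacian G (laplacian G (schouten_scalar G)) y = (1 / 2) * Lap (Lap theta) z"
    unfolding z_def by (rule laplacian_cmult[where F = "Lap theta" and f = "laplacian G (schouten_scalar G)",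
          OF _ laplacian_J y]) (intro sm_ops)
  have 4: "codiff G (\<lambda>y. endo G (schouten G) y *v differential (schouten_scalar G) y) y = (1 / 4) * div_op (ds K) theta z"
  proof -
    have "codiff G (\<lambda>y. endo G (schouten G) y *v differential (schouten_scalar G) y) y
        = - div_op (\<lambda>z. (- 1 / 2) *\<^sub>R ds K z) (\<lambda>z. (1 / 2) * theta z) (y, 0)"
      by (rule codiff_eq_div_op[where Q = "\<lambda>z. (- 1 / 2) *\<^sub>R ds K z" and F = "\<lambda>z. (1 / 2) * theta z",
            OF y G _ _ _ J_eq])
        (assumption, intro sm_ops, simp add: endo_eq schouten_boundary D_K matrix_mul_simps matrix_mul_assoc, intro sm_ops)
    moreover have "div_op (\<lambda>z. (- 1 / 2) *\<^sub>R ds K z) (\<lambda>z. (1 / 2) * theta z) (y, 0)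
        = (- 1 / 2) * ((1 / 2) * div_op (ds K) theta (y, 0))"
      by (simp only: div_op_scaleR div_op_cmult sm_ops y grad_inner_const add_0_right)
    ultimately show ?thesis by (simp add: z_def)
  qed
  have "fact 3 * fact 2 * 2 ^ 5 = (384 :: real)" by (simp add: fact_numeral)
  then show ?thesis
    unfolding Q6_def Let_def 1 2 3 4 norm_P_eq[OF y] laplacian_J[OF y] J_eq[OF y] n
    using v6_eq[OF y n6]
    by (simp flip: z_def) (simp add: field_simps power2_eq_square power3_eq_cube)
qed


text \<open>The operator of the theorem, with all terms expanded by the product rules for
  operators in divergence form, coincides with the expansion of the ambient operator.\<close>

lemma gjms_expansion:
  assumes f: "sm f" and y: "(y, 0) \<in> \<Omega>"
  defines "z \<equiv> (y, 0)" and "m \<equiv> real CARD('n) / 2"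
  shows "amb (- 1 - m) (amb (1 - m) (amb (3 - m) f)) z
    = Lap (Lap (Lap f)) z - Lap (div_op QT2 f) z - div_op QT2 (Lap f) z
      + (m - 1) * (Lap (\<lambda>z. theta z * Lap f z) z / 2) - div_op QT4 f z - (m - 3) * (Q6 G y * f z)"
proof -
  have z: "z \<in> \<Omega>" using y by (simp add: z_def)
  have n: "real CARD('n) = 2 * m" by (simp add: m_def)
  note sms = sm_ops f
  let ?t = theta and ?u = "ds theta" and ?E = "div_op (ds K)"
  let ?g = "grad_inner K" and ?e = "grad_inner (ds K)"
  have K': "transpose (ds K z) = ds K z" if "z \<in> \<Omega>" for z
    by (rule D_symmetric[OF sm_K K_sym that])
  have gs: "?g f g z = ?g g f z" "?e f g z = ?e g f z" for f g
    using grad_inner_sym[of K z f g] grad_inner_sym[of "ds K" z f g] K'[OF z] z by simp_all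
  have QT2: "div_op QT2 h z = (m - 1) * (?t z * Lap h z + ?g ?t h z) + 4 * ?E h z" if "sm h" "z \<in> \<Omega>" for h z
  proof -
    have "div_op QT2 h z = (m - 1) * ?t z * Lap h z + ?g (\<lambda>z. (m - 1) * ?t z) h z + 4 * ?E h z"
      unfolding QT2_def[abs_def] using that
      by (simp add: div_op_add_left div_op_scaleR sm_ops n)
    moreover have "?g (\<lambda>z. (m - 1) * ?t z) h z = (m - 1) * ?g ?t h z"
      using grad_inner_mult(1)[OF sm_rules(1) sm_theta that(2), of K "m - 1"] by simp
    ultimately show ?thesis by (simp add: algebra_simps)
  qed
  have LQT2: "Lap (div_op QT2 f) z = (m - 1) * (Lap (\<lambda>z. ?t z * Lap f z) z + Lap (?g ?t f) z) + 4 * Lap (?E f) z"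
  proof -
    have "Lap (div_op QT2 f) z = Lap (\<lambda>z. (m - 1) * (?t z * Lap f z + ?g ?t f z) + 4 * ?E f z) z"
      unfolding z_def by (rule div_op_slice_cong[OF sm_K sm_K _ _ refl _ y])
        (intro sms sm_QT2, intro sms, rule QT2[OF f])
    then show ?thesis using z f by (simp add: div_op_add div_op_cmult sm_ops)
  qed
  have QT4: "div_op QT4 f z = coeff4 z * Lap f z + ?g coeff4 f z - 4 * (m - 1) * (?t z * ?E f z + ?e ?t f z)
      - 8 * div_op (ds (ds K)) f z"
  proof -
    have "?e (\<lambda>z. (- 4 * (m - 1)) * ?t z) f z = (- 4 * (m - 1)) * ?e ?t f z"
      using grad_inner_mult(1)[OF sm_rules(1) sm_theta z, of "ds K" "- 4 * (m - 1)"] by simp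
    moreover have "div_op QT4 f z = coeff4 z * Lap f z + ?g coeff4 f z
        + ((- 4 * (m - 1)) * ?t z * ?E f z + ?e (\<lambda>z. (- 4 * (m - 1)) * ?t z) f z)
        + (- 8) * div_op (ds (ds K)) f z"
    proof -
      have m: "real CARD('n) / 2 - 1 = m - 1" by (simp add: m_def)
      show ?thesis unfolding QT4_def[abs_def] m
        by (simp only: div_op_add_left div_op_scaleR sm_ops sm_coeff4 z f grad_inner_const add_0_right)
    qed
    ultimately show ?thesis by (simp add: algebra_simps)
  qed
  have gcoeff: "?g coeff4 f z = (- (3 * (m - 1)\<^sup>2 - 4) / 4) * (2 * ?t z * ?g ?t f z)
      - 2 * (2 * m - 4) * ?g ?u f z + (m - 3) * ?g (Lap ?t) f z"
  proof -
    have c: "?g (\<lambda>z. c * h z) f z = c * ?g h f z" if "sm h" for c h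
      using grad_inner_mult(1)[OF sm_rules(1) that z, of K c] by simp
    have "?g coeff4 f z = (- (3 * (m - 1)\<^sup>2 - 4) / 4) * ?g (\<lambda>z. ?t z * ?t z) f z
      + (- 2 * (2 * m - 4)) * ?g ?u f z + ((2 * m - 6) / 2) * ?g (Lap ?t) f z"
      unfolding coeff4_def[abs_def] n
      by (simp only: grad_inner_add(1) c sm_ops z) simp
    then show ?thesis using z by (simp add: grad_inner_mult sm_ops) (simp add: field_simps)
  qed
  have coeff: "coeff4 z = (- (3 * (m - 1)\<^sup>2 - 4) / 4) * (?t z)\<^sup>2 - 2 * (2 * m - 4) * ?u z + (m - 3) * Lap ?t z"
    unfolding coeff4_def n by (simp add: power2_eq_square field_simps)
  have Ltf: "Lap (\<lambda>z. ?t z * f z) z = ?t z * Lap f z + f z * Lap ?t z + 2 * ?g ?t f z" if "z \<in> \<Omega>" for z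
    using div_op_mult[OF sm_K sm_theta f that] that by simp
  have Luf: "Lap (\<lambda>z. ?u z * f z) z = ?u z * Lap f z + f z * Lap ?u z + 2 * ?g ?u f z"
    using div_op_mult[OF sm_K sm_rules(8)[OF sm_theta] f z] z by simp
  have LLtf: "Lap (Lap (\<lambda>z. ?t z * f z)) z = Lap (\<lambda>z. ?t z * Lap f z) z
      + (f z * Lap (Lap ?t) z + Lap ?t z * Lap f z + 2 * ?g f (Lap ?t) z) + 2 * Lap (?g ?t f) z"
  proof -
    have "Lap (Lap (\<lambda>z. ?t z * f z)) z = Lap (\<lambda>z. ?t z * Lap f z + f z * Lap ?t z + 2 * ?g ?t f z) z"
      unfolding z_def by (rule div_op_slice_cong[OF sm_K sm_K _ _ refl Ltf y]) (intro sms)+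
    then show ?thesis using z f
      by (simp add: div_op_add div_op_cmult sm_ops div_op_mult[of K f "Lap ?t"])
  qed
  have LtLf: "Lap (\<lambda>z. ?t z * Lap f z) z = ?t z * Lap (Lap f) z + Lap f z * Lap ?t z + 2 * ?g ?t (Lap f) z"
    using div_op_mult[OF sm_K sm_theta sm_div_op[OF sm_K f] z] z by simp
  have Lttf: "Lap (\<lambda>z. ?t z * (?t z * f z)) z = ?t z * (?t z * Lap f z + f z * Lap ?t z + 2 * ?g ?t f z)
      + (?t z * f z) * Lap ?t z + 2 * (?t z * ?g ?t f z + f z * ?g ?t ?t z)"
    using div_op_mult[OF sm_K sm_theta _ z, of "\<lambda>z. ?t z * f z"] z f
    by (simp add: sm_ops Ltf grad_inner_mult)
  have Ltt: "Lap (\<lambda>z. ?t z * ?t z) z = 2 * ?t z * Lap ?t z + 2 * ?g ?t ?t z"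
    using div_op_mult[OF sm_K sm_theta sm_theta z] z by simp
  have L1tf: "Lap1 (\<lambda>z. ?t z * f z) z = ?t z * ?E f z + f z * ?E ?t z + 2 * ?e ?t f z
      + (?t z * ?g ?t f z + f z * ?g ?t ?t z) / 2"
    using z f K'[OF z] by (simp add: Lap1_def div_op_mult sm_ops grad_inner_mult)
  have LL1: "Lap (Lap1 f) z = Lap (?E f) z + Lap (?g ?t f) z / 2"
  proof -
    have "Lap (Lap1 f) z = Lap (\<lambda>z. ?E f z + (1 / 2) * ?g ?t f z) z"
      unfolding z_def by (rule div_op_slice_cong[OF sm_K sm_K _ _ refl _ y]) (intro sms, intro sms, simp add: Lap1_def)
    then show ?thesis using z f by (simp only: div_op_add div_op_cmult sm_ops)
  qed
  \<comment> \<open>For $n = 6$ both sides vanish.\<close>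
  have Q6: "(m - 3) * (Q6 G y * f z) = (m - 3) * (((?t z) ^ 3 + 6 * ?t z * ?u z + 4 * ds ?u z
    - (m + 1) / 4 * (2 * ?t z * Lap ?t z + 2 * ?g ?t ?t z) - 2 * Lap ?u z - 2 * ?E ?t z
    + Lap (Lap ?t) z / 2 - (m - 3) / 4 * ?t z * Lap ?t z
    + (2 * m - 6) * ?t z * ?u z + (m\<^sup>2 - 9) / 8 * (?t z) ^ 3) * f z)"
  proof (cases "CARD('n) = 6")
    case True then show ?thesis by (simp add: m_def)
  next
    case False
    show ?thesis using Q6_eq[OF y False] by (simp add: Ltt flip: m_def z_def)
  qed
  show ?thesis
    unfolding amb_cube[OF f y, folded z_def m_def] Q6 LQT2 QT2[OF sm_div_op[OF sm_K f] z] QT4 gcoeff coeff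
      LLtf LtLf Lttf L1tf LL1 Ltf[OF z] Luf
    by (simp add: Lap1_def Lap2_def gs[of f "Lap ?t"])
      (simp add: field_simps power2_eq_square power3_eq_cube)
qed

end

section \<open>The theorem\<close>

text \<open>The inverse of a chart is continuous, so that neighbourhoods of the zero section of the manifold are
  open in coordinates.\<close>

lemma open_chart_domain:
  assumes M: "smooth_manifold X A" and c: "c \<in> A" and D: "zero_section_nbhd X D"
  shows "open (chart_domain c D)"
    and "\<And>y. y \<in> chart_image c \<Longrightarrow> chart_inv c y \<in> fst c \<and> snd c (chart_inv c y) = y"
    and "\<And>y. y \<in> chart_image c \<Longrightarrow> (y, 0) \<in> chart_domain c D"
    and "\<And>p. p \<in> fst c \<Longrightarrow> snd c p \<in> chart_image c \<and> chart_inv c (snd c p) = p"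
proof -
  let ?V = "chart_image c"
  have U: "openin X (fst c)" "open ?V"
    and h: "homeomorphic_map (subtopology X (fst c)) (top_of_set ?V) (snd c)"
    using M c by (auto simp: smooth_manifold_def)
  have UX: "fst c \<subseteq> topspace X" by (rule openin_subset[OF U(1)])
  have inj: "inj_on (snd c) (fst c)"
    using homeomorphic_imp_injective_map[OF h] UX by (simp add: Int_absorb1)
  show inv: "chart_inv c y \<in> fst c \<and> snd c (chart_inv c y) = y" if "y \<in> ?V" for y
    using that unfolding chart_inv_def chart_image_def by (simp add: inv_into_into f_inv_into_f)
  show "snd c p \<in> ?V \<and> chart_inv c (snd c p) = p" if "p \<in> fst c" for p
    using that inj by (simp add: chart_image_def chart_inv_def)
  show "(y, 0) \<in> chart_domain c D" if "y \<in> ?V" for y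
    using inv[OF that] UX D that by (auto simp: chart_domain_def zero_section_nbhd_def)
  obtain k where k: "homeomorphic_maps (subtopology X (fst c)) (top_of_set ?V) (snd c) k"
    using h homeomorphic_map_maps by blast
  have "k y = chart_inv c y" if "y \<in> ?V" for y
    using k inv[OF that] UX by (auto simp: homeomorphic_maps_def Int_absorb1)
  then have cont: "continuous_map (top_of_set ?V) X (chart_inv c)"
    using k by (auto simp: homeomorphic_maps_def continuous_map_in_subtopology intro: continuous_map_eq)
  have "continuous_map (prod_topology (top_of_set ?V) euclideanreal) (prod_topology X euclideanreal)
      (\<lambda>z. (chart_inv c (fst z), snd z))"
    using continuous_map_compose[OF continuous_map_fst cont, of euclideanreal]
    by (intro continuous_map_pairedI continuous_map_snd) (simp add: o_def)
  from openin_continuous_map_preimage[OF this, of D]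
  have "openin (prod_topology (top_of_set ?V) euclideanreal)
      {z \<in> topspace (prod_topology (top_of_set ?V) euclideanreal). (chart_inv c (fst z), snd z) \<in> D}"
    using D by (simp add: zero_section_nbhd_def)
  moreover have "{z \<in> topspace (prod_topology (top_of_set ?V) euclideanreal). (chart_inv c (fst z), snd z) \<in> D}
      = chart_domain c D"
    by (auto simp: chart_domain_def)
  moreover have "prod_topology (top_of_set ?V) euclideanreal = top_of_set (?V \<times> UNIV)"
    using prod_topology_subtopology_eu[of ?V UNIV] by simp
  ultimately have "openin (top_of_set (?V \<times> UNIV)) (chart_domain c D)" by simp
  then show "open (chart_domain c D)"
    using U(2) by (metis open_Times open_UNIV openin_open_eq)
qed

theorem theorem10p2:
  fixes X :: "'m topology"
    and A :: "('m, 'n::finite) chart set"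
    and g :: "('m, 'n) tensor2"
    and gr h :: "real \<Rightarrow> ('m, 'n) tensor2"
    and D E :: "('m \<times> real) set"
    and u :: "'m \<Rightarrow> real"
    and U :: "'m \<Rightarrow> real \<Rightarrow> real"
    and c :: "('m, 'n) chart"
    and p :: 'm
  assumes "CARD('n) \<ge> 3" and "CARD('n) \<noteq> 4"
    and "smooth_manifold X A"
    and "riemannian_metric X A g"
    and "poincare_einstein X A g D gr"
    and "ambient_family X A D gr E h"
    and "smooth_function A u"
    and "smooth_extension X A E u U"
    and "c \<in> A" and "p \<in> fst c"
  shows "gjms 3 (\<lambda>\<rho>. h \<rho> c) (\<lambda>y. U (chart_inv c y)) (snd c p) =
    (let n = real CARD('n); G = g c; f = u \<circ> chart_inv c; x = snd c p; J = schouten_scalar G in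
      laplacian G (laplacian G (laplacian G f)) x
      + laplacian G (codiff G (\<lambda>y. T2 G y *v differential f y)) x
      + codiff G (\<lambda>y. T2 G y *v differential (laplacian G f) y) x
      + (n / 2 - 1) * laplacian G (\<lambda>y. J y * laplacian G f y) x
      + codiff G (\<lambda>y. T4 G y *v differential f y) x
      - (n / 2 - 3) * Q6 G x * f x)"
proof -
  note M = assms(3) and c = assms(9)
  let ?\<Omega> = "chart_domain c E" and ?H = "\<lambda>(y, s). h s c y" and ?gr = "\<lambda>r. gr r c" and ?G = "g c"
  \<comment> \<open>Where \<open>ambient_family\<close> identifies \<open>gr r\<close> with \<open>h (- r\<^sup>2 / 2)\<close>.\<close>
  let ?N = "{z. snd z > 0} \<inter> chart_domain c D \<inter> (\<lambda>z. (fst z, - (snd z)\<^sup>2 / 2)) -` ?\<Omega>"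
  have nD: "zero_section_nbhd X D" and nE: "zero_section_nbhd X E"
    using assms(5,6) by (auto simp: poincare_einstein_def ambient_family_def)
  note dD = open_chart_domain[OF M c nD] and dE = open_chart_domain[OF M c nE]
  have fam: "gr r c y = h (- r\<^sup>2 / 2) c y" if "(y, r) \<in> chart_domain c D" "(y, - r\<^sup>2 / 2) \<in> ?\<Omega>" for y r
  proof -
    have y: "y \<in> chart_image c" and D: "(chart_inv c y, r) \<in> D" and E: "(chart_inv c y, - r\<^sup>2 / 2) \<in> E"
      using that by (auto simp: chart_domain_def)
    have "h (- r\<^sup>2 / 2) c (snd c (chart_inv c y)) = gr r c (snd c (chart_inv c y))"
      using assms(6) D E c dD(2)[OF y] unfolding ambient_family_def by blast
    then show ?thesis using dD(2)[OF y] by simp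
  qed
  have slice: "y \<in> chart_image c" if "(y, s) \<in> ?\<Omega>" for y s
    using that by (simp add: chart_domain_def)
  have openN: "open ?N"
    by (intro open_Int dD(1) open_vimage[OF dE(1)] open_Collect_less continuous_intros) auto
  interpret einstein_family ?\<Omega> ?H ?gr ?N ?G
  proof (unfold_locales)
    show "open ?\<Omega>" by (rule dE(1))
    show "smooth_on ?\<Omega> ?H" using assms(6) c by (auto simp: ambient_family_def metric_family_def)
    show "positive_definite (?H z)" if "z \<in> ?\<Omega>" for z
      using assms(6) c that by (auto simp: ambient_family_def metric_family_def)
    show "open ?N" by (rule openN)
    show "r \<noteq> 0 \<and> (y, - r\<^sup>2 / 2) \<in> ?\<Omega> \<and> gr r c y = ?H (y, - r\<^sup>2 / 2)" if "(y, r) \<in> ?N" for y r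
      using that fam by auto
    show "\<forall>\<^sub>F r in at_right 0. (y, r) \<in> ?N" if "(y, 0) \<in> ?\<Omega>" for y
    proof -
      have t: "((\<lambda>r. (y, r)) \<longlongrightarrow> (y, 0)) (at_right 0)" by (intro tendsto_intros)
      have "\<forall>\<^sub>F r in at_right 0. (y, r) \<in> chart_domain c D"
        by (rule topological_tendstoD[OF t dD(1) dD(3)[OF slice[OF that]]])
      moreover have "((\<lambda>r. (y, - r\<^sup>2 / 2)) \<longlongrightarrow> (y, - 0\<^sup>2 / 2)) (at_right (0::real))" by (intro tendsto_intros) auto
      then have "\<forall>\<^sub>F r in at_right 0. (y, - r\<^sup>2 / 2) \<in> ?\<Omega>"
        by (rule topological_tendstoD[OF _ dE(1)]) (use that in simp)
      ultimately show ?thesis using eventually_at_right_less[of "0::real"]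
        by eventually_elim simp
    qed
    show "asymptotically_einstein ?G ?gr y" if "(y, 0) \<in> ?\<Omega>" for y
      using assms(5) c slice[OF that] by (auto simp: poincare_einstein_def)
    show "?G y = ?H (y, 0)" if "(y, 0) \<in> ?\<Omega>" for y
      using fam[of y 0] dD(3) that slice[OF that] assms(5) c by (auto simp: poincare_einstein_def)
    show "CARD('n) \<ge> 3" "CARD('n) \<noteq> 4" by (rule assms)+
  qed
  interpret ambient ?\<Omega> ?H "\<lambda>\<rho>. h \<rho> c" by unfold_locales simp
  define x where "x = snd c p"
  define f where "f = u \<circ> chart_inv c"
  define F where "F = (\<lambda>(y, s). U (chart_inv c y) s)"
  let ?m = "real CARD('n) / 2"
  have x: "(x, 0) \<in> ?\<Omega>" unfolding x_def using dE(3,4) assms(10) by blast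
  have F: "sm F" using assms(8) c by (auto simp: smooth_extension_def F_def)
  have fF: "f y = F (y, 0)" if "(y, 0) \<in> ?\<Omega>" for y
  proof -
    have "chart_inv c y \<in> topspace X"
      using dE(2)[OF slice[OF that]] M c by (auto simp: smooth_manifold_def)
    then show ?thesis using assms(8) by (simp add: smooth_extension_def f_def F_def)
  qed
  have L1: "laplacian ?G f y = Lap F (y, 0)" if "(y, 0) \<in> ?\<Omega>" for y
    by (rule laplacian_eq_Lap[where F = F and f = f, OF that G F fF])
  have L2: "laplacian ?G (laplacian ?G f) y = Lap (Lap F) (y, 0)" if "(y, 0) \<in> ?\<Omega>" for y
    by (rule laplacian_eq_Lap[where F = "Lap F", OF that G _ L1]) (assumption, intro sm_ops F)
  have L3: "laplacian ?G (laplacian ?G (laplacian ?G f)) x = Lap (Lap (Lap F)) (x, 0)"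
    by (rule laplacian_eq_Lap[where F = "Lap (Lap F)", OF x G _ L2]) (assumption, intro sm_ops F)
  have C1: "codiff ?G (\<lambda>y. T2 ?G y *v differential f y) y = (- 1) * div_op QT2 F (y, 0)" if "(y, 0) \<in> ?\<Omega>" for y
    using codiff_eq_div_op[where Q = QT2 and F = F and f = f, OF that G sm_QT2 K_T2 F fF] by simp
  have C2: "laplacian ?G (codiff ?G (\<lambda>y. T2 ?G y *v differential f y)) x = (- 1) * Lap (div_op QT2 F) (x, 0)"
    by (rule laplacian_cmult[where F = "div_op QT2 F", OF _ C1 x]) (intro sm_ops sm_QT2 F)
  have C3: "codiff ?G (\<lambda>y. T2 ?G y *v differential (laplacian ?G f) y) x = - div_op QT2 (Lap F) (x, 0)"
    by (rule codiff_eq_div_op[where Q = QT2 and F = "Lap F", OF x G sm_QT2 K_T2 _ L1])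
      (assumption, assumption, intro sm_ops F)
  have C4: "codiff ?G (\<lambda>y. T4 ?G y *v differential f y) x = - div_op QT4 F (x, 0)"
    by (rule codiff_eq_div_op[where Q = QT4 and F = F, OF x G sm_QT4 K_T4 F fF])
  have C5: "laplacian ?G (\<lambda>y. schouten_scalar ?G y * laplacian ?G f y) x = (1 / 2) * Lap (\<lambda>z. theta z * Lap F z) (x, 0)"
    by (rule laplacian_cmult[where F = "\<lambda>z. theta z * Lap F z", OF _ _ x]) (intro sm_ops F, simp add: J_eq L1)
  have "gjms 3 (\<lambda>\<rho>. h \<rho> c) (\<lambda>y. U (chart_inv c y)) x = amb (- 1 - ?m) (amb (1 - ?m) (amb (3 - ?m) F)) (x, 0)"
    using gjms_eq_amb[OF x, of "\<lambda>y. U (chart_inv c y)"] F by (simp add: F_def)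
  also note gjms_expansion[OF F x]
  finally show ?thesis
    unfolding Let_def x_def[symmetric] f_def[symmetric] L3 C2 C3 C4 C5
    by (simp add: fF[OF x])
qed

end
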